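(* Let $\lambda,\mu>0$ with $\lambda\mu<1$, and let $L_{\lambda,\mu}$ be the Hammersley process with sources of intensity $\lambda$, sinks of intensity $\mu$ and $\alpha$-points of intensity $1$. Let $X_t$ be the $x$-coordinate at time $t$ of a second class particle starting at zero. Then for every $a\ge 0$, $$\lim_{x\to\infty}P(X_{ax}>x)=\begin{cases} 1, & a\ge 1/\mu^2,\\[2pt] \dfrac{\sqrt{a}-\lambda}{1/\mu-\lambda}, & 1/\mu^2>a\ge\lambda^2,\\[4pt] 0, & \lambda^2>a\ge 0.\end{cases}$$
   Context: Hammersley process with sources and sinks. Take three independent homogeneous Poisson processes: a process of "sources" on the positive $x$-axis $(0,\infty)\times\{0\}$ with intensity $\lambda$, a process of "sinks" on the positive $t$-axis $\{0\}\times(0,\infty)$ with intensity $\mu$, and a process of "$\alpha$-points" in $(0,\infty)^2$ with intensity $1$ (Lebesgue measure). The vertical coordinate $t$ is time. The Hammersley process is the evolving (locally finite) particle configuration $\eta_t$ on $(0,\infty)$ defined as follows. At time $0$ the particles are located at the sources. When an $\alpha$-point $(u,s)$ occurs, the particle immediately to the right of $u$ jumps at time $s$ to $u$. When a sink $(0,s)$ occurs, the leftmost particle disappears at time $s$ (it exits through the $t$-axis). Nothing else changes. This is well defined because for each $R>0$ the restriction of $\eta_t$ to $(0,R]$ evolves autonomously: at an $\alpha$-point $(u,s)$ with $u\le R$, the leftmost particle in $(u,R]$, if any, is removed and a particle is put at $u$; at a sink, the leftmost particle in $(0,R]$, if any, is removed; these restrictions are consistent as $R$ varies. Second class particle. It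 is created by putting an extra source at the origin: let $\eta^+_t$ be the configuration on $[0,\infty)$ evolving by the same rules with the same sources, sinks and $\alpha$-points, but with one additional particle at $0$ at time $0$. Almost surely, for all $t$, $\eta^+_t$ consists of the particles of $\eta_t$ plus exactly one more particle, whose location is $X_t$. Equivalently, $X_0=0$, and $X$ stays constant except that whenever a particle of $\eta$ at a position $y>X_{s-}$ jumps at time $s$ to a position $u<X_{s-}$ (because of an $\alpha$-point) or exits through a sink, $X_s=y$. *)

theory Defs
  imports "HOL-Probability.Probability"
begin

text \<open>A point process on a region is represented by a random set of points: for every outcome,
  a subset of the region with only finitely many points in each bounded set.  In particular points
  may not accumulate at the boundary of the region (for the quadrant: at the axes).
  The Poisson distribution of the counts is written out because \<open>poisson_pmf\<close> is only specified for
  positive rates, whereas the rate is \<open>0\<close> on null sets.\<close>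

definition poisson_process ::
  "'w measure \<Rightarrow> 'a::euclidean_space set \<Rightarrow> real \<Rightarrow> ('w \<Rightarrow> 'a set) \<Rightarrow> bool" where
  "poisson_process M E c A \<longleftrightarrow>
     (\<forall>w\<in>space M. A w \<subseteq> E \<and> (\<forall>B. bounded B \<longrightarrow> finite (A w \<inter> B))) \<and>
     (\<forall>B\<in>sets borel. bounded B \<and> B \<subseteq> E \<longrightarrow>
        (\<lambda>w. card (A w \<inter> B)) \<in> M \<rightarrow>\<^sub>M count_space UNIV \<and>
        (\<forall>k. measure M {w \<in> space M. card (A w \<inter> B) = k} =
          (c * measure lborel B) ^ k / fact k * exp (- (c * measure lborel B)))) \<and>
     (\<forall>D. finite D \<and> disjoint D \<and> (\<forall>B\<in>D. B \<in> sets borel \<and> bounded B \<and> B \<subseteq> E) \<longrightarrow>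
        prob_space.indep_vars M (\<lambda>_. count_space UNIV) (\<lambda>B w. card (A w \<inter> B)) D)"

definition point_process_events :: "'w measure \<Rightarrow> ('w \<Rightarrow> 'a::euclidean_space set) \<Rightarrow> 'w set set" where
  "point_process_events M A =
     sigma_sets (space M)
       {{w \<in> space M. card (A w \<inter> B) = k} | B k. B \<in> sets borel \<and> bounded B}"

definition independent_point_processes ::
  "'w measure \<Rightarrow> ('w \<Rightarrow> 'a::euclidean_space set) \<Rightarrow> ('w \<Rightarrow> 'b::euclidean_space set) \<Rightarrow>
    ('w \<Rightarrow> 'c::euclidean_space set) \<Rightarrow> bool" where
  "independent_point_processes M A B C \<longleftrightarrow>
     prob_space.indep_sets M
       (\<lambda>i. [point_process_events M A, point_process_events M B, point_process_events M C] ! i)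
       {0, 1, 2::nat}"

text \<open>Configurations of particles are sets of positions.  \<open>leftmost D\<close> is the singleton of the least
  element of \<open>D\<close>, and empty if \<open>D\<close> is empty.\<close>

definition leftmost :: "real set \<Rightarrow> real set" where
  "leftmost D = {y \<in> D. \<forall>z\<in>D. y \<le> z}"

datatype event = Sink | Alpha_Point real

fun apply_event :: "event \<Rightarrow> real set \<Rightarrow> real set" where
  "apply_event Sink C = C - leftmost C"
| "apply_event (Alpha_Point u) C = insert u (C - leftmost {y \<in> C. u < y})"

text \<open>The events up to time \<open>t\<close> that are relevant for the particles at positions at most \<open>R\<close>, in
  chronological order.  A pair \<open>(u, s)\<close> in \<open>alp\<close> is an \<open>\<alpha>\<close>-point at position \<open>u\<close> and time \<open>s\<close>.
  Almost surely no two events are simultaneous, so the order chosen among simultaneous events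
  (sink first, then from left to right) is immaterial.\<close>

definition event_list :: "real set \<Rightarrow> (real \<times> real) set \<Rightarrow> real \<Rightarrow> real \<Rightarrow> event list" where
  "event_list snk alp R t =
     concat (map
       (\<lambda>s. (if s \<in> snk then [Sink] else []) @
            map Alpha_Point (sorted_list_of_set {u. u \<le> R \<and> (u, s) \<in> alp}))
       (sorted_list_of_set {s. s \<le> t \<and> (s \<in> snk \<or> (\<exists>u\<le>R. (u, s) \<in> alp))}))"

definition hammersley_restricted ::
  "real set \<Rightarrow> real set \<Rightarrow> (real \<times> real) set \<Rightarrow> real \<Rightarrow> real \<Rightarrow> real set" where
  "hammersley_restricted src snk alp R t =
     fold apply_event (event_list snk alp R t) (src \<inter> {..R})"

text \<open>The restricted evolutions are consistent: for \<open>R \<le> R'\<close> the particles at positions at most \<open>R\<close>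
  are the same in both.\<close>

definition hammersley ::
  "real set \<Rightarrow> real set \<Rightarrow> (real \<times> real) set \<Rightarrow> real \<Rightarrow> real set" where
  "hammersley src snk alp t = (\<Union>R. hammersley_restricted src snk alp R t)"

text \<open>On the null event where no such position exists, the value below is one fixed real number,
  so that measurability in the outcome is not affected.\<close>

definition second_class_particle ::
  "real set \<Rightarrow> real set \<Rightarrow> (real \<times> real) set \<Rightarrow> real \<Rightarrow> real" where
  "second_class_particle src snk alp t =
     (THE x. x \<notin> hammersley src snk alp t \<and>
             hammersley (insert 0 src) snk alp t = insert x (hammersley src snk alp t))"

end

theory Submission
  imports Defs "HOL-Real_Asymp.Real_Asymp"
begin

text \<open>The quadrant is discretised into small cells; the occupied cells form a field of independent
  Bernoulli variables, and the Hammersley process becomes a last passage percolation model on a grid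
  that satisfies an exact Burke property.  Comparing the source of the first column with a stationary
  one shows that the mean \<open>u\<close> of the passage time satisfies the discrete form of
  \<open>\<partial>u/\<partial>x = lam + (1/mu - lam) * P(X\<^sub>t > x)\<close>.  For \<open>lam * mu = 1\<close> this gives the stationary mean
  \<open>lam * x + t / lam\<close> and hence upper bounds for \<open>u\<close>.  Matching lower bounds follow from the constant \<open>2\<close>
  for the model without sources and sinks: the Efron-Stein inequality bounds the variance of a passage
  time by its mean, and changing the stationary parameter shows that optimal paths of the stationary model
  leave the axes after a negligible distance.  Since \<open>P(X\<^sub>t > x)\<close> is monotone in \<open>x\<close>, the asymptotics of \<open>u\<close>
  determine its limit.  The particle positions depend only on the relative order of the coordinates of
  the points, so that the event \<open>X\<^sub>t > x\<close> is, for every outcome, decided on a sufficiently fine grid.\<close>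

section \<open>Product Bernoulli measures on finite sets\<close>

text \<open>In the limit \<open>u\<close> at \<open>(x, a * x)\<close> is \<open>x\<close> times the
  minimum of \<open>\<rho> + a / \<rho>\<close> over the slopes \<rho> between \<open>lam\<close>
  and \<open>1 / mu\<close>: every dominating stationary system gives an upper bound
  \<open>\<rho> * x + t / \<rho>\<close>, and the best of these is attained. At the minimiser the
  derivative in \<open>x\<close> is \<rho> itself, that is \<open>sqrt a\<close> clipped to the
  interval from \<open>lam\<close> to \<open>1 / mu\<close>. Solving
  \<open>lam + (1/mu - lam) * P = \<rho>\<close> for \<open>P\<close> yields the three cases of the
  theorem. The obstacle is that convergence of \<open>u\<close> says nothing about its derivative;
  monotonicity of the probability traps it between secant slopes over blocks of columns. On a grid
  all expectations are finite sums, and Burke's theorem is an induction over the rows with one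
  algebraic identity. The price is an iterated limit: the mesh is refined for fixed \<open>x\<close>
  and \<open>t\<close>, then \<open>x\<close> grows with a fixed number of blocks, and only then the
  number of blocks grows.\<close>

definition bexp :: "'a set \<Rightarrow> ('a \<Rightarrow> real) \<Rightarrow> ('a set \<Rightarrow> real) \<Rightarrow> real" where
  "bexp I p f = (\<Sum>S\<in>Pow I. (\<Prod>i\<in>S. p i) * (\<Prod>i\<in>I - S. 1 - p i) * f S)"

lemma bexp_empty [simp]: "bexp {} p f = f {}"
  by (simp add: bexp_def)

lemma bexp_cong:
  assumes "\<And>i. i \<in> I \<Longrightarrow> p i = q i" "\<And>S. S \<subseteq> I \<Longrightarrow> f S = g S"
  shows "bexp I p f = bexp I q g"
  unfolding bexp_def
proof (rule sum.cong)
  fix S assume S: "S \<in> Pow I"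
  have "(\<Prod>i\<in>S. p i) = (\<Prod>i\<in>S. q i)" by (rule prod.cong) (use S assms in auto)
  moreover have "(\<Prod>i\<in>I-S. 1 - p i) = (\<Prod>i\<in>I-S. 1 - q i)" by (rule prod.cong) (use S assms in auto)
  ultimately show "(\<Prod>i\<in>S. p i) * (\<Prod>i\<in>I - S. 1 - p i) * f S = (\<Prod>i\<in>S. q i) * (\<Prod>i\<in>I - S. 1 - q i) * g S"
    using S assms(2) by simp
qed simp

lemma bexp_insert:
  assumes "finite I" "k \<notin> I"
  shows "bexp (insert k I) p f = p k * bexp I p (\<lambda>S. f (insert k S)) + (1 - p k) * bexp I p f"
proof -
  let ?w = "\<lambda>J S. (\<Prod>i\<in>S. p i) * (\<Prod>i\<in>J - S. 1 - p i)"
  have inj: "inj_on (insert k) (Pow I)"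
    using assms(2) by (auto simp: inj_on_def)
  have "bexp (insert k I) p f = (\<Sum>S\<in>Pow I. ?w (insert k I) S * f S)
      + (\<Sum>S\<in>insert k ` Pow I. ?w (insert k I) S * f S)"
    unfolding bexp_def Pow_insert using assms by (intro sum.union_disjoint) auto
  also have "(\<Sum>S\<in>insert k ` Pow I. ?w (insert k I) S * f S)
      = (\<Sum>S\<in>Pow I. ?w (insert k I) (insert k S) * f (insert k S))"
    by (simp add: sum.reindex[OF inj])
  also have "\<dots> = p k * bexp I p (\<lambda>S. f (insert k S))"
    unfolding bexp_def sum_distrib_left
  proof (rule sum.cong)
    fix S assume S: "S \<in> Pow I"
    have "finite S" "k \<notin> S" using S assms finite_subset by auto
    moreover have "insert k I - insert k S = I - S" using assms S by auto
    ultimately show "?w (insert k I) (insert k S) * f (insert k S) = p k * (?w I S * f (insert k S))"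
      by simp
  qed simp
  also have "(\<Sum>S\<in>Pow I. ?w (insert k I) S * f S) = (1 - p k) * bexp I p f"
    unfolding bexp_def sum_distrib_left
  proof (rule sum.cong)
    fix S assume S: "S \<in> Pow I"
    have "insert k I - S = insert k (I - S)" "k \<notin> I - S" "finite (I - S)" using S assms by auto
    then show "?w (insert k I) S * f S = (1 - p k) * (?w I S * f S)" by simp
  qed simp
  finally show ?thesis by simp
qed

lemma bexp_add: "bexp I p (\<lambda>S. f S + g S) = bexp I p f + bexp I p g"
  by (simp add: bexp_def ring_distribs sum.distrib)

lemma bexp_diff: "bexp I p (\<lambda>S. f S - g S) = bexp I p f - bexp I p g"
  by (simp add: bexp_def ring_distribs sum_subtractf)

lemma bexp_cmult: "bexp I p (\<lambda>S. c * f S) = c * bexp I p f"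
  by (simp add: bexp_def sum_distrib_left mult_ac)

lemma bexp_sum: "bexp I p (\<lambda>S. \<Sum>j\<in>J. f j S) = (\<Sum>j\<in>J. bexp I p (f j))"
  unfolding bexp_def sum_distrib_left by (subst sum.swap) simp

lemma bexp_const [simp]: "finite I \<Longrightarrow> bexp I p (\<lambda>S. c) = c"
  by (induction I rule: finite_induct) (simp_all add: bexp_insert algebra_simps)

definition is_prob_on :: "'a set \<Rightarrow> ('a \<Rightarrow> real) \<Rightarrow> bool" where
  "is_prob_on I p \<longleftrightarrow> (\<forall>i\<in>I. 0 \<le> p i \<and> p i \<le> 1)"

lemma bexp_mono:
  assumes "is_prob_on I p" "\<And>S. S \<subseteq> I \<Longrightarrow> f S \<le> g S"
  shows "bexp I p f \<le> bexp I p g"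
  unfolding bexp_def
  by (intro sum_mono mult_left_mono mult_nonneg_nonneg prod_nonneg)
     (use assms in \<open>auto simp: is_prob_on_def\<close>)

lemma bexp_nonneg:
  assumes "finite I" "is_prob_on I p" "\<And>S. S \<subseteq> I \<Longrightarrow> 0 \<le> f S"
  shows "0 \<le> bexp I p f"
  using bexp_mono[of I p "\<lambda>_. 0" f] assms by simp

lemma bexp_union:
  assumes "finite I" "finite J" "I \<inter> J = {}"
  shows "bexp (I \<union> J) p f = bexp I p (\<lambda>S. bexp J p (\<lambda>T. f (S \<union> T)))"
  using assms(1,3)
proof (induction I arbitrary: f rule: finite_induct)
  case (insert k I)
  have "bexp (insert k (I \<union> J)) p f
      = p k * bexp (I \<union> J) p (\<lambda>S. f (insert k S)) + (1 - p k) * bexp (I \<union> J) p f"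
    using insert assms(2) by (intro bexp_insert) auto
  with insert show ?case by (simp add: bexp_insert)
qed simp

lemma bexp_extend:
  assumes "finite J" "I \<subseteq> J" "\<And>S. S \<subseteq> J \<Longrightarrow> f S = f (S \<inter> I)"
  shows "bexp J p f = bexp I p f"
proof -
  have fin: "finite I" "finite (J - I)" using assms finite_subset by auto
  have "bexp (I \<union> (J - I)) p f = bexp I p (\<lambda>S. bexp (J - I) p (\<lambda>T. f (S \<union> T)))"
    by (rule bexp_union) (use fin in auto)
  also have "\<dots> = bexp I p f"
  proof (intro bexp_cong refl)
    fix S assume S: "S \<subseteq> I"
    have "bexp (J - I) p (\<lambda>T. f (S \<union> T)) = bexp (J - I) p (\<lambda>T. f S)"
    proof (intro bexp_cong refl)
      fix T assume T: "T \<subseteq> J - I"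
      then have "(S \<union> T) \<inter> I = S" using S by auto
      then show "f (S \<union> T) = f S" using assms(3)[of "S \<union> T"] S T assms(2) by auto
    qed
    then show "bexp (J - I) p (\<lambda>T. f (S \<union> T)) = f S" using fin by simp
  qed
  finally show ?thesis using assms(2) by (simp add: Un_absorb1)
qed

lemma bexp_image:
  assumes "finite I" "inj_on \<phi> I"
  shows "bexp (\<phi> ` I) p f = bexp I (p \<circ> \<phi>) (\<lambda>S. f (\<phi> ` S))"
  using assms
proof (induction I arbitrary: f rule: finite_induct)
  case (insert k I)
  have "bexp (insert (\<phi> k) (\<phi> ` I)) p f
      = p (\<phi> k) * bexp (\<phi> ` I) p (\<lambda>S. f (insert (\<phi> k) S)) + (1 - p (\<phi> k)) * bexp (\<phi> ` I) p f"
    using insert by (intro bexp_insert) auto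
  with insert show ?case by (simp add: bexp_insert)
qed simp

text \<open>The presence of \<open>i\<close> is independent of the rest of the set. The identity
  trades a factor \<open>p i\<close> for the presence of \<open>i\<close>, which turns the
  Efron-Stein sum into a sum over the points that are present.\<close>

lemma bexp_mem:
  assumes "finite I" "i \<in> I"
  shows "bexp I p (\<lambda>S. if i \<in> S then g (S - {i}) else 0) = p i * bexp I p (\<lambda>S. g (S - {i}))"
proof -
  define I' where "I' = I - {i}"
  have I: "I = insert i I'" "finite I'" "i \<notin> I'" using assms by (auto simp: I'_def)
  have 1: "bexp I' p (\<lambda>S. if i \<in> S then g (S - {i}) else 0) = 0"
    using I by (subst bexp_cong[where g = "\<lambda>_. 0" and q = p]) auto
  have 2: "bexp I' p (\<lambda>S. g (insert i S - {i})) = bexp I' p g"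
    "bexp I' p (\<lambda>S. g (S - {i})) = bexp I' p g"
    by (rule bexp_cong; use I in \<open>auto intro!: arg_cong[of _ _ g]\<close>)+
  show ?thesis unfolding I(1) using I 1 2 by (simp add: bexp_insert algebra_simps)
qed

lemma bexp_mem1:
  assumes "finite I" "i \<in> I"
  shows "bexp I p (\<lambda>S. of_bool (i \<in> S)) = p i"
  using bexp_mem[OF assms, of p "\<lambda>_. 1"] assms by (simp add: of_bool_def)

lemma bexp_mem2:
  assumes "finite I" "i \<in> I" "j \<in> I" "i \<noteq> j"
  shows "bexp I p (\<lambda>S. of_bool (i \<in> S \<and> j \<in> S)) = p i * p j"
proof -
  have "bexp I p (\<lambda>S. of_bool (i \<in> S \<and> j \<in> S)) = bexp I p (\<lambda>S. if i \<in> S then of_bool (j \<in> S - {i}) else 0)"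
    using assms by (intro bexp_cong) auto
  also have "\<dots> = p i * bexp I p (\<lambda>S. of_bool (j \<in> S - {i}))"
    using assms by (rule_tac bexp_mem) auto
  also have "bexp I p (\<lambda>S. of_bool (j \<in> S - {i})) = p j"
    using assms bexp_mem1[of I j p] by simp
  finally show ?thesis .
qed

text \<open>Induction on the sites: the mean is affine in the probability of \<open>k\<close>, and
  its slope is the mean gain from inserting \<open>k\<close>.\<close>

lemma bexp_mono_prob:
  assumes "finite I" "is_prob_on I p" "is_prob_on I q" "\<And>i. i \<in> I \<Longrightarrow> p i \<le> q i"
    and "\<And>S T. S \<subseteq> T \<Longrightarrow> T \<subseteq> I \<Longrightarrow> f S \<le> f T"
  shows "bexp I p f \<le> bexp I q f"
  using assms
proof (induction I arbitrary: f rule: finite_induct)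
  case (insert k I)
  have pr: "is_prob_on I p" "is_prob_on I q" "0 \<le> p k" "p k \<le> 1" "0 \<le> q k" "q k \<le> 1" "p k \<le> q k"
    using insert.prems by (auto simp: is_prob_on_def)
  have 1: "bexp I p (\<lambda>S. f (insert k S)) \<le> bexp I q (\<lambda>S. f (insert k S))"
    by (rule insert.IH) (use insert.prems pr in \<open>auto intro!: insert.prems(4)\<close>)
  have 0: "bexp I p f \<le> bexp I q f"
    by (rule insert.IH) (use insert.prems pr in \<open>auto intro!: insert.prems(4)\<close>)
  have 2: "bexp I q f \<le> bexp I q (\<lambda>S. f (insert k S))"
    by (rule bexp_mono) (use pr in \<open>auto intro!: insert.prems(4)\<close>)
  have "bexp (insert k I) p f \<le> p k * bexp I q (\<lambda>S. f (insert k S)) + (1 - p k) * bexp I q f"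
    unfolding bexp_insert[OF insert.hyps]
    by (intro add_mono mult_left_mono 0 1) (use pr in linarith)+
  also have "\<dots> = bexp I q f + p k * (bexp I q (\<lambda>S. f (insert k S)) - bexp I q f)"
    by (simp add: algebra_simps)
  also have "\<dots> \<le> bexp I q f + q k * (bexp I q (\<lambda>S. f (insert k S)) - bexp I q f)"
    using pr 2 by (intro add_left_mono mult_right_mono) auto
  also have "\<dots> = bexp (insert k I) q f"
    using insert by (simp add: bexp_insert algebra_simps)
  finally show ?case .
qed simp

section \<open>Variance and the Efron-Stein inequality\<close>

definition bvar :: "'a set \<Rightarrow> ('a \<Rightarrow> real) \<Rightarrow> ('a set \<Rightarrow> real) \<Rightarrow> real" where
  "bvar I p f = bexp I p (\<lambda>S. (f S)\<^sup>2) - (bexp I p f)\<^sup>2"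

lemma bvar_alt:
  assumes "finite I"
  shows "bvar I p f = bexp I p (\<lambda>S. (f S - bexp I p f)\<^sup>2)"
proof -
  define e where "e = bexp I p f"
  have "(f S - e)\<^sup>2 = (f S)\<^sup>2 - 2 * e * f S + e\<^sup>2" for S
    by (simp add: power2_eq_square algebra_simps)
  then have "bexp I p (\<lambda>S. (f S - e)\<^sup>2) = bexp I p (\<lambda>S. (f S)\<^sup>2) - 2 * e * bexp I p f + e\<^sup>2"
    using assms by (simp add: bexp_add bexp_diff bexp_cmult)
  then show ?thesis by (simp add: bvar_def e_def power2_eq_square)
qed

lemma bvar_nonneg: "finite I \<Longrightarrow> is_prob_on I p \<Longrightarrow> 0 \<le> bvar I p f"
  by (simp add: bvar_alt bexp_nonneg)

lemma bexp_abs_dev: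
  assumes "finite I" "is_prob_on I p"
  shows "bexp I p (\<lambda>S. \<bar>f S - bexp I p f\<bar>) \<le> sqrt (bvar I p f)"
proof -
  have "0 \<le> bvar I p (\<lambda>S. \<bar>f S - bexp I p f\<bar>)" using assms by (rule bvar_nonneg)
  then show ?thesis unfolding bvar_alt[OF assms(1), of p f]
    by (intro real_le_rsqrt) (simp add: bvar_def)
qed

text \<open>Conditioning on one site splits the variance into the mean conditional variance, handled
  by induction, and the variance of a conditional mean with two values, bounded by Jensen's
  inequality. The weight \<open>p i\<close> replaces the sharper \<open>p i * (1 - p i)\<close>
  because \<open>bvar_cov\<close> reads it as the presence of \<open>i\<close>.\<close>

lemma efron_stein:
  assumes "finite I" "is_prob_on I p"
  shows "bvar I p f \<le> (\<Sum>i\<in>I. p i * bexp I p (\<lambda>S. (f (insert i S) - f (S - {i}))\<^sup>2))"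
  using assms
proof (induction I arbitrary: f rule: finite_induct)
  case empty
  then show ?case by (simp add: bvar_def)
next
  case (insert k I)
  have pr: "is_prob_on I p" "0 \<le> p k" "p k \<le> 1"
    using insert.prems by (auto simp: is_prob_on_def)
  define f1 where "f1 = (\<lambda>S. f (insert k S))"
  define d where "d i S = (f (insert i S) - f (S - {i}))\<^sup>2" for i S
  have "bvar (insert k I) p f = p k * bvar I p f1 + (1 - p k) * bvar I p f
      + p k * (1 - p k) * (bexp I p f1 - bexp I p f)\<^sup>2"
    using insert by (simp add: bvar_def bexp_insert f1_def power2_eq_square algebra_simps)
  also have "\<dots> \<le> p k * (\<Sum>i\<in>I. p i * bexp I p (\<lambda>S. d i (insert k S)))
      + (1 - p k) * (\<Sum>i\<in>I. p i * bexp I p (\<lambda>S. d i S))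
      + p k * bexp I p (\<lambda>S. (f1 S - f S)\<^sup>2)"
  proof (intro add_mono mult_left_mono)
    have "bvar I p f1 \<le> (\<Sum>i\<in>I. p i * bexp I p (\<lambda>S. (f1 (insert i S) - f1 (S - {i}))\<^sup>2))"
      using insert pr by simp
    also have "\<dots> = (\<Sum>i\<in>I. p i * bexp I p (\<lambda>S. d i (insert k S)))"
    proof (intro sum.cong refl arg_cong2[where f = "(*)"] bexp_cong)
      fix i S assume "i \<in> I" "S \<subseteq> I"
      then have "insert k (S - {i}) = insert k S - {i}" using insert by auto
      then show "(f1 (insert i S) - f1 (S - {i}))\<^sup>2 = d i (insert k S)"
        by (simp add: f1_def d_def insert_commute)
    qed
    finally show "bvar I p f1 \<le> (\<Sum>i\<in>I. p i * bexp I p (\<lambda>S. d i (insert k S)))" .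
    show "bvar I p f \<le> (\<Sum>i\<in>I. p i * bexp I p (d i))"
      using insert.IH[OF pr(1), of f] by (simp add: d_def[abs_def])
    have "(bexp I p f1 - bexp I p f)\<^sup>2 \<le> bexp I p (\<lambda>S. (f1 S - f S)\<^sup>2)"
      using bvar_nonneg[OF insert(1) pr(1), of "\<lambda>S. f1 S - f S"] by (simp add: bvar_def bexp_diff)
    moreover have "p k * (1 - p k) \<le> p k * 1" using pr by (intro mult_left_mono) auto
    ultimately show "p k * (1 - p k) * (bexp I p f1 - bexp I p f)\<^sup>2 \<le> p k * bexp I p (\<lambda>S. (f1 S - f S)\<^sup>2)"
      using pr by (intro mult_mono) (auto intro!: bexp_nonneg insert)
  qed (use pr in auto)
  also have "\<dots> = (\<Sum>i\<in>I. p i * bexp (insert k I) p (d i)) + p k * bexp (insert k I) p (d k)"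
  proof -
    have "bexp I p (\<lambda>S. d k (insert k S)) = bexp I p (\<lambda>S. (f1 S - f S)\<^sup>2)"
         "bexp I p (\<lambda>S. d k S) = bexp I p (\<lambda>S. (f1 S - f S)\<^sup>2)"
    proof -
      have "S - {k} = S" if "S \<subseteq> I" for S using that insert.hyps by auto
      then show "bexp I p (\<lambda>S. d k (insert k S)) = bexp I p (\<lambda>S. (f1 S - f S)\<^sup>2)"
         "bexp I p (\<lambda>S. d k S) = bexp I p (\<lambda>S. (f1 S - f S)\<^sup>2)"
        by (auto intro!: bexp_cong simp: d_def f1_def insert_absorb)
    qed
    then have "bexp (insert k I) p (d k) = bexp I p (\<lambda>S. (f1 S - f S)\<^sup>2)"
      using insert by (simp add: bexp_insert algebra_simps)
    moreover have "p k * (\<Sum>i\<in>I. p i * bexp I p (\<lambda>S. d i (insert k S)))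
      + (1 - p k) * (\<Sum>i\<in>I. p i * bexp I p (\<lambda>S. d i S)) = (\<Sum>i\<in>I. p i * bexp (insert k I) p (d i))"
      using insert by (simp add: bexp_insert sum_distrib_left sum.distrib[symmetric] algebra_simps)
    ultimately show ?thesis by simp
  qed
  also have "\<dots> = (\<Sum>i\<in>insert k I. p i * bexp (insert k I) p (d i))"
    using insert by simp
  finally show ?case unfolding d_def[abs_def] .
qed

section \<open>Maximal counts over a family of sets\<close>

text \<open>The passage time and its versions restricted to certain paths all have this form, so the
  variance bound and the comparison of parameters are proved once for all of them.\<close>

definition cov :: "'a set set \<Rightarrow> 'a set \<Rightarrow> nat" where
  "cov \<C> S = Max ((\<lambda>C. card (C \<inter> S)) ` \<C>)"

lemma cov_ge: "finite \<C> \<Longrightarrow> C \<in> \<C> \<Longrightarrow> card (C \<inter> S) \<le> cov \<C> S"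
  by (simp add: cov_def)

lemma cov_attained:
  assumes "finite \<C>" "\<C> \<noteq> {}"
  obtains C where "C \<in> \<C>" "cov \<C> S = card (C \<inter> S)"
proof -
  have "cov \<C> S \<in> (\<lambda>C. card (C \<inter> S)) ` \<C>" unfolding cov_def using assms by (intro Max_in) auto
  then show ?thesis using that by auto
qed

lemma cov_mono:
  assumes "finite \<C>" "\<C> \<noteq> {}" "finite T" "S \<subseteq> T"
  shows "cov \<C> S \<le> cov \<C> T"
proof -
  obtain C where C: "C \<in> \<C>" "cov \<C> S = card (C \<inter> S)" using cov_attained assms by metis
  have "card (C \<inter> S) \<le> card (C \<inter> T)" using assms by (intro card_mono) auto
  then show ?thesis using cov_ge[OF assms(1) C(1), of T] C by simp
qed

lemma cov_insert:
  assumes "finite \<C>" "\<C> \<noteq> {}"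
  shows "cov \<C> (insert i S) \<le> cov \<C> (S - {i}) + 1"
proof -
  obtain C where C: "C \<in> \<C>" "cov \<C> (insert i S) = card (C \<inter> insert i S)" using cov_attained assms by metis
  have "card (C \<inter> insert i S) \<le> card (insert i (C \<inter> (S - {i})))"
  proof (cases "finite (C \<inter> insert i S)")
    case True
    then show ?thesis by (intro card_mono) (auto elim: finite_subset[rotated])
  qed simp
  also have "\<dots> \<le> card (C \<inter> (S - {i})) + 1"
    by (cases "finite (C \<inter> (S - {i}))") (auto simp: card_insert_if)
  finally show ?thesis using cov_ge[OF assms(1) C(1), of "S - {i}"] C by simp
qed

text \<open>Removing \<open>i\<close> lowers \<open>cov \<C> S\<close> only if \<open>i\<close> belongs to every optimal member of \<open>\<C>\<close>, so there are at
  most \<open>cov \<C> S\<close> such points.\<close>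

lemma bvar_cov:
  assumes "finite I" "is_prob_on I p" "finite \<C>" "\<C> \<noteq> {}"
  shows "bvar I p (\<lambda>S. real (cov \<C> S)) \<le> bexp I p (\<lambda>S. real (cov \<C> S))"
proof -
  define g where "g i S = (real (cov \<C> (insert i S)) - real (cov \<C> (S - {i})))\<^sup>2" for i S
  have "bvar I p (\<lambda>S. real (cov \<C> S)) \<le> (\<Sum>i\<in>I. p i * bexp I p (g i))"
    unfolding g_def by (rule efron_stein[OF assms(1,2)])
  also have "\<dots> = (\<Sum>i\<in>I. bexp I p (\<lambda>S. if i \<in> S then g i S else 0))"
  proof (rule sum.cong)
    fix i assume i: "i \<in> I"
    have "p i * bexp I p (\<lambda>S. g i (S - {i})) = bexp I p (\<lambda>S. if i \<in> S then g i (S - {i}) else 0)"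
      by (rule bexp_mem[symmetric]) (use assms i in auto)
    moreover have "g i (S - {i}) = g i S" for S by (simp add: g_def)
    ultimately show "p i * bexp I p (g i) = bexp I p (\<lambda>S. if i \<in> S then g i S else 0)"
      by (simp cong: if_cong)
  qed simp
  also have "\<dots> = bexp I p (\<lambda>S. \<Sum>i\<in>I. if i \<in> S then g i S else 0)"
    by (simp add: bexp_sum)
  also have "\<dots> \<le> bexp I p (\<lambda>S. real (cov \<C> S))"
  proof (rule bexp_mono[OF assms(2)])
    fix S assume S: "S \<subseteq> I"
    have fS: "finite S" using S assms finite_subset by auto
    obtain C where C: "C \<in> \<C>" "cov \<C> S = card (C \<inter> S)" using cov_attained assms by metis
    have "(\<Sum>i\<in>I. if i \<in> S then g i S else 0) \<le> (\<Sum>i\<in>I. if i \<in> C \<inter> S then 1 else 0)"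
    proof (rule sum_mono)
      fix i assume i: "i \<in> I"
      show "(if i \<in> S then g i S else 0) \<le> (if i \<in> C \<inter> S then 1 else 0)"
      proof (cases "i \<in> S")
        case True
        have up: "cov \<C> (insert i S) \<le> cov \<C> (S - {i}) + 1"
          using assms by (intro cov_insert) auto
        have lo: "cov \<C> (S - {i}) \<le> cov \<C> (insert i S)"
          using assms fS by (intro cov_mono) auto
        have "g i S \<le> 1" unfolding g_def using up lo by (intro power_le_one) auto
        moreover have "g i S = 0" if "i \<notin> C"
        proof -
          have "C \<inter> (S - {i}) = C \<inter> S" using that by auto
          then have "cov \<C> S \<le> cov \<C> (S - {i})" using cov_ge[OF assms(3) C(1), of "S - {i}"] C by simp
          then show ?thesis using lo True by (simp add: g_def insert_absorb)
        qed
        ultimately show ?thesis using True by auto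
      qed auto
    qed
    also have "\<dots> = real (card (I \<inter> (C \<inter> S)))"
      using assms(1) by (simp add: sum.If_cases Int_def)
    also have "I \<inter> (C \<inter> S) = C \<inter> S" using S by auto
    finally show "(\<Sum>i\<in>I. if i \<in> S then g i S else 0) \<le> real (cov \<C> S)" using C by simp
  qed
  finally show ?thesis .
qed

text \<open>The points of \<open>D\<close> are available to every member, so \<open>cov\<close> is
  their number in \<open>S\<close> plus a maximum over the remainders. The mean of the first part
  changes by exactly the sum over \<open>D\<close>, and the second part is monotone. The comparison
  of \<open>p\<close> and \<open>q\<close> is confined to the union of the family because in the
  application the parameter of one axis rises while that of the other falls.\<close>

lemma bexp_cov_increase:
  assumes "finite I" "is_prob_on I p" "is_prob_on I q" "finite \<C>" "\<C> \<noteq> {}"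
    and sub: "\<And>C. C \<in> \<C> \<Longrightarrow> D \<subseteq> C \<and> C \<subseteq> I"
    and le: "\<And>i. i \<in> \<Union>\<C> \<Longrightarrow> p i \<le> q i"
  shows "bexp I p (\<lambda>S. real (cov \<C> S)) + (\<Sum>i\<in>D. q i - p i) \<le> bexp I q (\<lambda>S. real (cov \<C> S))"
proof -
  obtain C0 where "C0 \<in> \<C>" using assms(5) by auto
  then have DU: "D \<subseteq> \<Union>\<C>" and DI: "D \<subseteq> I" using sub by blast+
  have D: "D \<subseteq> I" "finite D" using DI finite_subset[OF DI assms(1)] by auto
  have UC: "\<Union>\<C> \<subseteq> I" using sub by auto
  define g where "g S = real (cov \<C> S) - (\<Sum>i\<in>D. of_bool (i \<in> S))" for S
  have g: "g S = real (cov ((\<lambda>C. C - D) ` \<C>) S)" if "finite S" for S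
  proof -
    have *: "card (C \<inter> S) = card ((C - D) \<inter> S) + card (D \<inter> S)" if "C \<in> \<C>" for C
    proof -
      have "C \<inter> S = ((C - D) \<inter> S) \<union> (D \<inter> S)" using sub that by auto
      moreover have "card (((C - D) \<inter> S) \<union> (D \<inter> S)) = card ((C - D) \<inter> S) + card (D \<inter> S)"
        using \<open>finite S\<close> by (intro card_Un_disjoint) auto
      ultimately show ?thesis by simp
    qed
    have "cov \<C> S = Max ((\<lambda>C. card ((C - D) \<inter> S) + card (D \<inter> S)) ` \<C>)"
      unfolding cov_def by (rule arg_cong[of _ _ Max], rule image_cong) (use * in auto)
    also have "\<dots> = Max ((\<lambda>C. card ((C - D) \<inter> S)) ` \<C>) + card (D \<inter> S)"
      using assms by (intro Max_add_commute) auto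
    also have "Max ((\<lambda>C. card ((C - D) \<inter> S)) ` \<C>) = cov ((\<lambda>C. C - D) ` \<C>) S"
      by (simp add: cov_def image_image)
    finally show ?thesis using D by (simp add: g_def of_bool_def sum.If_cases Int_commute)
  qed
  have split: "bexp I r (\<lambda>S. real (cov \<C> S)) = bexp I r g + (\<Sum>i\<in>D. r i)" for r
  proof -
    have "bexp I r (\<lambda>S. real (cov \<C> S)) = bexp I r (\<lambda>S. g S + (\<Sum>i\<in>D. of_bool (i \<in> S)))"
      by (simp add: g_def)
    also have "\<dots> = bexp I r g + (\<Sum>i\<in>D. bexp I r (\<lambda>S. of_bool (i \<in> S)))"
      by (simp add: bexp_add bexp_sum)
    also have "(\<Sum>i\<in>D. bexp I r (\<lambda>S. of_bool (i \<in> S))) = (\<Sum>i\<in>D. r i)"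
      using D assms(1) by (intro sum.cong bexp_mem1) auto
    finally show ?thesis .
  qed
  have ext: "bexp I r g = bexp (\<Union>\<C>) r g" for r
  proof (rule bexp_extend[OF assms(1) UC])
    fix S assume "S \<subseteq> I"
    have "(\<lambda>C. card (C \<inter> S)) ` \<C> = (\<lambda>C. card (C \<inter> (S \<inter> \<Union>\<C>))) ` \<C>"
      by (intro image_cong refl arg_cong[of _ _ card]) auto
    moreover have "i \<in> S \<longleftrightarrow> i \<in> S \<inter> \<Union>\<C>" if "i \<in> D" for i using that DU by auto
    ultimately show "g S = g (S \<inter> \<Union>\<C>)" by (auto simp: g_def cov_def intro!: sum.cong)
  qed
  have fU: "finite (\<Union>\<C>)" by (rule finite_subset[OF UC assms(1)])
  have "bexp (\<Union>\<C>) p g \<le> bexp (\<Union>\<C>) q g"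
  proof (rule bexp_mono_prob)
    fix S T assume "S \<subseteq> T" "T \<subseteq> \<Union>\<C>"
    moreover have "finite T" by (rule finite_subset[OF \<open>T \<subseteq> \<Union>\<C>\<close> fU])
    moreover have "finite S" by (rule finite_subset[OF \<open>S \<subseteq> T\<close> \<open>finite T\<close>])
    ultimately show "g S \<le> g T" using assms by (simp add: g cov_mono)
  qed (use assms UC fU in \<open>auto simp: is_prob_on_def\<close>)
  then show ?thesis unfolding split ext by (simp add: sum_subtractf)
qed

section \<open>Last passage percolation on a grid\<close>

text \<open>Interior points count only on diagonal steps, whereas consecutive points of one axis all
  count. The value is the length of a longest chain for \<open>prec\<close>, given by a recursion
  that inductions over the grid can follow.\<close>

fun lpp :: "(nat \<times> nat) set \<Rightarrow> nat \<Rightarrow> nat \<Rightarrow> nat" where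
  "lpp S 0 0 = 0"
| "lpp S (Suc i) 0 = lpp S i 0 + of_bool ((Suc i, 0) \<in> S)"
| "lpp S 0 (Suc j) = lpp S 0 j + of_bool ((0, Suc j) \<in> S)"
| "lpp S (Suc i) (Suc j) =
     max (max (lpp S i (Suc j)) (lpp S (Suc i) j)) (lpp S i j + of_bool ((Suc i, Suc j) \<in> S))"

text \<open>If the increments along the left and bottom sides of a unit square are \<open>0\<close>
  or \<open>1\<close>, so are those along the top and right sides; on the axes this holds by
  definition.\<close>

lemma lpp_step:
  "lpp S i j \<le> lpp S (Suc i) j \<and> lpp S (Suc i) j \<le> lpp S i j + 1 \<and>
   lpp S i j \<le> lpp S i (Suc j) \<and> lpp S i (Suc j) \<le> lpp S i j + 1"
proof -
  define row where "row i j \<longleftrightarrow> lpp S i j \<le> lpp S (Suc i) j \<and> lpp S (Suc i) j \<le> lpp S i j + 1" for i j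
  define col where "col i j \<longleftrightarrow> lpp S i j \<le> lpp S i (Suc j) \<and> lpp S i (Suc j) \<le> lpp S i j + 1" for i j
  have row0: "row i 0" for i by (simp add: row_def)
  have col0: "col 0 j" for j by (simp add: col_def)
  have box: "row i (Suc j) \<and> col (Suc i) j" if "row i j" "col i j" for i j
    using that unfolding row_def col_def lpp.simps(4) by (auto simp: max_def simp del: lpp.simps)
  have "row i j \<and> col i j" for i j
  proof (induction j arbitrary: i)
    case 0
    have "col i 0" for i by (induction i) (use row0 col0 box in blast)+
    then show ?case using row0 by blast
  next
    case (Suc j)
    have r: "row i (Suc j)" for i using Suc box by blast
    have "col i (Suc j)" for i by (induction i) (use r col0 box in blast)+
    then show ?case using r by blast
  qed
  then show ?thesis by (simp add: row_def col_def)
qed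

lemma lpp_cong:
  assumes "\<And>a b. a \<le> i \<Longrightarrow> b \<le> j \<Longrightarrow> (a, b) \<noteq> (0, 0) \<Longrightarrow> (a, b) \<in> S \<longleftrightarrow> (a, b) \<in> T"
  shows "lpp S i j = lpp T i j"
  using assms
proof (induction S i j rule: lpp.induct)
  case (4 S i j)
  have "lpp S i (Suc j) = lpp T i (Suc j)" "lpp S (Suc i) j = lpp T (Suc i) j" "lpp S i j = lpp T i j"
    by (rule 4(1) 4(2) 4(3); rule 4(4); simp)+
  then show ?case using 4(4)[of "Suc i" "Suc j"] by (simp only: lpp.simps) simp
qed simp_all

text \<open>At each site the three values from which \<open>lpp\<close> takes the maximum are raised by amounts between
  the discrepancies above and to the left, so the result is too.\<close>

lemma lpp_discrepancy:
  fixes S :: "(nat \<times> nat) set"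
  defines "d \<equiv> \<lambda>i j. int (lpp (insert (1, 0) S) i j) - int (lpp (S - {(1, 0)}) i j)"
  shows "0 \<le> d i j \<and> d i j \<le> 1 \<and> d i j \<le> d (Suc i) j \<and> d i (Suc j) \<le> d i j"
proof -
  have d0: "d 0 j = 0" for j by (induction j) (auto simp: d_def)
  have d1: "d (Suc i) 0 = 1" for i by (induction i) (auto simp: d_def)
  have box: "d i (Suc j) \<le> d (Suc i) (Suc j) \<and> d (Suc i) (Suc j) \<le> d (Suc i) j"
    if "d i (Suc j) \<le> d i j" "d i j \<le> d (Suc i) j" for i j
    using that unfolding d_def lpp.simps(4) by (auto simp: max_def simp del: lpp.simps)
  have mono: "d i j \<le> d (Suc i) j \<and> d i (Suc j) \<le> d i j" for i j
  proof (induction j arbitrary: i)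
    case 0
    have "d i 0 \<le> d (Suc i) 0" for i by (cases i) (auto simp: d0 d1)
    moreover have "d i (Suc 0) \<le> d i 0" for i
    proof (induction i)
      case (Suc i)
      then show ?case using box[of i 0] \<open>\<And>i. d i 0 \<le> d (Suc i) 0\<close> by blast
    qed (simp add: d0)
    ultimately show ?case by blast
  next
    case (Suc j)
    have A: "d i (Suc j) \<le> d (Suc i) (Suc j)" for i using box Suc by blast
    moreover have "d i (Suc (Suc j)) \<le> d i (Suc j)" for i
    proof (induction i)
      case (Suc i)
      then show ?case using box[of i "Suc j"] A by blast
    qed (simp add: d0)
    ultimately show ?case by blast
  qed
  have ge: "0 \<le> d i j" for i j
  proof (induction i)
    case (Suc i) then show ?case using mono[of i j] by linarith
  qed (simp add: d0)
  have le: "d i j \<le> 1" for i j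
  proof (induction j)
    case 0 show ?case by (cases i) (auto simp: d0 d1)
  next
    case (Suc j) then show ?case using mono[of i j] by linarith
  qed
  show ?thesis using mono[of i j] ge[of i j] le[of i j] by simp
qed

section \<open>Passage times as lengths of chains\<close>

text \<open>Points of the same axis are comparable although they share a coordinate. A source and a
  sink are never comparable, so a chain follows at most one axis.\<close>

definition prec :: "nat \<times> nat \<Rightarrow> nat \<times> nat \<Rightarrow> bool" where
  "prec a b \<longleftrightarrow> (fst a < fst b \<and> snd a < snd b) \<or> (snd a = 0 \<and> snd b = 0 \<and> fst a < fst b)
     \<or> (fst a = 0 \<and> fst b = 0 \<and> snd a < snd b)"

definition chain :: "(nat \<times> nat) set \<Rightarrow> bool" where
  "chain C \<longleftrightarrow> (\<forall>a\<in>C. \<forall>b\<in>C. a = b \<or> prec a b \<or> prec b a)"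

definition grid :: "nat \<Rightarrow> nat \<Rightarrow> (nat \<times> nat) set" where
  "grid c n = {..c} \<times> {..n} - {(0, 0)}"

lemma finite_grid [simp]: "finite (grid c n)"
  by (simp add: grid_def)

lemma chain_subset: "chain C \<Longrightarrow> D \<subseteq> C \<Longrightarrow> chain D"
  unfolding chain_def by blast

text \<open>If the corner belongs to the chain, all other members lie strictly below and to the left
  of it. Otherwise the chain misses the last column or the last row, because a member of each would
  be incomparable.\<close>

lemma card_chain_le_lpp:
  assumes "chain C" "C \<subseteq> grid i j" "C \<subseteq> S"
  shows "card C \<le> lpp S i j"
  using assms
proof (induction S i j arbitrary: C rule: lpp.induct)
  case (1 S)
  then have "C = {}" by (auto simp: grid_def)
  then show ?case by simp
next
  case (2 S i)
  have "C - {(Suc i, 0)} \<subseteq> grid i 0" using 2(3) by (auto simp: grid_def le_Suc_eq)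
  then have "card (C - {(Suc i, 0)}) \<le> lpp S i 0"
    using 2 by (intro 2(1)) (auto intro: chain_subset)
  moreover have "finite C" by (rule finite_subset[OF 2(3) finite_grid])
  ultimately show ?case using 2(4) by (cases "(Suc i, 0) \<in> C") (auto simp: card_Diff_singleton_if split: if_splits)
next
  case (3 S j)
  have "C - {(0, Suc j)} \<subseteq> grid 0 j" using 3(3) by (auto simp: grid_def le_Suc_eq)
  then have "card (C - {(0, Suc j)}) \<le> lpp S 0 j"
    using 3 by (intro 3(1)) (auto intro: chain_subset)
  moreover have "finite C" by (rule finite_subset[OF 3(3) finite_grid])
  ultimately show ?case using 3(4) by (cases "(0, Suc j) \<in> C") (auto simp: card_Diff_singleton_if split: if_splits)
next
  case (4 S i j)
  note ch = 4(4) and sub = 4(5) and CS = 4(6)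
  have fin: "finite C" by (rule finite_subset[OF sub finite_grid])
  show ?case
  proof (cases "(Suc i, Suc j) \<in> C")
    case True
    have "C - {(Suc i, Suc j)} \<subseteq> grid i j"
    proof
      fix b assume b: "b \<in> C - {(Suc i, Suc j)}"
      then have "prec (Suc i, Suc j) b \<or> prec b (Suc i, Suc j)" using ch True by (auto simp: chain_def)
      then show "b \<in> grid i j" using b sub by (cases b) (auto simp: prec_def grid_def)
    qed
    then have "card (C - {(Suc i, Suc j)}) \<le> lpp S i j"
      using ch CS by (intro 4(3)) (auto intro: chain_subset)
    then show ?thesis using True CS fin unfolding lpp.simps(4)
      by (auto simp: card_Diff_singleton_if simp del: lpp.simps)
  next
    case False
    have "C \<subseteq> grid i (Suc j) \<or> C \<subseteq> grid (Suc i) j"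
    proof (rule ccontr)
      assume "\<not> ?thesis"
      then obtain a b where ab: "a \<in> C" "a \<notin> grid i (Suc j)" "b \<in> C" "b \<notin> grid (Suc i) j" by auto
      then have "fst a = Suc i" "snd b = Suc j" "a \<noteq> (Suc i, Suc j)" "b \<noteq> (Suc i, Suc j)"
        using sub False by (auto simp: grid_def le_Suc_eq)
      moreover have "snd a \<le> Suc j" "fst b \<le> Suc i" using ab sub by (auto simp: grid_def)
      ultimately have "fst a = Suc i" "snd b = Suc j" "snd a \<le> j" "fst b \<le> i"
        by (cases a; cases b; auto simp: le_Suc_eq)+
      moreover have "a = b \<or> prec a b \<or> prec b a" using ch ab by (auto simp: chain_def)
      ultimately show False by (auto simp: prec_def)
    qed
    then have "card C \<le> lpp S i (Suc j) \<or> card C \<le> lpp S (Suc i) j"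
      using 4(1)[OF ch _ CS] 4(2)[OF ch _ CS] by blast
    then show ?thesis unfolding lpp.simps(4) by (auto simp del: lpp.simps)
  qed
qed

lemma chain_insert:
  "chain C \<Longrightarrow> (\<And>b. b \<in> C \<Longrightarrow> prec b a) \<Longrightarrow> chain (insert a C)"
  by (auto simp: chain_def)

lemma lpp_chain_exists: "\<exists>C. chain C \<and> C \<subseteq> grid i j \<and> C \<subseteq> S \<and> card C = lpp S i j"
proof (induction S i j rule: lpp.induct)
  case (1 S)
  show ?case by (intro exI[of _ "{}"]) (auto simp: chain_def)
next
  case (2 S i)
  then obtain C where C: "chain C" "C \<subseteq> grid i 0" "C \<subseteq> S" "card C = lpp S i 0" by auto
  have fin: "finite C" by (rule finite_subset[OF C(2) finite_grid])
  show ?case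
  proof (cases "(Suc i, 0) \<in> S")
    case True
    have "chain (insert (Suc i, 0) C)" using C by (intro chain_insert) (auto simp: prec_def grid_def)
    moreover have "(Suc i, 0) \<notin> C" using C by (auto simp: grid_def)
    ultimately show ?thesis using C True fin
      by (intro exI[of _ "insert (Suc i, 0) C"]) (auto simp: grid_def)
  next
    case False
    then show ?thesis using C by (intro exI[of _ C]) (auto simp: grid_def)
  qed
next
  case (3 S j)
  then obtain C where C: "chain C" "C \<subseteq> grid 0 j" "C \<subseteq> S" "card C = lpp S 0 j" by auto
  have fin: "finite C" by (rule finite_subset[OF C(2) finite_grid])
  show ?case
  proof (cases "(0, Suc j) \<in> S")
    case True
    have "chain (insert (0, Suc j) C)" using C by (intro chain_insert) (auto simp: prec_def grid_def)
    moreover have "(0, Suc j) \<notin> C" using C by (auto simp: grid_def)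
    ultimately show ?thesis using C True fin
      by (intro exI[of _ "insert (0, Suc j) C"]) (auto simp: grid_def)
  next
    case False
    then show ?thesis using C by (intro exI[of _ C]) (auto simp: grid_def)
  qed
next
  case (4 S i j)
  obtain C where C: "chain C" "C \<subseteq> grid i j" "C \<subseteq> S" "card C = lpp S i j" using 4 by auto
  have fin: "finite C" by (rule finite_subset[OF C(2) finite_grid])
  have up: "grid i (Suc j) \<subseteq> grid (Suc i) (Suc j)" "grid (Suc i) j \<subseteq> grid (Suc i) (Suc j)"
    by (auto simp: grid_def)
  consider "lpp S (Suc i) (Suc j) = lpp S i (Suc j)" | "lpp S (Suc i) (Suc j) = lpp S (Suc i) j"
    | "lpp S (Suc i) (Suc j) = lpp S i j + 1" "(Suc i, Suc j) \<in> S"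
  proof -
    \<comment> \<open>The third value can be the strict maximum only if the corner is occupied,
      since \<open>lpp S i j\<close> never exceeds its neighbours.\<close>
    have "max (max a b) (c + of_bool x) = a \<or> max (max a b) (c + of_bool x) = b \<or>
        max (max a b) (c + of_bool x) = c + 1 \<and> x" if "c \<le> a" for a b c :: nat and x
      using that by (cases x) (auto simp: max_def)
    then show ?thesis
      using that lpp_step[of S i j] unfolding lpp.simps(4) by metis
  qed
  then show ?case
  proof cases
    case 1
    then show ?thesis using 4(1) up by (metis order_trans)
  next
    case 2
    then show ?thesis using 4(2) up by (metis order_trans)
  next
    case 3
    have "chain (insert (Suc i, Suc j) C)" using C by (intro chain_insert) (auto simp: prec_def grid_def)
    moreover have "(Suc i, Suc j) \<notin> C" using C by (auto simp: grid_def)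
    moreover have "insert (Suc i, Suc j) C \<subseteq> grid (Suc i) (Suc j)" using C by (auto simp: grid_def)
    ultimately show ?thesis using C 3 fin
      by (intro exI[of _ "insert (Suc i, Suc j) C"]) auto
  qed
qed

text \<open>Through this form the passage time inherits monotonicity in \<open>S\<close>. The family
  ranges over all chains of the grid, as intersecting with \<open>S\<close> keeps a chain a
  chain.\<close>

lemma lpp_eq_cov: "lpp S c n = cov {C. C \<subseteq> grid c n \<and> chain C} S"
proof (rule antisym)
  have fin: "finite {C. C \<subseteq> grid c n \<and> chain C}" by simp
  obtain C where C: "chain C" "C \<subseteq> grid c n" "C \<subseteq> S" "card C = lpp S c n"
    using lpp_chain_exists[of c n S] by blast
  then show "lpp S c n \<le> cov {C. C \<subseteq> grid c n \<and> chain C} S"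
    using cov_ge[OF fin, of C S] by (simp add: Int_absorb2)
  have ne: "{C. C \<subseteq> grid c n \<and> chain C} \<noteq> {}" using C by auto
  obtain C' where "C' \<subseteq> grid c n" "chain C'" "cov {C. C \<subseteq> grid c n \<and> chain C} S = card (C' \<inter> S)"
    using cov_attained[OF fin ne, of S] by auto
  then show "cov {C. C \<subseteq> grid c n \<and> chain C} S \<le> lpp S c n"
    by (auto intro!: card_chain_le_lpp intro: chain_subset)
qed

subsection \<open>The column identity\<close>

text \<open>The site \<open>(0, 0)\<close> formally receives the value \<open>l\<close>;
  \<open>grid\<close> excludes it.\<close>

definition prm :: "real \<Rightarrow> real \<Rightarrow> real \<Rightarrow> nat \<times> nat \<Rightarrow> real" where
  "prm l m p = (\<lambda>(i, j). if j = 0 then l else if i = 0 then m else p)"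

lemma is_prob_prm: "0 \<le> l \<Longrightarrow> l \<le> 1 \<Longrightarrow> 0 \<le> m \<Longrightarrow> m \<le> 1 \<Longrightarrow> 0 \<le> p \<Longrightarrow> p \<le> 1 \<Longrightarrow> is_prob_on I (prm l m p)"
  by (auto simp: is_prob_on_def prm_def)

text \<open>The input of a single column: the sinks on its left, its source and its interior
  points.\<close>

definition two_columns :: "nat \<Rightarrow> (nat \<times> nat) set" where
  "two_columns n = insert (1, 0) ({0, 1} \<times> {1..n})"

text \<open>These rows act as the sinks of the system that remains when the first column is
  removed.\<close>

definition column_out :: "(nat \<times> nat) set \<Rightarrow> nat \<Rightarrow> nat set" where
  "column_out S n = {j \<in> {1..n}. lpp S 1 (j - 1) < lpp S 1 j}"

lemma two_columns_Suc: "two_columns (Suc n) = insert (0, Suc n) (insert (1, Suc n) (two_columns n))"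
  by (auto simp: two_columns_def le_Suc_eq)

lemma column_out_Suc: "column_out S (Suc n) =
    (if lpp S 1 n < lpp S 1 (Suc n) then insert (Suc n) (column_out S n) else column_out S n)"
  by (auto simp: column_out_def le_Suc_eq simp del: lpp.simps)

text \<open>Burke's theorem for one column.  The assumption says that the product of the odds of sources and
  sinks is \<open>p\<close>.\<close>

lemma burke_column:
  assumes "l * m = (1 - l) * (1 - m) * p"
  shows "bexp (two_columns n) (prm l m p) (\<lambda>S. F (column_out S n) (lpp S 0 n < lpp S 1 n))
    = bexp {1..n} (\<lambda>_. m) (\<lambda>J. l * F J True + (1 - l) * F J False)"
proof (induction n arbitrary: F)
  case 0
  show ?case by (simp add: two_columns_def bexp_insert prm_def column_out_def)
next
  case (Suc n)
  let ?q = "prm l m p"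
  \<comment> \<open>The update by one row: \<open>b\<close> tells whether column 1 holds a particle
    before it, \<open>x\<close> whether the row has a sink, and \<open>a\<close> whether it has an
    \<alpha>-point in column 1.\<close>
  define H where "H J b x a = (if b \<and> x then F J False else if b then F J True
      else if x then F (insert (Suc n) J) False
      else if a then F (insert (Suc n) J) True else F J False)" for J b x a
  have step: "F (column_out T (Suc n)) (lpp T 0 (Suc n) < lpp T 1 (Suc n))
      = H (column_out S n) (lpp S 0 n < lpp S 1 n) x a"
    if T: "T = S \<union> (if x then {(0, Suc n)} else {}) \<union> (if a then {(1, Suc n)} else {})"
      and S: "S \<subseteq> two_columns n" for S T x a
  proof -
    have nS: "(0, Suc n) \<notin> S" "(Suc 0, Suc n) \<notin> S" using S by (auto simp: two_columns_def)
    have eq: "lpp T i j = lpp S i j" if "j \<le> n" for i j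
      by (rule lpp_cong) (use T that in auto)
    have co: "column_out T n = column_out S n"
      by (auto simp: column_out_def eq)
    have new: "lpp T 0 (Suc n) = lpp S 0 n + of_bool x" "lpp T 1 n = lpp S 1 n"
      "lpp T 1 (Suc n) = max (max (lpp S 0 n + of_bool x) (lpp S 1 n)) (lpp S 0 n + of_bool a)"
      using T nS eq[of n] by (auto simp: One_nat_def)
    have "lpp S 0 n \<le> lpp S 1 n" "lpp S 1 n \<le> lpp S 0 n + 1" using lpp_step[of S 0 n] by auto
    then consider "lpp S 1 n = lpp S 0 n" | "lpp S 1 n = lpp S 0 n + 1" by linarith
    then show ?thesis
      unfolding column_out_Suc co H_def new by cases (cases x; cases a; simp)+
  qed
  have nin: "(1, Suc n) \<notin> two_columns n" "(0, Suc n) \<notin> insert (1, Suc n) (two_columns n)" "finite (two_columns n)"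
    by (auto simp: two_columns_def)
  have "bexp (two_columns (Suc n)) ?q (\<lambda>S. F (column_out S (Suc n)) (lpp S 0 (Suc n) < lpp S 1 (Suc n)))
     = m * (p * bexp (two_columns n) ?q (\<lambda>S. H (column_out S n) (lpp S 0 n < lpp S 1 n) True True)
       + (1 - p) * bexp (two_columns n) ?q (\<lambda>S. H (column_out S n) (lpp S 0 n < lpp S 1 n) True False))
     + (1 - m) * (p * bexp (two_columns n) ?q (\<lambda>S. H (column_out S n) (lpp S 0 n < lpp S 1 n) False True)
       + (1 - p) * bexp (two_columns n) ?q (\<lambda>S. H (column_out S n) (lpp S 0 n < lpp S 1 n) False False))"
  proof -
    have q: "?q (0, Suc n) = m" "?q (1, Suc n) = p" by (auto simp: prm_def)
    have fin: "finite (insert (1, Suc n) (two_columns n))" using nin by simp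
    show ?thesis
      unfolding two_columns_Suc bexp_insert[OF fin nin(2)] bexp_insert[OF nin(3) nin(1)] q
      by (intro arg_cong2[where f = "(+)"] arg_cong2[where f = "(*)"] refl bexp_cong; rule step) auto
  qed
  also have "\<dots> = bexp {1..n} (\<lambda>_. m) (\<lambda>J. 
       m * (p * (l * H J True True True + (1 - l) * H J False True True)
          + (1 - p) * (l * H J True True False + (1 - l) * H J False True False))
     + (1 - m) * (p * (l * H J True False True + (1 - l) * H J False False True)
          + (1 - p) * (l * H J True False False + (1 - l) * H J False False False)))"
    unfolding Suc.IH[of "\<lambda>J b. H J b True True"] Suc.IH[of "\<lambda>J b. H J b True False"]
      Suc.IH[of "\<lambda>J b. H J b False True"] Suc.IH[of "\<lambda>J b. H J b False False"]
    by (simp add: bexp_add bexp_cmult)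
  also have "\<dots> = bexp {1..n} (\<lambda>_. m) (\<lambda>J. m * (l * F (insert (Suc n) J) True + (1 - l) * F (insert (Suc n) J) False)
       + (1 - m) * (l * F J True + (1 - l) * F J False))"
  proof (intro bexp_cong refl)
    fix J
    \<comment> \<open>A sink absorbing a particle has weight \<open>l * m\<close>; an \<alpha>-point
      creating a particle together with an output has weight \<open>p * (1 - l) * (1 - m)\<close>.
      Since these are equal, the two events can exchange roles, and the other terms agree.\<close>
    have *: "p * (1 - l) * (1 - m) = l * m" using assms by (simp add: algebra_simps)
    have 1: "p * (1 - l) * (1 - m) * x = l * m * x" for x using * by simp
    define a b c d where "a = F (insert (Suc n) J) True" "b = F (insert (Suc n) J) False" "c = F J True" "d = F J False"
    have "m * (p * (l * d + (1 - l) * b) + (1 - p) * (l * d + (1 - l) * b))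
     + (1 - m) * (p * (l * c + (1 - l) * a) + (1 - p) * (l * c + (1 - l) * d))
     = m * l * d + m * (1 - l) * b + (1 - m) * l * c + (1 - m) * (1 - l) * d
       + p * (1 - l) * (1 - m) * (a - d)"
      by (simp add: algebra_simps)
    also have "\<dots> = m * (l * a + (1 - l) * b) + (1 - m) * (l * c + (1 - l) * d)"
      unfolding * by (simp add: algebra_simps)
    finally show "m * (p * (l * H J True True True + (1 - l) * H J False True True)
          + (1 - p) * (l * H J True True False + (1 - l) * H J False True False))
     + (1 - m) * (p * (l * H J True False True + (1 - l) * H J False False True)
          + (1 - p) * (l * H J True False False + (1 - l) * H J False False False))
      = m * (l * F (insert (Suc n) J) True + (1 - l) * F (insert (Suc n) J) False)
       + (1 - m) * (l * F J True + (1 - l) * F J False)"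
      by (simp add: H_def a_b_c_d_def)
  qed
  also have "\<dots> = bexp {1..Suc n} (\<lambda>_. m) (\<lambda>J. l * F J True + (1 - l) * F J False)"
  proof -
    have "{1..Suc n} = insert (Suc n) {1..n}" by auto
    then show ?thesis
      by (simp add: bexp_insert bexp_add bexp_cmult) (simp add: ring_distribs mult_ac)
  qed
  finally show ?case .
qed

text \<open>The increments along column 1 serve as sinks for a system that starts there, so the
  recursion for the columns to the right is unchanged. The source of the first column contributes
  only a constant.\<close>

lemma lpp_shift:
  assumes "j \<le> n"
  shows "lpp S (Suc i) j = of_bool ((1, 0) \<in> S) +
    lpp (Pair 0 ` column_out S n \<union> {(i, j). 1 \<le> i \<and> (Suc i, j) \<in> S}) i j" (is "_ = ?b + lpp ?T i j")
proof -
  have T: "(Suc i, j) \<in> ?T \<longleftrightarrow> (Suc (Suc i), j) \<in> S" for i j by auto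
  have T0: "(0, Suc j) \<in> ?T \<longleftrightarrow> lpp S 1 j < lpp S 1 (Suc j)" if "Suc j \<le> n" for j
    using that by (auto simp: column_out_def simp del: lpp.simps)
  have base: "lpp S (Suc i) 0 = ?b + lpp ?T i 0" for i
    by (induction i) (auto simp: T)
  show ?thesis
    using assms
  proof (induction i arbitrary: j)
    case 0
    then show ?case
    proof (induction j)
      case 0
      show ?case by (rule base)
    next
      case (Suc j)
      have "lpp S 1 (Suc j) = lpp S 1 j + of_bool (lpp S 1 j < lpp S 1 (Suc j))"
        using lpp_step[of S 1 j] by (auto simp del: lpp.simps)
      then have "lpp S 1 (Suc j) = lpp S 1 j + of_bool ((0, Suc j) \<in> ?T)"
        by (simp only: T0[OF Suc.prems])
      moreover have "lpp S 1 j = ?b + lpp ?T 0 j" using Suc by simp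
      ultimately show ?case by (simp only: lpp.simps(3) One_nat_def add.assoc)
    qed
  next
    case (Suc i)
    note outer = Suc.IH
    show ?case
      using Suc.prems
    proof (induction j)
      case 0
      show ?case by (rule base)
    next
      case (Suc j)
      have "lpp S (Suc i) (Suc j) = ?b + lpp ?T i (Suc j)" "lpp S (Suc i) j = ?b + lpp ?T i j"
        by (rule outer; use Suc.prems in simp)+
      moreover have "lpp S (Suc (Suc i)) j = ?b + lpp ?T (Suc i) j"
        by (rule Suc.IH) (use Suc.prems in simp)
      ultimately show ?case
        by (simp only: lpp.simps(4) T max_add_distrib_right add.assoc)
    qed
  qed
qed

definition mean_lpp :: "real \<Rightarrow> real \<Rightarrow> real \<Rightarrow> nat \<Rightarrow> nat \<Rightarrow> real" where
  "mean_lpp l m p c n = bexp (grid c n) (prm l m p) (\<lambda>S. real (lpp S c n))"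

text \<open>The probability that the second class particle is still in the first \<open>c\<close> columns after \<open>n\<close> rows.\<close>

definition discr :: "real \<Rightarrow> real \<Rightarrow> real \<Rightarrow> nat \<Rightarrow> nat \<Rightarrow> real" where
  "discr l m p c n = bexp (grid c n) (prm l m p)
     (\<lambda>S. real (lpp (insert (1, 0) S) c n) - real (lpp (S - {(1, 0)}) c n))"

lemma lpp_remove_column:
  assumes "A \<subseteq> two_columns n" "T' \<subseteq> {1..c} \<times> {..n}"
  shows "lpp ((\<lambda>(i, j). (Suc i, j)) ` T' \<union> A) (Suc c) n
    = of_bool ((1, 0) \<in> A) + lpp (T' \<union> Pair 0 ` column_out A n) c n"
proof -
  let ?S = "(\<lambda>(i, j). (Suc i, j)) ` T' \<union> A"
  have "lpp ?S i j = lpp A i j" if "i \<le> 1" for i j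
    by (rule lpp_cong) (use assms that in auto)
  then have "column_out ?S n = column_out A n" by (simp add: column_out_def)
  moreover have "{(i, j). 1 \<le> i \<and> (Suc i, j) \<in> ?S} = T'"
    using assms by (auto simp: two_columns_def image_iff intro!: bexI[rotated])
  moreover have "(1, 0) \<in> ?S \<longleftrightarrow> (1, 0) \<in> A"
    using assms by auto
  ultimately show ?thesis by (simp add: lpp_shift[of n n] Un_commute)
qed

text \<open>Only the source of the first column has the stationary parameter. By Burke's theorem the
  output of that column is again distributed like the sinks, so the other columns form a system with
  one column less, and the first source adds its mean.\<close>

lemma mean_lpp_burke:
  assumes "l' * m = (1 - l') * (1 - m) * p"
  shows "bexp (grid (Suc c) n) ((prm l m p)((1, 0) := l')) (\<lambda>S. real (lpp S (Suc c) n))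
    = l' + mean_lpp l m p c n"
proof -
  let ?q = "(prm l m p)((1, 0) := l')" and ?\<psi> = "\<lambda>(i, j). (Suc i, j)"
  define R where "R = {1..c} \<times> {..n}"
  define V where "V T = bexp {1..n} (\<lambda>_. m) (\<lambda>J. real (lpp (T \<union> Pair 0 ` J) c n))" for T
  have inj: "inj_on ?\<psi> R" by (auto simp: inj_on_def)
  have fin: "finite R" "finite (two_columns n)" "finite (?\<psi> ` R)" by (auto simp: R_def two_columns_def)
  have g1: "grid (Suc c) n = ?\<psi> ` R \<union> two_columns n"
  proof (rule set_eqI)
    fix x :: "nat \<times> nat"
    obtain i j where x: "x = (i, j)" by (cases x)
    show "x \<in> grid (Suc c) n \<longleftrightarrow> x \<in> ?\<psi> ` R \<union> two_columns n"
    proof (cases "i \<le> 1")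
      case True
      then show ?thesis by (auto simp: x grid_def two_columns_def R_def image_iff le_Suc_eq)
    next
      case False
      then obtain i' where "i = Suc i'" "1 \<le> i'" by (cases i) auto
      then show ?thesis by (auto simp: x grid_def two_columns_def R_def image_iff)
    qed
  qed
  have g2: "grid c n = R \<union> Pair 0 ` {1..n}"
  proof (rule set_eqI)
    fix x :: "nat \<times> nat"
    obtain i j where x: "x = (i, j)" by (cases x)
    show "x \<in> grid c n \<longleftrightarrow> x \<in> R \<union> Pair 0 ` {1..n}"
      by (cases "i = 0") (auto simp: x grid_def R_def)
  qed
  have col: "bexp (two_columns n) ?q (\<lambda>A. real (lpp (?\<psi> ` T \<union> A) (Suc c) n)) = l' + V T" if T: "T \<subseteq> R" for T
  proof -
    have "bexp (two_columns n) ?q (\<lambda>A. real (lpp (?\<psi> ` T \<union> A) (Suc c) n))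
        = bexp (two_columns n) (prm l' m p) (\<lambda>A. of_bool ((1, 0) \<in> A) + real (lpp (T \<union> Pair 0 ` column_out A n) c n))"
    proof (rule bexp_cong)
      fix i assume "i \<in> two_columns n"
      then show "?q i = prm l' m p i" by (auto simp: two_columns_def prm_def)
    next
      fix A assume "A \<subseteq> two_columns n"
      then show "real (lpp (?\<psi> ` T \<union> A) (Suc c) n)
          = of_bool ((1, 0) \<in> A) + real (lpp (T \<union> Pair 0 ` column_out A n) c n)"
        using lpp_remove_column[of A n T c] T by (simp add: R_def)
    qed
    also have "\<dots> = l' + V T"
    proof -
      have "bexp (two_columns n) (prm l' m p) (\<lambda>A. of_bool ((1, 0) \<in> A)) = l'"
        using bexp_mem1[of "two_columns n" "(1, 0)" "prm l' m p"] by (simp add: two_columns_def prm_def)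
      moreover have "bexp (two_columns n) (prm l' m p) (\<lambda>A. real (lpp (T \<union> Pair 0 ` column_out A n) c n)) = V T"
        using burke_column[OF assms, of n "\<lambda>J b. real (lpp (T \<union> Pair 0 ` J) c n)"]
        by (simp add: V_def algebra_simps)
      ultimately show ?thesis by (simp add: bexp_add)
    qed
    finally show ?thesis .
  qed
  have "bexp (grid (Suc c) n) ?q (\<lambda>S. real (lpp S (Suc c) n))
      = bexp (?\<psi> ` R) ?q (\<lambda>T. bexp (two_columns n) ?q (\<lambda>A. real (lpp (T \<union> A) (Suc c) n)))"
    unfolding g1 by (rule bexp_union) (use fin in \<open>auto simp: R_def two_columns_def\<close>)
  also have "\<dots> = bexp R (?q \<circ> ?\<psi>) (\<lambda>T. bexp (two_columns n) ?q (\<lambda>A. real (lpp (?\<psi> ` T \<union> A) (Suc c) n)))"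
    by (rule bexp_image[OF fin(1) inj])
  also have "\<dots> = bexp R (prm l m p) (\<lambda>T. l' + V T)"
  proof (rule bexp_cong)
    fix i assume "i \<in> R"
    then show "(?q \<circ> ?\<psi>) i = prm l m p i" by (cases i) (auto simp: R_def prm_def)
  qed (rule col)
  also have "\<dots> = l' + bexp R (prm l m p) V"
    using fin by (simp add: bexp_add)
  also have "bexp R (prm l m p) V = mean_lpp l m p c n"
  proof -
    have "bexp (Pair 0 ` {1..n}) (prm l m p) f = bexp {1..n} (\<lambda>_. m) (\<lambda>J. f (Pair 0 ` J))" for f
      by (subst bexp_image) (auto simp: prm_def inj_on_def intro!: bexp_cong)
    moreover have "mean_lpp l m p c n = bexp R (prm l m p) (\<lambda>T. bexp (Pair 0 ` {1..n}) (prm l m p) (\<lambda>B. real (lpp (T \<union> B) c n)))"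
      unfolding mean_lpp_def g2 by (rule bexp_union) (use fin in \<open>auto simp: R_def\<close>)
    ultimately show ?thesis by (simp add: V_def[abs_def])
  qed
  finally show ?thesis .
qed

text \<open>Replacing the source of the first column by one with the stationary parameter \<open>l'\<close> reproduces
  the system with one column less; the cost of the replacement is a second class particle.\<close>

lemma mean_lpp_Suc:
  assumes "l' * m = (1 - l') * (1 - m) * p"
  shows "mean_lpp l m p (Suc c) n = mean_lpp l m p c n + l' - (l' - l) * discr l m p (Suc c) n"
proof -
  let ?f = "\<lambda>S. real (lpp S (Suc c) n)"
  define G where "G = grid (Suc c) n - {(1, 0)}"
  have gG: "grid (Suc c) n = insert (1, 0) G" "finite G" "(1, 0) \<notin> G"
    by (auto simp: G_def grid_def)
  \<comment> \<open>The conditional means given that \<open>(1, 0)\<close> is empty or occupied.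
    Both expectations to be compared are affine in the parameter of \<open>(1, 0)\<close> with slope
    \<open>f1 - f0\<close>, which is \<open>discr\<close>.\<close>
  define f0 f1 where "f0 = bexp G (prm l m p) ?f" "f1 = bexp G (prm l m p) (\<lambda>S. ?f (insert (1, 0) S))"
  have G': "bexp G ((prm l m p)((1, 0) := l')) g = bexp G (prm l m p) g" for g
    by (rule bexp_cong) (auto simp: G_def)
  have "mean_lpp l m p (Suc c) n = l * f1 + (1 - l) * f0"
    unfolding mean_lpp_def gG(1) bexp_insert[OF gG(2,3)] f0_f1_def by (simp add: prm_def)
  moreover have "l' + mean_lpp l m p c n = l' * f1 + (1 - l') * f0"
    unfolding mean_lpp_burke[OF assms, symmetric] gG(1) bexp_insert[OF gG(2,3)] f0_f1_def G' by simp
  moreover have "discr l m p (Suc c) n = f1 - f0"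
  proof -
    let ?g = "\<lambda>S. ?f (insert (1, 0) S) - ?f (S - {(1, 0)})"
    have "bexp G (prm l m p) (\<lambda>S. ?g (insert (1, 0) S)) = f1 - f0" "bexp G (prm l m p) ?g = f1 - f0"
    proof -
      have S: "S - {(1, 0)} = S" if "S \<subseteq> G" for S using that gG(3) by auto
      show "bexp G (prm l m p) (\<lambda>S. ?g (insert (1, 0) S)) = f1 - f0"
        unfolding f0_f1_def bexp_diff[symmetric] by (rule bexp_cong) (use S in auto)
      show "bexp G (prm l m p) ?g = f1 - f0"
        unfolding f0_f1_def bexp_diff[symmetric] by (rule bexp_cong) (use S in auto)
    qed
    then show ?thesis
      unfolding discr_def gG(1) bexp_insert[OF gG(2,3)] by (simp add: algebra_simps)
  qed
  ultimately show ?thesis by algebra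
qed

lemma mean_lpp_0: "mean_lpp l m p 0 n = real n * m"
proof -
  have "lpp S 0 n = (\<Sum>j\<in>{1..n}. of_bool ((0, j) \<in> S))" for S by (induction n) auto
  then have "mean_lpp l m p 0 n = (\<Sum>j\<in>{1..n}. bexp (grid 0 n) (prm l m p) (\<lambda>S. of_bool ((0, j) \<in> S)))"
    by (simp add: mean_lpp_def bexp_sum del: sum_of_bool_eq)
  also have "\<dots> = (\<Sum>j\<in>{1..n}. m)"
    by (intro sum.cong refl, subst bexp_mem1) (auto simp: grid_def prm_def)
  finally show ?thesis by simp
qed

lemma mean_lpp_stationary:
  assumes "l * m = (1 - l) * (1 - m) * p"
  shows "mean_lpp l m p c n = real c * l + real n * m"
  by (induction c) (simp_all add: mean_lpp_0 mean_lpp_Suc[OF assms] algebra_simps)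

context
  fixes l m p :: real
  assumes probs: "0 \<le> l" "l \<le> 1" "0 \<le> m" "m \<le> 1" "0 \<le> p" "p \<le> 1"
begin

lemma discr_bounds: "0 \<le> discr l m p c n" "discr l m p c n \<le> 1"
proof -
  have "0 \<le> real (lpp (insert (1, 0) S) c n) - real (lpp (S - {(1, 0)}) c n) \<and>
      real (lpp (insert (1, 0) S) c n) - real (lpp (S - {(1, 0)}) c n) \<le> 1" for S
    using lpp_discrepancy[of S c n] by auto
  then have "bexp (grid c n) (prm l m p) (\<lambda>_. 0) \<le> discr l m p c n"
    "discr l m p c n \<le> bexp (grid c n) (prm l m p) (\<lambda>_. 1)"
    unfolding discr_def by (intro bexp_mono is_prob_prm probs; simp)+
  then show "0 \<le> discr l m p c n" "discr l m p c n \<le> 1" by auto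
qed

lemma discr_mono: "c \<le> c' \<Longrightarrow> discr l m p c n \<le> discr l m p c' n"
proof (rule lift_Suc_mono_le[of "\<lambda>c. discr l m p c n"])
  fix c
  let ?f = "\<lambda>c S. real (lpp (insert (1, 0) S) c n) - real (lpp (S - {(1, 0)}) c n)"
  have "discr l m p c n = bexp (grid (Suc c) n) (prm l m p) (?f c)"
    unfolding discr_def
  proof (rule bexp_extend[symmetric])
    fix S :: "(nat \<times> nat) set"
    have "lpp (insert (1, 0) S) c n = lpp (insert (1, 0) (S \<inter> grid c n)) c n"
      "lpp (S - {(1, 0)}) c n = lpp (S \<inter> grid c n - {(1, 0)}) c n"
      by (rule lpp_cong; auto simp: grid_def)+
    then show "?f c S = ?f c (S \<inter> grid c n)" by simp
  qed (auto simp: grid_def)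
  also have "\<dots> \<le> discr l m p (Suc c) n"
    unfolding discr_def
  proof (intro bexp_mono is_prob_prm probs)
    fix S
    show "?f c S \<le> ?f (Suc c) S" using lpp_discrepancy[of S c n] by linarith
  qed
  finally show "discr l m p c n \<le> discr l m p (Suc c) n" .
qed

text \<open>By \<open>mean_lpp_Suc\<close> and \<open>discr_mono\<close> the increments do not
  increase with the column, so a secant slope lies between the values at its ends. This turns
  estimates of means into estimates of \<open>discr\<close>.\<close>

lemma mean_lpp_increment:
  assumes "l' * m = (1 - l') * (1 - m) * p" "l \<le> l'"
  shows "real d * (l + (l' - l) * (1 - discr l m p (c + d) n)) \<le> mean_lpp l m p (c + d) n - mean_lpp l m p c n"
    and "mean_lpp l m p (c + d) n - mean_lpp l m p c n \<le> real d * (l + (l' - l) * (1 - discr l m p c n))"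
proof -
  have eq: "mean_lpp l m p (c + d) n - mean_lpp l m p c n
      = (\<Sum>i<d. l + (l' - l) * (1 - discr l m p (c + Suc i) n))"
    by (induction d) (simp_all add: mean_lpp_Suc[OF assms(1)] algebra_simps)
  have "(\<Sum>i<d. l + (l' - l) * (1 - discr l m p (c + d) n))
      \<le> (\<Sum>i<d. l + (l' - l) * (1 - discr l m p (c + Suc i) n))"
    using assms(2) discr_mono by (intro sum_mono add_left_mono mult_left_mono) auto
  then show "real d * (l + (l' - l) * (1 - discr l m p (c + d) n)) \<le> mean_lpp l m p (c + d) n - mean_lpp l m p c n"
    using eq by simp
  have "(\<Sum>i<d. l + (l' - l) * (1 - discr l m p (c + Suc i) n))
      \<le> (\<Sum>i<d. l + (l' - l) * (1 - discr l m p c n))"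
    using assms(2) discr_mono by (intro sum_mono add_left_mono mult_left_mono) auto
  then show "mean_lpp l m p (c + d) n - mean_lpp l m p c n \<le> real d * (l + (l' - l) * (1 - discr l m p c n))"
    using eq by simp
qed

end

section \<open>The mean of the percolation time without sources and sinks\<close>

text \<open>The probability with odds \<open>x\<close>. In terms of odds the stationarity relation
  reads \<open>x * y = p\<close>, so multiplying one by \<open>r\<close> and dividing the other by
  \<open>r\<close> preserves it.\<close>

definition odds_prob :: "real \<Rightarrow> real" where
  "odds_prob x = x / (1 + x)"

lemma odds_prob_bounds:
  assumes "0 \<le> x"
  shows "0 \<le> odds_prob x" "odds_prob x \<le> x" "odds_prob x \<le> 1" "x - x\<^sup>2 \<le> odds_prob x"
  using assms by (auto simp: odds_prob_def field_simps power2_eq_square power3_eq_cube)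

lemma odds_prob_burke:
  "0 \<le> x \<Longrightarrow> 0 \<le> y \<Longrightarrow> odds_prob x * odds_prob y = (1 - odds_prob x) * (1 - odds_prob y) * (x * y)"
  by (simp add: odds_prob_def field_simps)

lemma odds_prob_mono: "0 \<le> x \<Longrightarrow> x \<le> y \<Longrightarrow> odds_prob x \<le> odds_prob y"
  by (simp add: odds_prob_def field_simps)

text \<open>The constant \<open>3 / 4\<close> absorbs the two denominators, whose product is at most
  \<open>13 / 12 * 14 / 12 < 4 / 3\<close> in this range.\<close>

lemma odds_prob_increase:
  assumes "0 \<le> x" "x \<le> 1 / 12" "0 \<le> e" "e \<le> 1"
  shows "3 / 4 * e * x \<le> odds_prob ((1 + e) * x) - odds_prob x"
proof -
  have "(1 + e) * x \<le> 2 * (1 / 12)" using assms by (intro mult_mono) auto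
  then have "(1 + x) * (1 + (1 + e) * x) \<le> (1 + 1 / 12) * (1 + 2 * (1 / 12))"
    using assms by (intro mult_mono) auto
  then have le: "3 / 4 * ((1 + x) * (1 + (1 + e) * x)) \<le> 1" by simp
  have pos: "0 < (1 + x) * (1 + (1 + e) * x)" using assms by (auto intro!: mult_pos_pos add_pos_nonneg)
  have "1 + x \<noteq> 0" "1 + (1 + e) * x \<noteq> 0" using pos by auto
  then have eq: "odds_prob ((1 + e) * x) - odds_prob x = e * x / ((1 + x) * (1 + (1 + e) * x))"
    by (simp add: odds_prob_def diff_frac_eq algebra_simps)
  have "3 / 4 * ((1 + x) * (1 + (1 + e) * x)) * (e * x) \<le> 1 * (e * x)"
    using le assms by (intro mult_right_mono) auto
  then show ?thesis unfolding eq using pos by (simp add: pos_le_divide_eq mult_ac)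
qed

text \<open>The maximum exceeds the largest of the means by at most the sum of the absolute
  deviations, and each mean deviation is at most the standard deviation.\<close>

lemma bexp_max3:
  assumes "finite I" "is_prob_on I p"
  shows "bexp I p (\<lambda>S. max (f S) (max (g S) (h S)))
    \<le> max (bexp I p f) (max (bexp I p g) (bexp I p h)) + sqrt (bvar I p f) + sqrt (bvar I p g) + sqrt (bvar I p h)"
proof -
  define M where "M = max (bexp I p f) (max (bexp I p g) (bexp I p h))"
  have "bexp I p (\<lambda>S. max (f S) (max (g S) (h S)))
      \<le> bexp I p (\<lambda>S. M + \<bar>f S - bexp I p f\<bar> + \<bar>g S - bexp I p g\<bar> + \<bar>h S - bexp I p h\<bar>)"
    by (rule bexp_mono[OF assms(2)]) (auto simp: M_def)
  also have "\<dots> = M + bexp I p (\<lambda>S. \<bar>f S - bexp I p f\<bar>) + bexp I p (\<lambda>S. \<bar>g S - bexp I p g\<bar>)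
      + bexp I p (\<lambda>S. \<bar>h S - bexp I p h\<bar>)"
    using assms(1) by (simp add: bexp_add)
  also have "\<dots> \<le> M + sqrt (bvar I p f) + sqrt (bvar I p g) + sqrt (bvar I p h)"
    using bexp_abs_dev[OF assms] by (intro add_mono order_refl)
  finally show ?thesis by (simp add: M_def)
qed

section \<open>Paths classified by where they leave the axes\<close>

definition source_part :: "nat \<Rightarrow> (nat \<times> nat) set" where
  "source_part d = {1..d} \<times> {0}"

definition sink_part :: "nat \<Rightarrow> (nat \<times> nat) set" where
  "sink_part d = {0} \<times> {1..d}"

text \<open>Every chain in the grid with a source beyond column \<open>d\<close> is a subset of a
  member. Adding all of the first \<open>d\<close> sources leaves a chain and gives the family the
  common part that \<open>bexp_cov_increase\<close> exploits.\<close>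

definition late_source_chains :: "nat \<Rightarrow> nat \<Rightarrow> nat \<Rightarrow> (nat \<times> nat) set set" where
  "late_source_chains c n d = {source_part d \<union> C | C. C \<subseteq> {Suc d..c} \<times> {0..n} \<and> chain C}"

definition late_sink_chains :: "nat \<Rightarrow> nat \<Rightarrow> nat \<Rightarrow> (nat \<times> nat) set set" where
  "late_sink_chains c n d = {sink_part d \<union> C | C. C \<subseteq> {0..c} \<times> {Suc d..n} \<and> chain C}"

text \<open>These sets can contain sources and sinks at once and then are not chains; they serve
  only as an upper bound for chains that leave the axes early.\<close>

definition early_exit_sets :: "nat \<Rightarrow> nat \<Rightarrow> nat \<Rightarrow> nat \<Rightarrow> (nat \<times> nat) set set" where
  "early_exit_sets c n d d' = {source_part d \<union> sink_part d' \<union> C | C. C \<subseteq> {1..c} \<times> {1..n} \<and> chain C}"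

lemma chain_empty [simp]: "chain {}"
  by (simp add: chain_def)

lemma late_source_chains:
  "finite (late_source_chains c n d)" "late_source_chains c n d \<noteq> {}"
  "d \<le> c \<Longrightarrow> C \<in> late_source_chains c n d \<Longrightarrow> source_part d \<subseteq> C \<and> C \<subseteq> grid c n \<and> chain C"
  "C \<in> late_source_chains c n d \<Longrightarrow> (0, Suc j) \<notin> C"
proof -
  have "late_source_chains c n d = (\<lambda>C. source_part d \<union> C) ` {C. C \<subseteq> {Suc d..c} \<times> {0..n} \<and> chain C}"
    by (auto simp: late_source_chains_def)
  then show "finite (late_source_chains c n d)" by simp
  show "late_source_chains c n d \<noteq> {}"
    unfolding late_source_chains_def using chain_empty by blast
next
  assume "C \<in> late_source_chains c n d" "d \<le> c"
  then obtain C' where C: "C = source_part d \<union> C'" "C' \<subseteq> {Suc d..c} \<times> {0..n}" "chain C'"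
    by (auto simp: late_source_chains_def)
  have "a = b \<or> prec a b \<or> prec b a" if "a \<in> C" "b \<in> C" for a b
  proof -
    have 1: "a = b \<or> prec a b \<or> prec b a" if "a \<in> source_part d" "b \<in> source_part d" for a b
      using that by (cases a; cases b) (auto simp: source_part_def prec_def)
    have 2: "prec a b" if "a \<in> source_part d" "b \<in> C'" for a b
    proof -
      have "Suc d \<le> fst b" using that(2) C(2) by auto
      then show ?thesis using that(1) by (auto simp: source_part_def prec_def)
    qed
    have 3: "a = b \<or> prec a b \<or> prec b a" if "a \<in> C'" "b \<in> C'" for a b
      using that C(3) by (simp add: chain_def)
    show ?thesis using that 1 2 3 unfolding C(1) by blast
  qed
  then have "chain C" by (simp add: chain_def)
  moreover have "source_part d \<subseteq> grid c n" using \<open>d \<le> c\<close> by (auto simp: source_part_def grid_def)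
  moreover have "C' \<subseteq> grid c n" using C(2) by (auto simp: grid_def)
  ultimately show "source_part d \<subseteq> C \<and> C \<subseteq> grid c n \<and> chain C" using C(1) by auto
next
  show "(0, Suc j) \<notin> C" if "C \<in> late_source_chains c n d"
    using that by (auto simp: late_source_chains_def source_part_def)
qed

lemma late_sink_chains:
  "finite (late_sink_chains c n d)" "late_sink_chains c n d \<noteq> {}"
  "d \<le> n \<Longrightarrow> C \<in> late_sink_chains c n d \<Longrightarrow> sink_part d \<subseteq> C \<and> C \<subseteq> grid c n \<and> chain C"
  "C \<in> late_sink_chains c n d \<Longrightarrow> (Suc i, 0) \<notin> C"
proof -
  have "late_sink_chains c n d = (\<lambda>C. sink_part d \<union> C) ` {C. C \<subseteq> {0..c} \<times> {Suc d..n} \<and> chain C}"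
    by (auto simp: late_sink_chains_def)
  then show "finite (late_sink_chains c n d)" by simp
  show "late_sink_chains c n d \<noteq> {}"
    unfolding late_sink_chains_def using chain_empty by blast
next
  assume "C \<in> late_sink_chains c n d" "d \<le> n"
  then obtain C' where C: "C = sink_part d \<union> C'" "C' \<subseteq> {0..c} \<times> {Suc d..n}" "chain C'"
    by (auto simp: late_sink_chains_def)
  have "a = b \<or> prec a b \<or> prec b a" if "a \<in> C" "b \<in> C" for a b
  proof -
    have 1: "a = b \<or> prec a b \<or> prec b a" if "a \<in> sink_part d" "b \<in> sink_part d" for a b
      using that by (cases a; cases b) (auto simp: sink_part_def prec_def)
    have 2: "prec a b" if "a \<in> sink_part d" "b \<in> C'" for a b
    proof -
      have "Suc d \<le> snd b" using that(2) C(2) by auto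
      then show ?thesis using that(1) by (auto simp: sink_part_def prec_def)
    qed
    have 3: "a = b \<or> prec a b \<or> prec b a" if "a \<in> C'" "b \<in> C'" for a b
      using that C(3) by (simp add: chain_def)
    show ?thesis using that 1 2 3 unfolding C(1) by blast
  qed
  then have "chain C" by (simp add: chain_def)
  moreover have "sink_part d \<subseteq> grid c n" using \<open>d \<le> n\<close> by (auto simp: sink_part_def grid_def)
  moreover have "C' \<subseteq> grid c n" using C(2) by (auto simp: grid_def)
  ultimately show "sink_part d \<subseteq> C \<and> C \<subseteq> grid c n \<and> chain C" using C(1) by auto
next
  show "(Suc i, 0) \<notin> C" if "C \<in> late_sink_chains c n d"
    using that by (auto simp: late_sink_chains_def sink_part_def)
qed

lemma early_exit_sets:
  "finite (early_exit_sets c n d d')" "early_exit_sets c n d d' \<noteq> {}"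
proof -
  have "early_exit_sets c n d d' = (\<lambda>C. source_part d \<union> sink_part d' \<union> C) ` {C. C \<subseteq> {1..c} \<times> {1..n} \<and> chain C}"
    by (auto simp: early_exit_sets_def)
  then show "finite (early_exit_sets c n d d')" by simp
  show "early_exit_sets c n d d' \<noteq> {}"
    unfolding early_exit_sets_def using chain_empty by blast
qed

lemma cov_subfamily_le_lpp:
  assumes "finite \<C>" "\<C> \<noteq> {}" "\<And>C. C \<in> \<C> \<Longrightarrow> C \<subseteq> grid c n \<and> chain C"
  shows "cov \<C> S \<le> lpp S c n"
proof -
  obtain C where C: "C \<in> \<C>" "cov \<C> S = card (C \<inter> S)" using cov_attained[OF assms(1,2)] by metis
  have "card (C \<inter> S) \<le> lpp S c n"
    using assms(3)[OF C(1)] by (intro card_chain_le_lpp) (auto intro: chain_subset)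
  then show ?thesis using C by simp
qed

text \<open>The cases are an optimal chain with a source beyond \<open>d\<close>, with a sink beyond
  \<open>d'\<close>, or with neither. A point comparable to a source but off the source axis lies to
  the right of it, so in the first case only sources occur in the first \<open>d\<close>
  columns.\<close>

lemma lpp_le_max_cov:
  "lpp S c n \<le> max (cov (late_source_chains c n d) S)
     (max (cov (late_sink_chains c n d') S) (cov (early_exit_sets c n d d') S))"
proof -
  obtain C where C: "chain C" "C \<subseteq> grid c n" "C \<subseteq> S" "card C = lpp S c n"
    using lpp_chain_exists[of c n S] by blast
  have le: "lpp S c n \<le> cov \<C> S" if "finite \<C>" "C' \<in> \<C>" "C \<subseteq> C'" "finite C'" for \<C> C'
  proof -
    have "card C \<le> card (C' \<inter> S)" using that C by (intro card_mono) auto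
    also have "\<dots> \<le> cov \<C> S" using that by (intro cov_ge) auto
    finally show ?thesis using C by simp
  qed
  have cmp: "a = b \<or> prec a b \<or> prec b a" if "a \<in> C" "b \<in> C" for a b
    using C(1) that by (simp add: chain_def)
  have gr: "fst b \<le> c \<and> snd b \<le> n \<and> b \<noteq> (0, 0)" if "b \<in> C" for b
    using C(2) that by (auto simp: grid_def)
  show ?thesis
  proof (cases "\<exists>i>d. (i, 0) \<in> C")
    case True
    then obtain i where i: "i > d" "(i, 0) \<in> C" by blast
    let ?D = "C \<inter> {Suc d..c} \<times> {0..n}"
    have "C \<subseteq> source_part d \<union> ?D"
    proof
      fix b assume b: "b \<in> C"
      then have "b = (i, 0) \<or> prec b (i, 0) \<or> prec (i, 0) b" using cmp i by blast
      then show "b \<in> source_part d \<union> ?D"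
        using b gr[OF b] i by (cases b) (auto simp: prec_def source_part_def)
    qed
    moreover have "source_part d \<union> ?D \<in> late_source_chains c n d"
      unfolding late_source_chains_def mem_Collect_eq by (rule exI[of _ ?D]) (auto intro: chain_subset[OF C(1)])
    moreover have "finite (source_part d \<union> ?D)" by (simp add: source_part_def)
    ultimately have "lpp S c n \<le> cov (late_source_chains c n d) S"
      using late_source_chains(1) by (intro le)
    then show ?thesis by simp
  next
    case nosrc: False
    show ?thesis
    proof (cases "\<exists>j>d'. (0, j) \<in> C")
      case True
      then obtain j where j: "j > d'" "(0, j) \<in> C" by blast
      let ?D = "C \<inter> {0..c} \<times> {Suc d'..n}"
      have "C \<subseteq> sink_part d' \<union> ?D"
      proof
        fix b assume b: "b \<in> C"
        then have "b = (0, j) \<or> prec b (0, j) \<or> prec (0, j) b" using cmp j by blast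
        then show "b \<in> sink_part d' \<union> ?D"
          using b gr[OF b] j by (cases b) (auto simp: prec_def sink_part_def)
      qed
      moreover have "sink_part d' \<union> ?D \<in> late_sink_chains c n d'"
        unfolding late_sink_chains_def mem_Collect_eq by (rule exI[of _ ?D]) (auto intro: chain_subset[OF C(1)])
      moreover have "finite (sink_part d' \<union> ?D)" by (simp add: sink_part_def)
      ultimately have "lpp S c n \<le> cov (late_sink_chains c n d') S"
        using late_sink_chains(1) by (intro le)
      then show ?thesis by simp
    next
      case False
      let ?D = "C \<inter> {1..c} \<times> {1..n}"
      have "C \<subseteq> source_part d \<union> sink_part d' \<union> ?D"
      proof
        fix b assume b: "b \<in> C"
        obtain i j where ij: "b = (i, j)" by (cases b)
        have "j = 0 \<Longrightarrow> i \<le> d" "i = 0 \<Longrightarrow> j \<le> d'"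
          using nosrc False b ij by (auto simp: not_less)
        then show "b \<in> source_part d \<union> sink_part d' \<union> ?D"
          using b gr[OF b] ij by (cases i; cases j) (auto simp: source_part_def sink_part_def)
      qed
      moreover have "source_part d \<union> sink_part d' \<union> ?D \<in> early_exit_sets c n d d'"
        unfolding early_exit_sets_def mem_Collect_eq by (rule exI[of _ ?D]) (auto intro: chain_subset[OF C(1)])
      moreover have "finite (source_part d \<union> sink_part d' \<union> ?D)"
        by (simp add: source_part_def sink_part_def)
      ultimately have "lpp S c n \<le> cov (early_exit_sets c n d d') S"
        using early_exit_sets(1) by (intro le)
      then show ?thesis by simp
    qed
  qed
qed

lemma bexp_prm_card:
  assumes "A \<subseteq> grid c n" "\<And>x. x \<in> A \<Longrightarrow> prm l m p x = r"
  shows "bexp (grid c n) (prm l m p) (\<lambda>S. real (card (A \<inter> S))) = real (card A) * r"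
proof -
  have fin: "finite A" by (rule finite_subset[OF assms(1) finite_grid])
  have "real (card (A \<inter> S)) = (\<Sum>x\<in>A. of_bool (x \<in> S))" for S
    using fin by (simp add: Int_def)
  then have "bexp (grid c n) (prm l m p) (\<lambda>S. real (card (A \<inter> S)))
      = (\<Sum>x\<in>A. bexp (grid c n) (prm l m p) (\<lambda>S. of_bool (x \<in> S)))"
    by (simp add: bexp_sum del: sum_of_bool_eq)
  also have "\<dots> = (\<Sum>x\<in>A. r)"
    using assms by (intro sum.cong refl) (subst bexp_mem1; auto)
  finally show ?thesis by simp
qed

text \<open>Such a set gains at most the first \<open>d\<close> sources and \<open>d'\<close> sinks
  over a chain of interior points. The law of the interior does not depend on \<open>l\<close> and
  \<open>m\<close>, which brings in the model without sources and sinks.\<close>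

lemma bexp_early_exit:
  assumes "d \<le> c" "d' \<le> n" "0 \<le> l" "l \<le> 1" "0 \<le> m" "m \<le> 1" "0 \<le> p" "p \<le> 1"
  shows "bexp (grid c n) (prm l m p) (\<lambda>S. real (cov (early_exit_sets c n d d') S))
    \<le> real d * l + real d' * m + mean_lpp 0 0 p c n"
proof -
  let ?Q = "{1..c} \<times> {1..n}"
  have "bexp (grid c n) (prm l m p) (\<lambda>S. real (cov (early_exit_sets c n d d') S))
      \<le> bexp (grid c n) (prm l m p) (\<lambda>S. real (card (source_part d \<inter> S))
          + real (card (sink_part d' \<inter> S)) + real (lpp (S \<inter> ?Q) c n))"
  proof (rule bexp_mono)
    show "is_prob_on (grid c n) (prm l m p)" using assms by (intro is_prob_prm)
    fix S assume S: "S \<subseteq> grid c n"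
    have fS: "finite S" by (rule finite_subset[OF S finite_grid])
    obtain C' where C': "C' \<in> early_exit_sets c n d d'"
        "cov (early_exit_sets c n d d') S = card (C' \<inter> S)"
      using cov_attained[OF early_exit_sets] by metis
    then obtain C where C: "C' = source_part d \<union> sink_part d' \<union> C" "C \<subseteq> ?Q" "chain C"
      by (auto simp: early_exit_sets_def)
    have "card (C' \<inter> S) \<le> card ((source_part d \<inter> S) \<union> (sink_part d' \<inter> S) \<union> (C \<inter> S))"
      using C fS by (intro card_mono) auto
    also have "\<dots> \<le> card (source_part d \<inter> S) + card (sink_part d' \<inter> S) + card (C \<inter> S)"
      by (meson card_Un_le order_trans add_le_mono1)
    also have "card (C \<inter> S) \<le> lpp (S \<inter> ?Q) c n"
      using C by (intro card_chain_le_lpp) (auto intro: chain_subset simp: grid_def)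
    finally show "real (cov (early_exit_sets c n d d') S) \<le> real (card (source_part d \<inter> S))
        + real (card (sink_part d' \<inter> S)) + real (lpp (S \<inter> ?Q) c n)"
      using C' by linarith
  qed
  also have "\<dots> = real d * l + real d' * m + bexp (grid c n) (prm l m p) (\<lambda>S. real (lpp (S \<inter> ?Q) c n))"
  proof -
    have "bexp (grid c n) (prm l m p) (\<lambda>S. real (card (source_part d \<inter> S))) = real (card (source_part d)) * l"
      using assms by (intro bexp_prm_card) (auto simp: source_part_def grid_def prm_def)
    moreover have "bexp (grid c n) (prm l m p) (\<lambda>S. real (card (sink_part d' \<inter> S))) = real (card (sink_part d')) * m"
      using assms by (intro bexp_prm_card) (auto simp: sink_part_def grid_def prm_def)
    ultimately show ?thesis
      by (simp add: bexp_add source_part_def sink_part_def card_cartesian_product)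
  qed
  also have "bexp (grid c n) (prm l m p) (\<lambda>S. real (lpp (S \<inter> ?Q) c n)) \<le> mean_lpp 0 0 p c n"
  proof -
    have Q: "?Q \<subseteq> grid c n" by (auto simp: grid_def)
    have ext: "bexp (grid c n) (prm l m p) (\<lambda>S. real (lpp (S \<inter> ?Q) c n))
        = bexp ?Q (prm l m p) (\<lambda>S. real (lpp (S \<inter> ?Q) c n))" for l m
      by (rule bexp_extend[OF finite_grid Q]) (simp add: Int_assoc)
    have "bexp ?Q (prm l m p) (\<lambda>S. real (lpp (S \<inter> ?Q) c n)) = bexp ?Q (prm 0 0 p) (\<lambda>S. real (lpp (S \<inter> ?Q) c n))"
      by (rule bexp_cong) (auto simp: prm_def)
    then have "bexp (grid c n) (prm l m p) (\<lambda>S. real (lpp (S \<inter> ?Q) c n))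
        = bexp (grid c n) (prm 0 0 p) (\<lambda>S. real (lpp (S \<inter> ?Q) c n))"
      by (simp only: ext)
    also have "\<dots> \<le> mean_lpp 0 0 p c n"
      unfolding mean_lpp_def
    proof (rule bexp_mono)
      fix S assume "S \<subseteq> grid c n"
      then have "finite S" by (rule finite_subset) simp
      then show "real (lpp (S \<inter> ?Q) c n) \<le> real (lpp S c n)"
        unfolding lpp_eq_cov using chain_empty
        by (intro of_nat_mono cov_mono) (auto intro!: exI[of _ "{}"])
    qed (use assms in \<open>auto intro!: is_prob_prm\<close>)
    finally show ?thesis .
  qed
  finally show ?thesis by simp
qed

text \<open>The stationary passage time has mean close to \<open>2 * s\<close>. Scaling the odds by
  \<open>1 + e\<close> preserves stationarity and raises the mean only to second order in
  \<open>e\<close>, while a path that stays on an axis for a fraction \<delta> of its length would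
  gain to first order. Such paths are therefore too short, and the paths that leave early must
  account for the mean. The lower bound for \<open>s\<close> makes fluctuations of order
  \<open>sqrt s\<close> negligible.\<close>

lemma mean_alpha_lower:
  fixes \<delta> x y s p :: real and c n :: nat
  assumes \<delta>: "0 < \<delta>" "\<delta> \<le> 1" and xy: "0 < x" "0 < y" "x \<le> \<delta>\<^sup>2 / 64" "y \<le> \<delta>\<^sup>2 / 64"
    and p: "p = x * y" "p \<le> 1" and s: "real c * x = s" "real n * y = s" "(160 / \<delta>\<^sup>2)\<^sup>2 \<le> s"
  shows "(2 - 3 * \<delta>) * s \<le> mean_lpp 0 0 p c n"
proof -
  define l m where "l = odds_prob x" "m = odds_prob y"
  define I where "I = grid c n"
  define q where "q = prm l m p"
  define d d' where "d = nat \<lfloor>\<delta> * real c\<rfloor>" "d' = nat \<lfloor>\<delta> * real n\<rfloor>"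
  \<comment> \<open>The paths that stay late fall short by
    \<open>(9 / 16 * \<delta> * e - e\<^sup>2) * s\<close>, which is nearly maximal at
    \<open>e = \<delta> / 4\<close>; this leaves the constant \<open>5 / 64\<close>.\<close>
  define e where "e = \<delta> / 4"
  have e: "0 < e" "e \<le> 1" "0 \<le> e" using \<delta> by (auto simp: e_def)
  have \<delta>2: "\<delta>\<^sup>2 \<le> \<delta>" "0 < \<delta>\<^sup>2" using \<delta> by (auto simp: power2_eq_square mult_left_le)
  have x12: "x \<le> 1 / 12" "y \<le> 1 / 12" using xy \<delta>2 \<delta> by linarith+
  have p0: "0 \<le> p" using p xy by simp
  have fin: "finite I" by (simp add: I_def)
  have prob: "is_prob_on I (prm (odds_prob a) (odds_prob b) p)" if "0 \<le> a" "0 \<le> b" for a b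
    using that odds_prob_bounds p0 p(2) by (intro is_prob_prm) auto
  have q: "is_prob_on I q" unfolding q_def l_m_def using xy by (intro prob) auto
  have "1 \<le> 160 / \<delta>\<^sup>2" using \<delta>2 \<delta> by (simp add: field_simps)
  then have "1 \<le> (160 / \<delta>\<^sup>2)\<^sup>2" by (simp add: one_le_power)
  then have s1: "1 \<le> s" using s(3) by linarith
  \<comment> \<open>Three standard deviations of at most \<open>3 / 2 * sqrt s\<close> each stay
    below \<open>5 * sqrt s\<close>, and \<open>160\<close> is \<open>5 * 32\<close>.\<close>
  have sqs: "5 * sqrt s \<le> \<delta>\<^sup>2 / 32 * s"
  proof -
    have "160 / \<delta>\<^sup>2 \<le> sqrt s" using s(3) \<delta>2 by (intro real_le_rsqrt) auto
    then have "160 \<le> \<delta>\<^sup>2 * sqrt s" using \<delta>2 by (simp add: field_simps)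
    then have "160 * sqrt s \<le> \<delta>\<^sup>2 * sqrt s * sqrt s" using s1 by (intro mult_right_mono) auto
    also have "\<dots> = \<delta>\<^sup>2 * s" using s1 by simp
    finally show ?thesis by simp
  qed
  \<comment> \<open>The smallness of \<open>z\<close> makes \<open>\<delta> * k\<close> at least
    \<open>64\<close>, so rounding down costs less than a quarter.\<close>
  have large: "3 / 4 * (\<delta> * real k) \<le> real (nat \<lfloor>\<delta> * real k\<rfloor>)" "real (nat \<lfloor>\<delta> * real k\<rfloor>) \<le> \<delta> * real k"
      "nat \<lfloor>\<delta> * real k\<rfloor> \<le> k" if k: "real k * z = s" "z \<le> \<delta>\<^sup>2 / 64" for k z
  proof -
    have "real k * z \<le> real k * (\<delta> / 64)" using k(2) \<delta>2 by (intro mult_left_mono) auto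
    then have "64 \<le> \<delta> * real k" using k(1) s1 by (simp add: algebra_simps)
    then show "3 / 4 * (\<delta> * real k) \<le> real (nat \<lfloor>\<delta> * real k\<rfloor>)" by linarith
    show 1: "real (nat \<lfloor>\<delta> * real k\<rfloor>) \<le> \<delta> * real k" using \<delta> by simp
    have "\<delta> * real k \<le> real k" using \<delta> by (simp add: mult_left_le_one_le)
    then show "nat \<lfloor>\<delta> * real k\<rfloor> \<le> k" using 1 by linarith
  qed
  note d = large[OF s(1) xy(3), folded d_d'_def] and d' = large[OF s(2) xy(4), folded d_d'_def]
  have mean_up: "mean_lpp (odds_prob (r * x)) (odds_prob (y / r)) p c n \<le> r * s + s / r" if "0 < r" for r
  proof -
    have "r * x * (y / r) = p" using that p by simp
    then have "mean_lpp (odds_prob (r * x)) (odds_prob (y / r)) p c n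
        = real c * odds_prob (r * x) + real n * odds_prob (y / r)"
      using odds_prob_burke[of "r * x" "y / r"] that xy by (intro mean_lpp_stationary) simp
    also have "\<dots> \<le> real c * (r * x) + real n * (y / r)"
      using that xy by (intro add_mono mult_left_mono odds_prob_bounds) auto
    also have "\<dots> = r * (real c * x) + real n * y / r" by simp
    finally show ?thesis by (simp only: s)
  qed
  \<comment> \<open>The function \<open>r + 1 / r\<close> has its minimum at \<open>1\<close>, so
    its excess over \<open>2\<close> is quadratic in \<open>e\<close>.\<close>
  have inv: "(1 + e) + 1 / (1 + e) \<le> 2 + e\<^sup>2"
    using e by (simp add: field_simps power2_eq_square)
  have mean_e: "mean_lpp (odds_prob ((1 + e) * x)) (odds_prob (y / (1 + e))) p c n \<le> 2 * s + \<delta>\<^sup>2 / 16 * s"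
    "mean_lpp (odds_prob (1 / (1 + e) * x)) (odds_prob (y / (1 / (1 + e)))) p c n \<le> 2 * s + \<delta>\<^sup>2 / 16 * s"
  proof -
    have "((1 + e) + 1 / (1 + e)) * s \<le> (2 + e\<^sup>2) * s" using inv s1 by (intro mult_right_mono) auto
    then have *: "(1 + e) * s + s / (1 + e) \<le> 2 * s + \<delta>\<^sup>2 / 16 * s"
      by (simp add: e_def power_divide ring_distribs)
    show "mean_lpp (odds_prob ((1 + e) * x)) (odds_prob (y / (1 + e))) p c n \<le> 2 * s + \<delta>\<^sup>2 / 16 * s"
      using mean_up[of "1 + e"] * e by linarith
    show "mean_lpp (odds_prob (1 / (1 + e) * x)) (odds_prob (y / (1 / (1 + e)))) p c n \<le> 2 * s + \<delta>\<^sup>2 / 16 * s"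
    proof -
      have "0 < 1 / (1 + e)" using e by simp
      moreover have "s / (1 / (1 + e)) = (1 + e) * s" "1 / (1 + e) * s = s / (1 + e)" by simp_all
      ultimately show ?thesis using mean_up[of "1 / (1 + e)"] * by linarith
    qed
  qed
  define EL where "EL = mean_lpp l m p c n"
  have EL: "2 * s - \<delta>\<^sup>2 / 32 * s \<le> EL" "EL \<le> 2 * s"
  proof -
    show "EL \<le> 2 * s" using mean_up[of 1] by (simp add: EL_def l_m_def)
    have "EL = real c * l + real n * m"
      unfolding EL_def l_m_def using odds_prob_burke[of x y] xy p by (intro mean_lpp_stationary) simp
    moreover have "real c * (x - x\<^sup>2) \<le> real c * l" "real n * (y - y\<^sup>2) \<le> real n * m"
      unfolding l_m_def using xy by (intro mult_left_mono odds_prob_bounds; simp)+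
    moreover have "real c * (x - x\<^sup>2) = s - s * x" "real n * (y - y\<^sup>2) = s - s * y"
      using s(1,2) by (simp_all add: power2_eq_square right_diff_distrib flip: mult.assoc)
    moreover have "s * x \<le> s * (\<delta>\<^sup>2 / 64)" "s * y \<le> s * (\<delta>\<^sup>2 / 64)"
      using xy s1 by (intro mult_left_mono; simp)+
    moreover have "2 * s - \<delta>\<^sup>2 / 32 * s = (s - s * (\<delta>\<^sup>2 / 64)) + (s - s * (\<delta>\<^sup>2 / 64))"
      by (simp add: field_simps)
    ultimately show "2 * s - \<delta>\<^sup>2 / 32 * s \<le> EL" by linarith
  qed
  define A B Y where "A = (\<lambda>S. real (cov (late_source_chains c n d) S))"
    "B = (\<lambda>S. real (cov (late_sink_chains c n d') S))"
    "Y = (\<lambda>S. real (cov (early_exit_sets c n d d') S))"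
  note lc = late_source_chains[where c=c and n=n and d=d] and lk = late_sink_chains[where c=c and n=n and d=d']
  have A_le: "bexp I r A \<le> bexp I r (\<lambda>S. real (lpp S c n))" if "is_prob_on I r" for r
    unfolding A_B_Y_def
  proof (rule bexp_mono[OF that], rule of_nat_mono, rule cov_subfamily_le_lpp[OF lc(1,2)])
    fix C assume "C \<in> late_source_chains c n d"
    from lc(3)[OF d(3) this] show "C \<subseteq> grid c n \<and> chain C" by simp
  qed
  have B_le: "bexp I r B \<le> bexp I r (\<lambda>S. real (lpp S c n))" if "is_prob_on I r" for r
    unfolding A_B_Y_def
  proof (rule bexp_mono[OF that], rule of_nat_mono, rule cov_subfamily_le_lpp[OF lk(1,2)])
    fix C assume "C \<in> late_sink_chains c n d'"
    from lk(3)[OF d'(3) this] show "C \<subseteq> grid c n \<and> chain C" by simp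
  qed
  \<comment> \<open>With the source odds raised and the sink odds lowered, the mean of
    \<open>A\<close> gains at least \<open>9 / 64 * \<delta>\<^sup>2 * s\<close> from the first
    \<open>d\<close> sources, but stays below the new stationary mean, which exceeds
    \<open>2 * s\<close> by at most \<open>4 / 64 * \<delta>\<^sup>2 * s\<close>.\<close>
  have EA: "bexp I q A \<le> 2 * s - 5 / 64 * \<delta>\<^sup>2 * s"
  proof -
    define l' m' where "l' = odds_prob ((1 + e) * x)" "m' = odds_prob (y / (1 + e))"
    define q' where "q' = prm l' m' p"
    have pr: "is_prob_on I q'" unfolding q'_def l'_m'_def using xy e by (intro prob) auto
    have ll: "l \<le> l'" unfolding l_m_def l'_m'_def using xy e by (intro odds_prob_mono) auto
    have "bexp I q A + (\<Sum>i\<in>source_part d. q' i - q i) \<le> bexp I q' A"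
      unfolding A_B_Y_def
    proof (rule bexp_cov_increase[OF fin q pr lc(1,2)])
      show "source_part d \<subseteq> C \<and> C \<subseteq> I" if "C \<in> late_source_chains c n d" for C
        using lc(3)[OF d(3) that] by (simp add: I_def)
      fix i assume "i \<in> \<Union> (late_source_chains c n d)"
      then have "i \<noteq> (0, Suc j)" for j using lc(4) by auto
      then show "q i \<le> q' i"
        using ll by (cases i; cases "snd i") (auto simp: q_def q'_def prm_def)
    qed
    also have "\<dots> \<le> mean_lpp l' m' p c n"
      using A_le[OF pr] by (simp add: mean_lpp_def I_def q'_def)
    also have "\<dots> \<le> 2 * s + \<delta>\<^sup>2 / 16 * s" using mean_e(1) by (simp add: l'_m'_def)
    finally have 1: "bexp I q A + (\<Sum>i\<in>source_part d. q' i - q i) \<le> 2 * s + \<delta>\<^sup>2 / 16 * s" .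
    have "(\<Sum>i\<in>source_part d. q' i - q i) = (\<Sum>i\<in>source_part d. l' - l)"
      by (rule sum.cong) (auto simp: source_part_def q_def q'_def prm_def)
    also have "\<dots> = real d * (l' - l)" by (simp add: source_part_def card_cartesian_product)
    also have "\<dots> \<ge> (3 / 4 * (\<delta> * real c)) * (3 / 4 * e * x)"
      using d(1) odds_prob_increase[of x e] xy x12 e \<delta>
      by (intro mult_mono) (auto simp: l'_m'_def l_m_def)
    also have "(3 / 4 * (\<delta> * real c)) * (3 / 4 * e * x) = 9 / 64 * \<delta>\<^sup>2 * s"
      using s(1)[symmetric] by (simp add: e_def power2_eq_square)
    finally show ?thesis using 1 by (simp add: algebra_simps)
  qed
  have EB: "bexp I q B \<le> 2 * s - 5 / 64 * \<delta>\<^sup>2 * s"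
  proof -
    define l' m' where "l' = odds_prob (1 / (1 + e) * x)" "m' = odds_prob (y / (1 / (1 + e)))"
    define q' where "q' = prm l' m' p"
    have pr: "is_prob_on I q'" unfolding q'_def l'_m'_def using xy e by (intro prob) auto
    \<comment> \<open>Scaling by \<open>1 / (1 + e)\<close> instead raises the sink odds and lowers
      the source odds.\<close>
    have m': "m' = odds_prob ((1 + e) * y)" by (simp add: l'_m'_def mult.commute)
    have mm: "m \<le> m'" unfolding l_m_def m' using xy e by (intro odds_prob_mono) auto
    have "bexp I q B + (\<Sum>i\<in>sink_part d'. q' i - q i) \<le> bexp I q' B"
      unfolding A_B_Y_def
    proof (rule bexp_cov_increase[OF fin q pr lk(1,2)])
      show C: "sink_part d' \<subseteq> C \<and> C \<subseteq> I" if "C \<in> late_sink_chains c n d'" for C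
        using lk(3)[OF d'(3) that] by (simp add: I_def)
      fix i assume i: "i \<in> \<Union> (late_sink_chains c n d')"
      then have "i \<noteq> (Suc j, 0)" for j using lk(4) by auto
      moreover have "i \<noteq> (0, 0)" using i C by (auto simp: I_def grid_def)
      ultimately show "q i \<le> q' i"
        using mm by (cases i; cases "fst i"; cases "snd i") (auto simp: q_def q'_def prm_def)
    qed
    also have "\<dots> \<le> mean_lpp l' m' p c n"
      using B_le[OF pr] by (simp add: mean_lpp_def I_def q'_def)
    also have "\<dots> \<le> 2 * s + \<delta>\<^sup>2 / 16 * s" using mean_e(2) by (simp add: l'_m'_def)
    finally have 1: "bexp I q B + (\<Sum>i\<in>sink_part d'. q' i - q i) \<le> 2 * s + \<delta>\<^sup>2 / 16 * s" .
    have "(\<Sum>i\<in>sink_part d'. q' i - q i) = (\<Sum>i\<in>sink_part d'. m' - m)"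
      by (rule sum.cong) (auto simp: sink_part_def q_def q'_def prm_def)
    also have "\<dots> = real d' * (m' - m)" by (simp add: sink_part_def card_cartesian_product)
    also have "\<dots> \<ge> (3 / 4 * (\<delta> * real n)) * (3 / 4 * e * y)"
      using d'(1) odds_prob_increase[of y e] xy x12 e \<delta>
      by (intro mult_mono) (auto simp: m' l_m_def)
    also have "(3 / 4 * (\<delta> * real n)) * (3 / 4 * e * y) = 9 / 64 * \<delta>\<^sup>2 * s"
      using s(2)[symmetric] by (simp add: e_def power2_eq_square)
    finally show ?thesis using 1 by (simp add: algebra_simps)
  qed
  define E0 where "E0 = mean_lpp 0 0 p c n"
  have lm01: "0 \<le> l" "l \<le> 1" "0 \<le> m" "m \<le> 1" "l \<le> x" "m \<le> y"
    using xy odds_prob_bounds by (auto simp: l_m_def)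
  have EY: "bexp I q Y \<le> 2 * \<delta> * s + E0"
  proof -
    have "bexp I q Y \<le> real d * l + real d' * m + E0"
      unfolding A_B_Y_def I_def q_def E0_def using d(3) d'(3) lm01 p0 p by (intro bexp_early_exit) auto
    moreover have "real d * l \<le> (\<delta> * real c) * x" "real d' * m \<le> (\<delta> * real n) * y"
      using d(2) d'(2) lm01 \<delta> by (auto intro!: mult_mono)
    moreover have "(\<delta> * real c) * x = \<delta> * s" "(\<delta> * real n) * y = \<delta> * s"
      using s(1,2) by (simp_all add: mult.assoc)
    ultimately show ?thesis by linarith
  qed
  show ?thesis
  proof (rule ccontr)
    assume neg: "\<not> ?thesis"
    then have E0: "E0 < (2 - 3 * \<delta>) * s" by (simp add: E0_def)
    have EY': "bexp I q Y \<le> 2 * s - \<delta> * s" using EY E0 by (simp add: algebra_simps)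
    have \<delta>s: "\<delta>\<^sup>2 * s \<le> \<delta> * s" "0 \<le> \<delta>\<^sup>2 * s" "0 < \<delta>\<^sup>2 * s" using \<delta>2 s1 by (auto intro!: mult_right_mono)
    have bounds: "bexp I q A \<le> 2 * s - 5 / 64 * (\<delta>\<^sup>2 * s)" "bexp I q B \<le> 2 * s - 5 / 64 * (\<delta>\<^sup>2 * s)"
      "bexp I q Y \<le> 2 * s - 5 / 64 * (\<delta>\<^sup>2 * s)"
      using EA EB EY' \<delta>s by (simp_all add: mult.assoc)
    \<comment> \<open>By \<open>bvar_cov\<close> the variance is at most the mean;
      \<open>9 / 4\<close> is a square above \<open>2\<close>.\<close>
    have var: "sqrt (bvar I q f) \<le> 3 / 2 * sqrt s"
      if "bvar I q f \<le> bexp I q f" "bexp I q f \<le> 2 * s - 5 / 64 * (\<delta>\<^sup>2 * s)" for f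
    proof -
      have "bvar I q f \<le> 9 / 4 * s" using that \<delta>s s1 by linarith
      then have "sqrt (bvar I q f) \<le> sqrt (9 / 4 * s)" by simp
      also have "\<dots> = 3 / 2 * sqrt s" by (simp add: real_sqrt_mult real_sqrt_divide)
      finally show ?thesis .
    qed
    have "EL \<le> bexp I q (\<lambda>S. max (A S) (max (B S) (Y S)))"
      unfolding EL_def mean_lpp_def I_def[symmetric] q_def[symmetric]
    proof (rule bexp_mono[OF q])
      fix S
      show "real (lpp S c n) \<le> max (A S) (max (B S) (Y S))"
        using lpp_le_max_cov[of S c n d d'] unfolding A_B_Y_def by linarith
    qed
    also have "\<dots> \<le> max (bexp I q A) (max (bexp I q B) (bexp I q Y))
        + sqrt (bvar I q A) + sqrt (bvar I q B) + sqrt (bvar I q Y)"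
      by (rule bexp_max3[OF fin q])
    also have "\<dots> \<le> (2 * s - 5 / 64 * (\<delta>\<^sup>2 * s)) + 3 / 2 * sqrt s + 3 / 2 * sqrt s + 3 / 2 * sqrt s"
    proof (intro add_mono var bounds)
      show "bvar I q A \<le> bexp I q A" "bvar I q B \<le> bexp I q B" "bvar I q Y \<le> bexp I q Y"
        unfolding A_B_Y_def by (rule bvar_cov[OF fin q]; rule lc lk early_exit_sets)+
    qed (use bounds in auto)
    finally have "EL \<le> 2 * s - 5 / 64 * (\<delta>\<^sup>2 * s) + 9 / 2 * sqrt s" by simp
    moreover have "2 * s - 1 / 32 * (\<delta>\<^sup>2 * s) \<le> EL" using EL(1) by simp
    moreover have "5 * sqrt s \<le> 1 / 32 * (\<delta>\<^sup>2 * s)" using sqs by simp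
    moreover have "0 \<le> sqrt s" using s1 by simp
    \<comment> \<open>The gap \<open>5 / 64\<close> would have to be covered by the deficit of the
      stationary mean and the fluctuations, which are at most \<open>2 / 64\<close> each.\<close>
    ultimately have "5 / 64 * (\<delta>\<^sup>2 * s) \<le> 1 / 32 * (\<delta>\<^sup>2 * s) + 1 / 32 * (\<delta>\<^sup>2 * s)" by linarith
    then show False using \<delta>s by linarith
  qed
qed

section \<open>Discretisation of the quadrant\<close>

lemma mean_lpp_mono:
  assumes "0 \<le> l" "l \<le> l'" "l' \<le> 1" "0 \<le> m" "m \<le> m'" "m' \<le> 1" "0 \<le> p" "p \<le> 1"
  shows "mean_lpp l m p c n \<le> mean_lpp l' m' p c n"
  unfolding mean_lpp_def
proof (rule bexp_mono_prob)
  fix S T :: "(nat \<times> nat) set" assume "S \<subseteq> T" "T \<subseteq> grid c n"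
  moreover have "finite T" by (rule finite_subset[OF \<open>T \<subseteq> grid c n\<close> finite_grid])
  ultimately show "real (lpp S c n) \<le> real (lpp T c n)"
    unfolding lpp_eq_cov using chain_empty by (intro of_nat_mono cov_mono) (auto intro!: exI[of _ "{}"])
qed (use assms in \<open>auto simp: is_prob_on_def prm_def\<close>)

text \<open>The parameters of the discretisation with \<open>K\<close> columns per length \<open>\<alpha>\<close> and \<open>K\<close> rows per time \<open>t\<close>.
  The value \<open>star_par\<close> is the source parameter for which the sinks and \<open>\<alpha>\<close>-points are stationary.\<close>

definition src_par :: "real \<Rightarrow> real \<Rightarrow> nat \<Rightarrow> real" where
  "src_par lam \<alpha> K = 1 - exp (- (lam * \<alpha> / real K))"

definition alp_par :: "real \<Rightarrow> real \<Rightarrow> nat \<Rightarrow> real" where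
  "alp_par \<alpha> t K = 1 - exp (- (\<alpha> * t / (real K)\<^sup>2))"

definition star_par :: "real \<Rightarrow> real \<Rightarrow> real \<Rightarrow> nat \<Rightarrow> real" where
  "star_par mu \<alpha> t K = alp_par \<alpha> t K / (alp_par \<alpha> t K + exp (mu * t / real K) - 1)"

definition mesh_mean :: "real \<Rightarrow> real \<Rightarrow> real \<Rightarrow> real \<Rightarrow> nat \<Rightarrow> nat \<Rightarrow> real" where
  "mesh_mean lam mu \<alpha> t k K = mean_lpp (src_par lam \<alpha> K) (src_par mu t K) (alp_par \<alpha> t K) k K"

definition mesh_discr :: "real \<Rightarrow> real \<Rightarrow> real \<Rightarrow> real \<Rightarrow> nat \<Rightarrow> nat \<Rightarrow> real" where
  "mesh_discr lam mu \<alpha> t k K = discr (src_par lam \<alpha> K) (src_par mu t K) (alp_par \<alpha> t K) k K"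

lemma src_par_bounds: "0 < lam \<Longrightarrow> 0 < \<alpha> \<Longrightarrow> 0 \<le> src_par lam \<alpha> K \<and> src_par lam \<alpha> K \<le> 1"
  by (auto simp: src_par_def)

lemma alp_par_bounds: "0 < \<alpha> \<Longrightarrow> 0 < t \<Longrightarrow> 0 \<le> alp_par \<alpha> t K \<and> alp_par \<alpha> t K \<le> 1"
  by (auto simp: alp_par_def)

lemma alp_par_le: "alp_par \<alpha> t K \<le> \<alpha> * t / (real K)\<^sup>2"
  unfolding alp_par_def using exp_ge_add_one_self[of "- (\<alpha> * t / (real K)\<^sup>2)"] by linarith

lemma alp_par_pos: "0 < \<alpha> \<Longrightarrow> 0 < t \<Longrightarrow> 0 < K \<Longrightarrow> 0 < alp_par \<alpha> t K"
  by (auto simp: alp_par_def)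

text \<open>The odds of a sink are \<open>exp (mu * t / K) - 1\<close>, and the relation says that
  the odds of source and sink have product \<open>p\<close>. Solving for the source gives the
  formula of \<open>star_par\<close>.\<close>

lemma star_par_burke:
  assumes "0 < mu" "0 < \<alpha>" "0 < t" "0 < K"
  shows "star_par mu \<alpha> t K * src_par mu t K = (1 - star_par mu \<alpha> t K) * (1 - src_par mu t K) * alp_par \<alpha> t K"
proof -
  define p E where "p = alp_par \<alpha> t K" "E = exp (mu * t / real K)"
  have "1 < E" "0 < p" using assms alp_par_pos by (auto simp: p_E_def)
  moreover have "src_par mu t K = 1 - 1 / E" by (simp add: src_par_def p_E_def exp_minus field_simps)
  ultimately show ?thesis
    unfolding star_par_def p_E_def[symmetric] by (simp add: field_simps)
qed

lemma src_par_lim: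
  assumes "0 < lam" "0 < \<alpha>"
  shows "(\<lambda>K. real K * src_par lam \<alpha> K) \<longlonglongrightarrow> lam * \<alpha>"
proof -
  define c where "c = lam * \<alpha>"
  have "0 < c" using assms by (simp add: c_def)
  then have "(\<lambda>K::nat. real K * (1 - exp (- (c / real K)))) \<longlonglongrightarrow> c" by real_asymp
  then show ?thesis by (simp add: src_par_def c_def)
qed

lemma alp_par_lim:
  assumes "0 < \<alpha>" "0 < t"
  shows "(\<lambda>K. (real K)\<^sup>2 * alp_par \<alpha> t K) \<longlonglongrightarrow> \<alpha> * t"
proof -
  define c where "c = \<alpha> * t"
  have "0 < c" using assms by (simp add: c_def)
  then have "(\<lambda>K::nat. (real K)\<^sup>2 * (1 - exp (- (c / (real K)\<^sup>2)))) \<longlonglongrightarrow> c" by real_asymp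
  then show ?thesis by (simp add: alp_par_def c_def)
qed

lemma exp_mesh_lim:
  assumes "0 < c"
  shows "(\<lambda>K::nat. real K * (exp (c / real K) - 1)) \<longlonglongrightarrow> c"
  using assms by real_asymp

text \<open>As \<open>p\<close> is of order \<open>1 / K\<^sup>2\<close>, its share in the
  denominator vanishes in the limit. What remains is the stationary source density
  \<open>1 / mu\<close> of the continuum.\<close>

lemma star_par_lim:
  assumes "0 < mu" "0 < \<alpha>" "0 < t"
  shows "(\<lambda>K. real K * star_par mu \<alpha> t K) \<longlonglongrightarrow> \<alpha> / mu"
proof -
  have "(\<lambda>K. (real K)\<^sup>2 * alp_par \<alpha> t K * inverse (real K)) \<longlonglongrightarrow> \<alpha> * t * 0"
    by (intro tendsto_mult alp_par_lim lim_inverse_n assms)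
  then have "(\<lambda>K. (real K)\<^sup>2 * alp_par \<alpha> t K / ((real K)\<^sup>2 * alp_par \<alpha> t K * inverse (real K)
      + real K * (exp (mu * t / real K) - 1))) \<longlonglongrightarrow> \<alpha> * t / (\<alpha> * t * 0 + mu * t)"
    using assms by (intro tendsto_divide tendsto_add alp_par_lim exp_mesh_lim) auto
  moreover have "\<forall>\<^sub>F K in sequentially. (real K)\<^sup>2 * alp_par \<alpha> t K / ((real K)\<^sup>2 * alp_par \<alpha> t K * inverse (real K)
      + real K * (exp (mu * t / real K) - 1)) = real K * star_par mu \<alpha> t K"
    using eventually_gt_at_top[of 0]
  proof eventually_elim
    case (elim K)
    have "(real K)\<^sup>2 * alp_par \<alpha> t K * inverse (real K) + real K * (exp (mu * t / real K) - 1)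
        = real K * (alp_par \<alpha> t K + exp (mu * t / real K) - 1)"
      using elim by (simp add: power2_eq_square field_simps)
    then show ?case using elim by (simp add: star_par_def power2_eq_square)
  qed
  ultimately have "(\<lambda>K. real K * star_par mu \<alpha> t K) \<longlonglongrightarrow> \<alpha> * t / (\<alpha> * t * 0 + mu * t)"
    by (rule Lim_transform_eventually)
  then show ?thesis using assms by simp
qed

section \<open>Asymptotics of the mean on a fine mesh\<close>

locale mesh =
  fixes lam mu \<alpha> t :: real
  assumes pos: "0 < lam" "0 < mu" "0 < \<alpha>" "0 < t" and lm: "lam * mu < 1"
begin

abbreviation "l \<equiv> src_par lam \<alpha>"
abbreviation "m \<equiv> src_par mu t"
abbreviation "p \<equiv> alp_par \<alpha> t"
abbreviation "l' \<equiv> star_par mu \<alpha> t"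
abbreviation "u \<equiv> mesh_mean lam mu \<alpha> t"

lemma lam_less: "lam < 1 / mu"
  using pos lm by (simp add: field_simps)

lemma par_bounds: "0 \<le> l K" "l K \<le> 1" "0 \<le> m K" "m K \<le> 1" "0 \<le> p K" "p K \<le> 1"
  using src_par_bounds[of lam \<alpha>] src_par_bounds[of mu t] alp_par_bounds[of \<alpha> t] pos by auto

lemma eventually_l_le: "\<forall>\<^sub>F K in sequentially. l K \<le> l' K"
proof -
  have "\<forall>\<^sub>F K in sequentially. real K * l K < (lam * \<alpha> + \<alpha> / mu) / 2"
    "\<forall>\<^sub>F K in sequentially. (lam * \<alpha> + \<alpha> / mu) / 2 < real K * l' K"
    using lam_less pos mult_strict_right_mono[OF lam_less pos(3)]
    by (intro order_tendstoD[OF src_par_lim] order_tendstoD[OF star_par_lim]; simp add: field_simps)+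
  then show ?thesis using eventually_gt_at_top[of 0]
  proof eventually_elim
    case (elim K)
    then have "real K * l K < real K * l' K" by linarith
    then show ?case using elim by simp
  qed
qed

text \<open>The stationary system with odds \<open>x = \<rho> * \<alpha> / K\<close> and
  \<open>y = p / x\<close> dominates the given sources and sinks for large \<open>K\<close>. The
  strict inequalities for \<rho> provide the room, because the discrete odds match the densities
  only in the limit.\<close>

lemma mean_upper:
  assumes "lam < \<rho>" "\<rho> < 1 / mu"
  shows "\<forall>\<^sub>F K in sequentially. \<forall>k. u k K \<le> \<rho> * (\<alpha> * real k / real K) + t / \<rho>"
proof -
  have \<rho>: "0 < \<rho>" using assms pos by linarith
  have "\<forall>\<^sub>F K::nat in sequentially. real K * (exp (lam * \<alpha> / real K) - 1) < \<rho> * \<alpha>"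
    using assms pos by (intro order_tendstoD[OF exp_mesh_lim]) auto
  \<comment> \<open>The midpoint separates \<open>mu * t\<close> and \<open>t / \<rho>\<close>, the
    limits of \<open>K\<close> times the odds of a sink and of \<open>K * y\<close>.\<close>
  moreover have "\<forall>\<^sub>F K::nat in sequentially. real K * (exp (mu * t / real K) - 1) < (mu * t + t / \<rho>) / 2"
  proof (intro order_tendstoD[OF exp_mesh_lim])
    have "mu < 1 / \<rho>" using assms \<rho> pos by (simp add: field_simps)
    then have "mu * t < 1 / \<rho> * t" using pos by (intro mult_strict_right_mono)
    then show "mu * t < (mu * t + t / \<rho>) / 2" by simp
  qed (use pos in auto)
  moreover have "\<forall>\<^sub>F K in sequentially. (mu * t + t / \<rho>) / 2 < (real K)\<^sup>2 * p K / (\<rho> * \<alpha>)"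
  proof -
    have "(\<lambda>K. (real K)\<^sup>2 * p K / (\<rho> * \<alpha>)) \<longlonglongrightarrow> \<alpha> * t / (\<rho> * \<alpha>)"
      using pos \<rho> by (intro tendsto_divide alp_par_lim tendsto_const) auto
    moreover have "(mu * t + t / \<rho>) / 2 < \<alpha> * t / (\<rho> * \<alpha>)"
    proof -
      have "mu < 1 / \<rho>" using assms \<rho> pos by (simp add: field_simps)
      then have "mu * t < 1 / \<rho> * t" using pos by (intro mult_strict_right_mono)
      then have lt: "mu * t < t / \<rho>" by simp
      have "\<alpha> * t / (\<rho> * \<alpha>) = t / \<rho>" using pos by simp
      moreover have "(a + b) / 2 < b" if "a < b" for a b :: real using that by simp
      ultimately show ?thesis using lt by (simp only:)
    qed
    ultimately show ?thesis by (rule order_tendstoD)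
  qed
  ultimately show ?thesis using eventually_gt_at_top[of 0]
  proof eventually_elim
    case (elim K)
    define x y where "x = \<rho> * \<alpha> / real K" "y = p K / x"
    have K: "0 < real K" using elim by simp
    have x: "0 < x" using \<rho> pos K by (simp add: x_y_def)
    have pK: "0 < p K" using alp_par_pos pos elim by simp
    have y: "0 < y" unfolding x_y_def(2) using pK x by (rule divide_pos_pos)
    have inv: "src_par a b K = odds_prob (exp (a * b / real K) - 1)" for a b
      by (simp add: src_par_def odds_prob_def exp_minus field_simps)
    have "exp (lam * \<alpha> / real K) - 1 \<le> x"
      using elim(1) K by (simp add: x_y_def field_simps)
    then have lx: "l K \<le> odds_prob x" unfolding inv using pos K by (intro odds_prob_mono) auto
    have "real K * (exp (mu * t / real K) - 1) < real K * y"
    proof -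
      have "real K * y = (real K)\<^sup>2 * p K / (\<rho> * \<alpha>)" by (simp add: x_y_def power2_eq_square)
      then show ?thesis using elim(2,3) by linarith
    qed
    then have "exp (mu * t / real K) - 1 \<le> y" using K by simp
    then have my: "m K \<le> odds_prob y" unfolding inv using pos K by (intro odds_prob_mono) auto
    have xy: "x * y = p K" using x by (simp add: x_y_def(2))
    show ?case
    proof
      fix k
      have "u k K \<le> mean_lpp (odds_prob x) (odds_prob y) (p K) k K"
        unfolding mesh_mean_def using par_bounds lx my x y odds_prob_bounds(3) by (intro mean_lpp_mono) auto
      also have "\<dots> = real k * odds_prob x + real K * odds_prob y"
        using odds_prob_burke[of x y] x y unfolding xy by (intro mean_lpp_stationary) auto
      also have "\<dots> \<le> real k * x + real K * y"
        using x y by (intro add_mono mult_left_mono odds_prob_bounds) auto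
      also have "real K * y \<le> t / \<rho>"
      proof -
        have "real K * y \<le> real K * ((\<alpha> * t / (real K)\<^sup>2) / x)"
          unfolding x_y_def(2) using x K by (intro mult_left_mono divide_right_mono alp_par_le) auto
        also have "\<dots> = t / \<rho>" using K pos \<rho> by (simp add: x_y_def power2_eq_square field_simps)
        finally show ?thesis .
      qed
      finally show "u k K \<le> \<rho> * (\<alpha> * real k / real K) + t / \<rho>"
        by (simp add: x_y_def mult_ac)
    qed
  qed
qed

lemma floor_mesh_lim: "0 < \<kappa> \<Longrightarrow> (\<lambda>K. real (nat \<lfloor>\<kappa> * real K\<rfloor>) / real K) \<longlonglongrightarrow> \<kappa>"
  by real_asymp

text \<open>The number of columns puts the corner near \<open>(t / \<rho>\<^sup>2, t)\<close>, where
  \<open>\<rho> * x + t / \<rho>\<close> equals \<open>2 * t / \<rho>\<close>. The bound comes from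
  dropping all sources and sinks.\<close>

lemma mean_lower_alpha:
  assumes "0 < \<delta>" "\<delta> \<le> 1" "0 < \<rho>" "(160 / \<delta>\<^sup>2)\<^sup>2 < t / \<rho>"
  shows "\<forall>\<^sub>F K in sequentially.
    (2 - 4 * \<delta>) * (t / \<rho>) \<le> u (nat \<lfloor>t / (\<rho>\<^sup>2 * \<alpha>) * real K\<rfloor>) K"
proof -
  define \<kappa> where "\<kappa> = t / (\<rho>\<^sup>2 * \<alpha>)"
  define k where "k K = nat \<lfloor>\<kappa> * real K\<rfloor>" for K :: nat
  \<comment> \<open>The square root of the mean number of occupied interior cells; its limit
    \<open>t / \<rho>\<close> is the root of the area of the rectangle.\<close>
  define s where "s K = sqrt (p K * real (k K) * real K)" for K
  have \<kappa>: "0 < \<kappa>" using assms pos by (simp add: \<kappa>_def)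
  have kl: "(\<lambda>K. real (k K) / real K) \<longlonglongrightarrow> \<kappa>" unfolding k_def by (rule floor_mesh_lim[OF \<kappa>])
  have s_lim: "s \<longlonglongrightarrow> t / \<rho>"
  proof -
    have 1: "(\<lambda>K. sqrt ((real K)\<^sup>2 * p K * (real (k K) / real K))) \<longlonglongrightarrow> sqrt (\<alpha> * t * \<kappa>)"
      by (intro tendsto_real_sqrt tendsto_mult alp_par_lim kl pos)
    have 2: "sqrt (\<alpha> * t * \<kappa>) = t / \<rho>"
      using assms pos by (intro real_sqrt_unique) (auto simp: \<kappa>_def power2_eq_square field_simps)
    have 3: "\<forall>\<^sub>F K in sequentially. sqrt ((real K)\<^sup>2 * p K * (real (k K) / real K)) = s K"
      using eventually_gt_at_top[of 0] by eventually_elim (simp add: s_def power2_eq_square field_simps)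
    show ?thesis using Lim_transform_eventually[OF 1 3] unfolding 2 .
  qed
  have p_lim: "p \<longlonglongrightarrow> 0"
  proof -
    have 1: "(\<lambda>K. (real K)\<^sup>2 * p K * (inverse (real K))\<^sup>2) \<longlonglongrightarrow> \<alpha> * t * 0\<^sup>2"
      by (intro tendsto_mult tendsto_power alp_par_lim lim_inverse_n pos)
    have 2: "\<forall>\<^sub>F K in sequentially. (real K)\<^sup>2 * p K * (inverse (real K))\<^sup>2 = p K"
      using eventually_gt_at_top[of 0] by eventually_elim (simp add: power2_eq_square field_simps)
    show ?thesis using Lim_transform_eventually[OF 1 2] by simp
  qed
  have y_lim: "(\<lambda>K. sqrt (p K * (real (k K) / real K))) \<longlonglongrightarrow> 0"
    using tendsto_real_sqrt[OF tendsto_mult[OF p_lim kl]] by simp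
  have x_lim: "(\<lambda>K. sqrt (p K / (real (k K) / real K))) \<longlonglongrightarrow> 0"
    using tendsto_real_sqrt[OF tendsto_divide[OF p_lim kl]] \<kappa> by simp
  have \<delta>64: "0 < \<delta>\<^sup>2 / 64" using assms by simp
  have "\<forall>\<^sub>F K in sequentially. (160 / \<delta>\<^sup>2)\<^sup>2 < s K"
    by (rule order_tendstoD(1)[OF s_lim assms(4)])
  moreover have "\<forall>\<^sub>F K in sequentially. (1 - \<delta> / 2) * (t / \<rho>) < s K"
    using assms pos by (intro order_tendstoD(1)[OF s_lim]) (simp add: field_simps)
  moreover have "\<forall>\<^sub>F K in sequentially. sqrt (p K * (real (k K) / real K)) < \<delta>\<^sup>2 / 64"
    "\<forall>\<^sub>F K in sequentially. sqrt (p K / (real (k K) / real K)) < \<delta>\<^sup>2 / 64"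
    by (rule order_tendstoD(2)[OF y_lim \<delta>64] order_tendstoD(2)[OF x_lim \<delta>64])+
  moreover have "\<forall>\<^sub>F K in sequentially. 0 < real (k K) / real K"
    by (rule order_tendstoD(1)[OF kl \<kappa>])
  ultimately show ?thesis using eventually_gt_at_top[of 0]
  proof eventually_elim
    case (elim K)
    \<comment> \<open>The solution of \<open>x * y = p\<close> and \<open>k * x = K * y\<close>, so
      that sources and sinks have the same total odds \<open>s\<close>.\<close>
    define x y where "x = sqrt (p K / (real (k K) / real K))" "y = sqrt (p K * (real (k K) / real K))"
    have K: "0 < real K" "0 < real (k K)" using elim(5,6) by (auto simp: zero_less_divide_iff)
    have pK: "0 < p K" using alp_par_pos pos elim by simp
    have x: "0 < x" "0 < y" using K pK by (auto simp: x_y_def)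
    have "(2 - 3 * \<delta>) * s K \<le> mean_lpp 0 0 (p K) (k K) K"
    proof (rule mean_alpha_lower)
      show "p K = x * y"
        using K pK by (simp add: x_y_def flip: real_sqrt_mult)
      show "real (k K) * x = s K"
        using K pK by (simp add: x_y_def s_def real_sqrt_mult real_sqrt_divide field_simps)
      show "real K * y = s K"
        using K pK by (simp add: x_y_def s_def real_sqrt_mult real_sqrt_divide field_simps)
    qed (use assms x elim par_bounds in \<open>auto simp: x_y_def\<close>)
    also have "\<dots> \<le> u (k K) K"
      unfolding mesh_mean_def using par_bounds by (intro mean_lpp_mono) auto
    finally have 1: "(2 - 3 * \<delta>) * s K \<le> u (k K) K" .
    have u0: "0 \<le> u (k K) K"
      unfolding mesh_mean_def mean_lpp_def using par_bounds by (intro bexp_nonneg is_prob_prm) auto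
    have T: "0 < t / \<rho>" using assms pos by simp
    have "(2 - 4 * \<delta>) * (t / \<rho>) \<le> u (k K) K"
    \<comment> \<open>For \<delta> close to one the factor is not positive, and
      \<open>u \<ge> 0\<close> is enough.\<close>
    proof (cases "2 - 3 * \<delta> \<le> 0")
      case True
      then have "(2 - 4 * \<delta>) * (t / \<rho>) \<le> 0" using T assms by (intro mult_nonpos_nonneg) auto
      then show ?thesis using u0 by linarith
    next
      case False
      have "(2 - 4 * \<delta>) \<le> (2 - 3 * \<delta>) * (1 - \<delta> / 2)" using assms by (simp add: algebra_simps)
      then have "(2 - 4 * \<delta>) * (t / \<rho>) \<le> (2 - 3 * \<delta>) * (1 - \<delta> / 2) * (t / \<rho>)"
        using T by (intro mult_right_mono) auto
      also have "\<dots> = (2 - 3 * \<delta>) * ((1 - \<delta> / 2) * (t / \<rho>))" by simp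
      also have "\<dots> \<le> (2 - 3 * \<delta>) * s K" using False elim(2) by (intro mult_left_mono) auto
      finally show ?thesis using 1 by simp
    qed
    then show ?case by (simp add: k_def \<kappa>_def)
  qed
qed

lemma mean_increment:
  assumes "0 < K" "l K \<le> l' K"
  shows "real d * (l K + (l' K - l K) * (1 - mesh_discr lam mu \<alpha> t (c + d) K)) \<le> u (c + d) K - u c K"
    and "u (c + d) K - u c K \<le> real d * (l K + (l' K - l K) * (1 - mesh_discr lam mu \<alpha> t c K))"
  using mean_lpp_increment[OF par_bounds star_par_burke[OF pos(2,3,4) assms(1)] assms(2)]
  by (simp_all add: mesh_mean_def mesh_discr_def)

lemma mean_increment_bounds:
  assumes "0 < K" "l K \<le> l' K"
  shows "real d * l K \<le> u (c + d) K - u c K" "u (c + d) K - u c K \<le> real d * l' K"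
proof -
  have D: "0 \<le> mesh_discr lam mu \<alpha> t i K" "mesh_discr lam mu \<alpha> t i K \<le> 1" for i
    unfolding mesh_discr_def using discr_bounds[OF par_bounds] by auto
  have "real d * l K \<le> real d * (l K + (l' K - l K) * (1 - mesh_discr lam mu \<alpha> t (c + d) K))"
    using D assms by (intro mult_left_mono) auto
  then show "real d * l K \<le> u (c + d) K - u c K" using mean_increment(1)[OF assms, of d c] by linarith
  have "(l' K - l K) * (1 - mesh_discr lam mu \<alpha> t c K) \<le> l' K - l K"
    using D assms by (intro mult_right_le_one_le) auto
  then have "real d * (l K + (l' K - l K) * (1 - mesh_discr lam mu \<alpha> t c K)) \<le> real d * l' K"
    by (intro mult_left_mono) auto
  then show "u (c + d) K - u c K \<le> real d * l' K" using mean_increment(2)[OF assms, of c d] by linarith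
qed

text \<open>The optimal \<open>\<rho>\<close> places the point \<open>(t / \<rho>\<^sup>2, t)\<close> on the characteristic of slope \<open>\<rho>\<^sup>2\<close>; from
  there the mean moves with derivative between \<open>lam\<close> and \<open>1 / mu\<close>.\<close>

lemma mean_lower:
  assumes "0 < \<delta>" "\<delta> \<le> 1" "0 < \<rho>" "(160 / \<delta>\<^sup>2)\<^sup>2 < t / \<rho>"
    and cases: "t / \<rho>\<^sup>2 \<le> real i * \<alpha> \<and> \<rho> = lam \<or> real i * \<alpha> \<le> t / \<rho>\<^sup>2 \<and> \<rho> = 1 / mu
      \<or> t / \<rho>\<^sup>2 = real i * \<alpha>"
  shows "\<forall>\<^sub>F K in sequentially. \<rho> * (real i * \<alpha>) + t / \<rho> - 5 * \<delta> * (t / \<rho>) \<le> u (i * K) K"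
proof -
  define \<kappa> where "\<kappa> = t / (\<rho>\<^sup>2 * \<alpha>)"
  define k where "k K = nat \<lfloor>\<kappa> * real K\<rfloor>" for K :: nat
  have \<kappa>: "0 < \<kappa>" using assms pos by (simp add: \<kappa>_def)
  have kl: "(\<lambda>K. real (k K) / real K) \<longlonglongrightarrow> \<kappa>" unfolding k_def by (rule floor_mesh_lim[OF \<kappa>])
  have T: "0 < t / \<rho>" using assms pos by simp
  have \<kappa>\<alpha>: "\<kappa> * \<alpha> = t / \<rho>\<^sup>2" using pos by (simp add: \<kappa>_def)
  have \<rho>t: "\<rho> * (t / \<rho>\<^sup>2) = t / \<rho>" using assms by (simp add: power2_eq_square)
  have "\<forall>\<^sub>F K in sequentially. (2 - 4 * \<delta>) * (t / \<rho>) \<le> u (k K) K"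
    using mean_lower_alpha[OF assms(1-4)] by (simp add: k_def \<kappa>_def)
  moreover have "\<forall>\<^sub>F K in sequentially. \<rho> * (real i * \<alpha> - t / \<rho>\<^sup>2) - \<delta> * (t / \<rho>) \<le> u (i * K) K - u (k K) K"
  \<comment> \<open>The hypothesis \<open>cases\<close> makes \<rho> the rate that is needed:
    \<open>lam\<close> if the characteristic point lies to the left of column \<open>i * K\<close>,
    \<open>1 / mu\<close> if it lies to the right, and any rate if they coincide.\<close>
  proof (cases "\<kappa> \<le> real i")
    case True
    have "\<kappa> * \<alpha> \<le> real i * \<alpha>" using True pos by (intro mult_right_mono) auto
    then have le: "\<rho> * (real i * \<alpha> - t / \<rho>\<^sup>2) \<le> lam * (real i * \<alpha> - t / \<rho>\<^sup>2)"
      using cases \<kappa>\<alpha> by auto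
    have "(\<lambda>K. (real i - real (k K) / real K) * (real K * l K)) \<longlonglongrightarrow> (real i - \<kappa>) * (lam * \<alpha>)"
      by (intro tendsto_mult tendsto_diff tendsto_const kl src_par_lim pos)
    moreover have "(real i - \<kappa>) * (lam * \<alpha>) = lam * (real i * \<alpha> - t / \<rho>\<^sup>2)"
      unfolding \<kappa>\<alpha>[symmetric] by (simp add: algebra_simps)
    moreover have "0 < \<delta> * (t / \<rho>)" using T assms(1) by (rule mult_pos_pos[rotated])
    then have "\<rho> * (real i * \<alpha> - t / \<rho>\<^sup>2) - \<delta> * (t / \<rho>) < lam * (real i * \<alpha> - t / \<rho>\<^sup>2)"
      using le by linarith
    ultimately have "\<forall>\<^sub>F K in sequentially. \<rho> * (real i * \<alpha> - t / \<rho>\<^sup>2) - \<delta> * (t / \<rho>)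
        < (real i - real (k K) / real K) * (real K * l K)"
      by (simp only: order_tendstoD(1))
    then show ?thesis using eventually_gt_at_top[of 0] eventually_l_le
    proof eventually_elim
      case (elim K)
      have "real (k K) \<le> \<kappa> * real K" using \<kappa> by (simp add: k_def)
      also have "\<dots> \<le> real i * real K" using True by (intro mult_right_mono) auto
      finally have "k K \<le> i * K" by (metis of_nat_le_iff of_nat_mult)
      then obtain d where d: "i * K = k K + d" using le_Suc_ex by blast
      then have "real i * real K = real (k K) + real d" by (metis of_nat_add of_nat_mult)
      then have "(real i - real (k K) / real K) * (real K * l K) = real d * l K"
        using elim(2) by (simp add: field_simps)
      then show ?case using elim(1) mean_increment_bounds(1)[OF elim(2,3), where d = d and c = "k K"] unfolding d by linarith
    qed
  next
    case False
    have "real i * \<alpha> < \<kappa> * \<alpha>" using False pos by (intro mult_strict_right_mono) auto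
    then have \<rho>: "\<rho> = 1 / mu" using cases \<kappa>\<alpha> by auto
    have "(\<lambda>K. (real (k K) / real K - real i) * (real K * l' K)) \<longlonglongrightarrow> (\<kappa> - real i) * (\<alpha> / mu)"
      by (intro tendsto_mult tendsto_diff tendsto_const kl star_par_lim pos)
    moreover have "(\<kappa> - real i) * (\<alpha> / mu) = \<rho> * (t / \<rho>\<^sup>2 - real i * \<alpha>)"
      unfolding \<kappa>\<alpha>[symmetric] by (simp add: \<rho> algebra_simps)
    moreover have "0 < \<delta> * (t / \<rho>)" using T assms(1) by (rule mult_pos_pos[rotated])
    then have "\<rho> * (t / \<rho>\<^sup>2 - real i * \<alpha>) < \<rho> * (t / \<rho>\<^sup>2 - real i * \<alpha>) + \<delta> * (t / \<rho>)"
      by linarith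
    ultimately have "\<forall>\<^sub>F K in sequentially. (real (k K) / real K - real i) * (real K * l' K)
        < \<rho> * (t / \<rho>\<^sup>2 - real i * \<alpha>) + \<delta> * (t / \<rho>)"
      by (simp only: order_tendstoD(2))
    moreover have "\<forall>\<^sub>F K in sequentially. real i < real (k K) / real K"
      using False by (intro order_tendstoD(1)[OF kl]) simp
    ultimately show ?thesis using eventually_gt_at_top[of 0] eventually_l_le
    proof eventually_elim
      case (elim K)
      have "real i * real K < real (k K)" using elim by (simp add: field_simps)
      then have "i * K \<le> k K" by (metis less_imp_le of_nat_less_iff of_nat_mult)
      then obtain d where d: "k K = i * K + d" using le_Suc_ex by blast
      then have "real (k K) = real i * real K + real d" by (metis of_nat_add of_nat_mult)
      then have "(real (k K) / real K - real i) * (real K * l' K) = real d * l' K"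
        using elim(3) by (simp add: field_simps)
      moreover have "\<rho> * (real i * \<alpha> - t / \<rho>\<^sup>2) = - (\<rho> * (t / \<rho>\<^sup>2 - real i * \<alpha>))" by (simp add: algebra_simps)
      ultimately show ?case using elim(1) mean_increment_bounds(2)[OF elim(3,4), where d = d and c = "i * K"] unfolding d by linarith
    qed
  qed
  ultimately show ?thesis
  proof eventually_elim
    case (elim K)
    have "\<rho> * (real i * \<alpha> - t / \<rho>\<^sup>2) = \<rho> * (real i * \<alpha>) - t / \<rho>"
      using \<rho>t by (simp add: right_diff_distrib)
    moreover have "(2 - 4 * \<delta>) * (t / \<rho>) = 2 * (t / \<rho>) - 4 * (\<delta> * (t / \<rho>))"
      "5 * \<delta> * (t / \<rho>) = 5 * (\<delta> * (t / \<rho>))" by (simp_all only: left_diff_distrib mult.assoc)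
    ultimately show ?case using elim by linarith
  qed
qed

text \<open>A block of \<open>K\<close> columns has width \<alpha>. The secant over the block that
  ends at the point in question bounds \<open>1 - discr\<close> there from above;
  \<open>discr_limit_lower\<close> uses the block that starts at the point.\<close>

lemma discr_limit_upper:
  assumes "(\<lambda>K. 1 - mesh_discr lam mu \<alpha> t (Suc b * K) K) \<longlonglongrightarrow> Q"
    and "\<forall>\<^sub>F K in sequentially. u (Suc b * K) K \<le> U1" "\<forall>\<^sub>F K in sequentially. U0 \<le> u (b * K) K"
  shows "lam * \<alpha> + (\<alpha> / mu - lam * \<alpha>) * Q \<le> U1 - U0"
proof (rule tendsto_upperbound)
  show "(\<lambda>K. real K * l K + (real K * l' K - real K * l K) * (1 - mesh_discr lam mu \<alpha> t (Suc b * K) K))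
      \<longlonglongrightarrow> lam * \<alpha> + (\<alpha> / mu - lam * \<alpha>) * Q"
    by (intro tendsto_add tendsto_mult tendsto_diff src_par_lim star_par_lim pos assms(1))
  show "\<forall>\<^sub>F K in sequentially. real K * l K + (real K * l' K - real K * l K)
      * (1 - mesh_discr lam mu \<alpha> t (Suc b * K) K) \<le> U1 - U0"
    using assms(2,3) eventually_gt_at_top[of 0] eventually_l_le
  proof eventually_elim
    case (elim K)
    have "b * K + K = Suc b * K" by simp
    then show ?case
      using mean_increment(1)[OF elim(3,4), of K "b * K"] elim(1,2) by (simp only:) (simp add: algebra_simps)
  qed
qed simp

lemma discr_limit_lower:
  assumes "(\<lambda>K. 1 - mesh_discr lam mu \<alpha> t (b * K) K) \<longlonglongrightarrow> Q"
    and "\<forall>\<^sub>F K in sequentially. U1 \<le> u (Suc b * K) K" "\<forall>\<^sub>F K in sequentially. u (b * K) K \<le> U0"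
  shows "U1 - U0 \<le> lam * \<alpha> + (\<alpha> / mu - lam * \<alpha>) * Q"
proof (rule tendsto_lowerbound)
  show "(\<lambda>K. real K * l K + (real K * l' K - real K * l K) * (1 - mesh_discr lam mu \<alpha> t (b * K) K))
      \<longlonglongrightarrow> lam * \<alpha> + (\<alpha> / mu - lam * \<alpha>) * Q"
    by (intro tendsto_add tendsto_mult tendsto_diff src_par_lim star_par_lim pos assms(1))
  show "\<forall>\<^sub>F K in sequentially. U1 - U0 \<le> real K * l K + (real K * l' K - real K * l K)
      * (1 - mesh_discr lam mu \<alpha> t (b * K) K)"
    using assms(2,3) eventually_gt_at_top[of 0] eventually_l_le
  proof eventually_elim
    case (elim K)
    have "b * K + K = Suc b * K" by simp
    then show ?case
      using mean_increment(2)[OF elim(3,4), of "b * K" K] elim(1,2) by (simp only:) (simp add: algebra_simps)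
  qed
qed simp

end

section \<open>From means to the limit of the probability\<close>

text \<open>\<open>Q x t\<close> stands for the probability that the second class particle is beyond
  \<open>x\<close> at time \<open>t\<close>. The locale separates the analysis from the probability
  space. The mesh limit is the same for every number \<open>b\<close> of blocks, which leaves
  \<open>b\<close> free to choose.\<close>

locale mesh_limit =
  fixes lam mu :: real and Q :: "real \<Rightarrow> real \<Rightarrow> real"
  assumes pos: "0 < lam" "0 < mu" and lm: "lam * mu < 1"
    and Q_lim: "\<And>x t b. 0 < x \<Longrightarrow> 0 < t \<Longrightarrow> 0 < b \<Longrightarrow>
      (\<lambda>K. 1 - mesh_discr lam mu (x / real b) t (b * K) K) \<longlonglongrightarrow> Q x t"
begin

lemma mesh: "0 < \<alpha> \<Longrightarrow> 0 < t \<Longrightarrow> mesh lam mu \<alpha> t"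
  using pos lm by (simp add: mesh_def)

lemma lam_less: "lam < 1 / mu"
  using pos lm by (simp add: field_simps)

text \<open>For \<open>v = sqrt (a / \<xi>)\<close> this is the minimiser of
  \<open>r * \<xi> + a / r\<close> over \<open>r\<close> between \<open>lam\<close> and
  \<open>1 / mu\<close>.\<close>

definition clamp_slope :: "real \<Rightarrow> real" where
  "clamp_slope v = max lam (min (1 / mu) v)"

lemma clamp_slope: "lam \<le> clamp_slope v" "clamp_slope v \<le> 1 / mu" "0 < clamp_slope v"
  using pos lam_less by (auto simp: clamp_slope_def)

lemma mean_lower_clamp:
  assumes "0 < a" "0 < i" "0 < b" "0 < \<epsilon>"
  defines "\<xi> \<equiv> real i / real b"
  defines "\<rho> \<equiv> clamp_slope (sqrt (a / \<xi>))"
  shows "\<forall>\<^sub>F x in at_top. \<forall>\<^sub>F K in sequentially.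
    (\<rho> * \<xi> + a / \<rho> - \<epsilon>) * x \<le> mesh_mean lam mu (x / real b) (a * x) (i * K) K"
proof -
  \<comment> \<open>Then the error \<open>5 * \<delta> * (t / \<rho>)\<close> of
    \<open>mean_lower\<close> is at most \<open>\<epsilon> * x\<close> for
    \<open>t = a * x\<close>.\<close>
  define \<delta> where "\<delta> = min 1 (\<epsilon> * \<rho> / (5 * a))"
  have \<rho>: "0 < \<rho>" using clamp_slope by (simp add: \<rho>_def)
  have \<xi>: "0 < \<xi>" using assms by (simp add: \<xi>_def)
  have \<delta>: "0 < \<delta>" "\<delta> \<le> 1" using assms \<rho> by (auto simp: \<delta>_def)
  have "\<delta> \<le> \<epsilon> * \<rho> / (5 * a)" by (simp add: \<delta>_def)
  then have \<delta>\<epsilon>: "5 * \<delta> * (a / \<rho>) \<le> \<epsilon>" using \<rho> assms(1) by (simp add: field_simps)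
  \<comment> \<open>The three alternatives of \<open>mean_lower\<close> at unit scale: the slope is
    clipped from below, clipped from above, or not clipped.\<close>
  have slope: "a / \<rho>\<^sup>2 \<le> \<xi> \<and> \<rho> = lam \<or> \<xi> \<le> a / \<rho>\<^sup>2 \<and> \<rho> = 1 / mu \<or> a / \<rho>\<^sup>2 = \<xi>"
  proof -
    define v where "v = sqrt (a / \<xi>)"
    have v: "0 < v" "v\<^sup>2 = a / \<xi>" using assms(1) \<xi> by (auto simp: v_def)
    have a: "a = \<xi> * v\<^sup>2" using v \<xi> by simp
    consider "v \<le> lam" "\<rho> = lam" | "1 / mu \<le> v" "\<rho> = 1 / mu" | "\<rho> = v"
      using lam_less by (force simp: \<rho>_def clamp_slope_def v_def[symmetric])
    then show ?thesis
    proof cases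
      case 1
      have "v\<^sup>2 \<le> lam\<^sup>2" using 1 v by (intro power_mono) auto
      then have "a \<le> \<xi> * \<rho>\<^sup>2" unfolding a using 1 \<xi> by (intro mult_left_mono) auto
      then have "a / \<rho>\<^sup>2 \<le> \<xi>" using \<rho> by (simp add: pos_divide_le_eq)
      then show ?thesis using 1 by blast
    next
      case 2
      have "(1 / mu)\<^sup>2 \<le> v\<^sup>2" using 2 pos by (intro power_mono) auto
      then have "\<xi> * \<rho>\<^sup>2 \<le> a" unfolding a using 2 \<xi> by (intro mult_left_mono) auto
      then have "\<xi> \<le> a / \<rho>\<^sup>2" using \<rho> by (simp add: pos_le_divide_eq)
      then show ?thesis using 2 by blast
    next
      case 3
      then show ?thesis using v a by simp
    qed
  qed
  have "\<forall>\<^sub>F x in at_top. (160 / \<delta>\<^sup>2)\<^sup>2 * \<rho> / a < x" by (rule eventually_gt_at_top)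
  then show ?thesis
    using eventually_gt_at_top[of 0]
  proof eventually_elim
    case (elim x)
    interpret mesh lam mu "x / real b" "a * x"
      using elim assms by (intro mesh) auto
    have big: "(160 / \<delta>\<^sup>2)\<^sup>2 < a * x / \<rho>"
    proof -
      have "(160 / \<delta>\<^sup>2)\<^sup>2 * \<rho> < x * a" using elim(1) assms(1) by (simp only: pos_divide_less_eq)
      then show ?thesis using \<rho> by (simp only: pos_less_divide_eq mult.commute)
    qed
    have X: "real i * (x / real b) = \<xi> * x" by (simp add: \<xi>_def)
    have "a * x / \<rho>\<^sup>2 \<le> real i * (x / real b) \<and> \<rho> = lam
      \<or> real i * (x / real b) \<le> a * x / \<rho>\<^sup>2 \<and> \<rho> = 1 / mu \<or> a * x / \<rho>\<^sup>2 = real i * (x / real b)"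
    proof -
      have eq: "a * x / \<rho>\<^sup>2 = a / \<rho>\<^sup>2 * x" by simp
      show ?thesis unfolding X eq using slope elim(2) mult_right_mono[of _ _ x] by (metis less_imp_le)
    qed
    from mean_lower[OF \<delta> \<rho> big this]
    show "\<forall>\<^sub>F K in sequentially. (\<rho> * \<xi> + a / \<rho> - \<epsilon>) * x \<le> mesh_mean lam mu (x / real b) (a * x) (i * K) K"
    proof eventually_elim
      case (elim K)
      have "5 * \<delta> * (a * x / \<rho>) = 5 * \<delta> * (a / \<rho>) * x" by simp
      also have "\<dots> \<le> \<epsilon> * x" using \<delta>\<epsilon> \<open>0 < x\<close> by (intro mult_right_mono) auto
      finally have "5 * \<delta> * (a * x / \<rho>) \<le> \<epsilon> * x" .
      moreover have "(\<rho> * \<xi> + a / \<rho> - \<epsilon>) * x = \<rho> * (\<xi> * x) + a * x / \<rho> - \<epsilon> * x"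
        by (simp add: algebra_simps)
      ultimately show ?case using elim unfolding X by linarith
    qed
  qed
qed

lemma mean_upper_ray:
  assumes "lam < \<rho>" "\<rho> < 1 / mu" "0 < x" "0 < t" "0 < b"
  shows "\<forall>\<^sub>F K in sequentially. mesh_mean lam mu (x / real b) t (b * K) K \<le> \<rho> * x + t / \<rho>"
proof -
  interpret mesh lam mu "x / real b" t
    using assms by (intro mesh) auto
  show ?thesis using mean_upper[OF assms(1,2)] eventually_gt_at_top[of 0]
  proof eventually_elim
    case (elim K)
    have "x / real b * real (b * K) / real K = x" using elim assms by simp
    then show ?case using elim(1) by metis
  qed
qed

text \<open>The upper bound for the mean requires a slope strictly inside the interval, whereas the
  clipped slope may be an end point; continuity bridges the difference.\<close>

lemma interior_slope:
  assumes "0 < a" "lam \<le> \<rho>" "\<rho> \<le> 1 / mu" "0 < \<epsilon>"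
  obtains \<rho>' where "lam < \<rho>'" "\<rho>' < 1 / mu" "\<rho>' + a / \<rho>' < \<rho> + a / \<rho> + \<epsilon>"
proof -
  have "isCont (\<lambda>r. r + a / r) \<rho>" using assms pos by (intro continuous_intros) auto
  then obtain d where d: "0 < d" "\<And>r. dist r \<rho> < d \<Longrightarrow> dist (r + a / r) (\<rho> + a / \<rho>) < \<epsilon>"
    using assms(4) unfolding continuous_at_eps_delta by metis
  have "\<rho> \<in> closure {lam<..<1 / mu}" using assms lam_less by (simp add: closure_greaterThanLessThan)
  then obtain r where "r \<in> {lam<..<1 / mu}" "dist r \<rho> < d"
    using d(1) unfolding closure_approachable by metis
  then show ?thesis using d(2)[of r] that[of r] by (auto simp: dist_real_def)
qed

text \<open>The secant from \<open>b / (b + 1) * x\<close> to \<open>x\<close>. The slope \<rho> is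
  optimal at the left end and, slightly perturbed, gives an upper bound at the right end, so the
  difference is \<rho> times the block width up to errors. Dividing by the width
  \<open>x / (b + 1)\<close> multiplies the errors by \<open>b + 1\<close>.\<close>

lemma Q_upper:
  assumes "0 < a" "0 < b" "0 < \<epsilon>"
  defines "\<rho> \<equiv> clamp_slope (sqrt (a / (real b / real (Suc b))))"
  shows "\<forall>\<^sub>F x in at_top. lam + (1 / mu - lam) * Q x (a * x) \<le> \<rho> + 2 * real (Suc b) * \<epsilon>"
proof -
  obtain \<rho>' where \<rho>': "lam < \<rho>'" "\<rho>' < 1 / mu" "\<rho>' + a / \<rho>' < \<rho> + a / \<rho> + \<epsilon>"
    using interior_slope[OF assms(1) _ _ assms(3), of \<rho>] clamp_slope by (metis \<rho>_def)
  have "\<forall>\<^sub>F x in at_top. \<forall>\<^sub>F K in sequentially. (\<rho> * (real b / real (Suc b)) + a / \<rho> - \<epsilon>) * x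
      \<le> mesh_mean lam mu (x / real (Suc b)) (a * x) (b * K) K"
    using mean_lower_clamp[OF assms(1,2) zero_less_Suc assms(3)] by (simp add: \<rho>_def)
  then show ?thesis using eventually_gt_at_top[of 0]
  proof eventually_elim
    case (elim x)
    define \<alpha> where "\<alpha> = x / real (Suc b)"
    have \<alpha>: "0 < \<alpha>" "x = real (Suc b) * \<alpha>" using elim by (auto simp: \<alpha>_def)
    have t: "0 < a * x" using elim assms by simp
    interpret mesh lam mu \<alpha> "a * x" using \<alpha> t by (intro mesh) auto
    have "\<forall>\<^sub>F K in sequentially. mesh_mean lam mu \<alpha> (a * x) (Suc b * K) K \<le> \<rho>' * x + (a * x) / \<rho>'"
      using mean_upper_ray[OF \<rho>'(1,2) elim(2) t zero_less_Suc] by (simp only: \<alpha>_def)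
    with Q_lim[OF elim(2) t zero_less_Suc[of b]] elim(1)
    have "lam * \<alpha> + (\<alpha> / mu - lam * \<alpha>) * Q x (a * x)
        \<le> (\<rho>' * x + (a * x) / \<rho>') - (\<rho> * (real b / real (Suc b)) + a / \<rho> - \<epsilon>) * x"
      unfolding \<alpha>_def[symmetric] by (intro discr_limit_upper)
    moreover have "(\<rho>' * x + (a * x) / \<rho>') - (\<rho> * (real b / real (Suc b)) + a / \<rho> - \<epsilon>) * x
        = ((\<rho>' + a / \<rho>') - (\<rho> + a / \<rho>) + \<epsilon>) * x + \<rho> * \<alpha>"
    proof -
      have "real b / real (Suc b) * x = x - \<alpha>" unfolding \<alpha>_def by (simp add: field_simps)
      then have "\<rho> * (real b / real (Suc b)) * x = \<rho> * (x - \<alpha>)" by (simp only: mult.assoc)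
      then have "(\<rho> * (real b / real (Suc b)) + a / \<rho> - \<epsilon>) * x = \<rho> * (x - \<alpha>) + a / \<rho> * x - \<epsilon> * x"
        by (simp only: distrib_right left_diff_distrib)
      then show ?thesis by (simp add: algebra_simps)
    qed
    moreover have "((\<rho>' + a / \<rho>') - (\<rho> + a / \<rho>) + \<epsilon>) * x \<le> (2 * \<epsilon>) * x"
      using \<rho>'(3) elim(2) by (intro mult_right_mono) auto
    moreover have "(2 * \<epsilon>) * x = 2 * \<epsilon> * (real (Suc b) * \<alpha>)" by (simp only: \<alpha>(2)[symmetric])
    ultimately have "lam * \<alpha> + (\<alpha> / mu - lam * \<alpha>) * Q x (a * x) \<le> 2 * \<epsilon> * (real (Suc b) * \<alpha>) + \<rho> * \<alpha>"
      by linarith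
    then have "(lam + (1 / mu - lam) * Q x (a * x)) * \<alpha> \<le> (\<rho> + 2 * real (Suc b) * \<epsilon>) * \<alpha>"
      by (simp add: algebra_simps)
    then show ?case using \<alpha>(1) by simp
  qed
qed

text \<open>The mirror image: the secant runs from \<open>x\<close> to
  \<open>(b + 1) / b * x\<close>, and \<rho> is optimal at the right end.\<close>

lemma Q_lower:
  assumes "0 < a" "0 < b" "0 < \<epsilon>"
  defines "\<rho> \<equiv> clamp_slope (sqrt (a / (real (Suc b) / real b)))"
  shows "\<forall>\<^sub>F x in at_top. \<rho> - 2 * real b * \<epsilon> \<le> lam + (1 / mu - lam) * Q x (a * x)"
proof -
  obtain \<rho>' where \<rho>': "lam < \<rho>'" "\<rho>' < 1 / mu" "\<rho>' + a / \<rho>' < \<rho> + a / \<rho> + \<epsilon>"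
    using interior_slope[OF assms(1) _ _ assms(3), of \<rho>] clamp_slope by (metis \<rho>_def)
  have "\<forall>\<^sub>F x in at_top. \<forall>\<^sub>F K in sequentially. (\<rho> * (real (Suc b) / real b) + a / \<rho> - \<epsilon>) * x
      \<le> mesh_mean lam mu (x / real b) (a * x) (Suc b * K) K"
    using mean_lower_clamp[OF assms(1) zero_less_Suc assms(2,3), of b] by (simp add: \<rho>_def)
  then show ?thesis using eventually_gt_at_top[of 0]
  proof eventually_elim
    case (elim x)
    define \<alpha> where "\<alpha> = x / real b"
    have \<alpha>: "0 < \<alpha>" "x = real b * \<alpha>" using elim assms(2) by (auto simp: \<alpha>_def)
    have t: "0 < a * x" using elim assms by simp
    interpret mesh lam mu \<alpha> "a * x" using \<alpha> t by (intro mesh) auto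
    have "\<forall>\<^sub>F K in sequentially. mesh_mean lam mu \<alpha> (a * x) (b * K) K \<le> \<rho>' * x + (a * x) / \<rho>'"
      using mean_upper_ray[OF \<rho>'(1,2) elim(2) t assms(2)] by (simp only: \<alpha>_def)
    with Q_lim[OF elim(2) t assms(2)] elim(1)
    have "(\<rho> * (real (Suc b) / real b) + a / \<rho> - \<epsilon>) * x - (\<rho>' * x + (a * x) / \<rho>')
        \<le> lam * \<alpha> + (\<alpha> / mu - lam * \<alpha>) * Q x (a * x)"
      unfolding \<alpha>_def[symmetric] by (intro discr_limit_lower)
    moreover have "(\<rho> * (real (Suc b) / real b) + a / \<rho> - \<epsilon>) * x - (\<rho>' * x + (a * x) / \<rho>')
        = \<rho> * \<alpha> - ((\<rho>' + a / \<rho>') - (\<rho> + a / \<rho>) + \<epsilon>) * x"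
    proof -
      have "real (Suc b) / real b * x = x + \<alpha>" unfolding \<alpha>_def using assms(2) by (simp add: field_simps)
      then have "\<rho> * (real (Suc b) / real b) * x = \<rho> * (x + \<alpha>)" by (simp only: mult.assoc)
      then have "(\<rho> * (real (Suc b) / real b) + a / \<rho> - \<epsilon>) * x = \<rho> * (x + \<alpha>) + a / \<rho> * x - \<epsilon> * x"
        by (simp only: distrib_right left_diff_distrib)
      then show ?thesis by (simp add: algebra_simps)
    qed
    moreover have "((\<rho>' + a / \<rho>') - (\<rho> + a / \<rho>) + \<epsilon>) * x \<le> (2 * \<epsilon>) * x"
      using \<rho>'(3) elim(2) by (intro mult_right_mono) auto
    moreover have "(2 * \<epsilon>) * x = 2 * \<epsilon> * (real b * \<alpha>)" by (simp only: \<alpha>(2)[symmetric])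
    ultimately have "\<rho> * \<alpha> - 2 * \<epsilon> * (real b * \<alpha>) \<le> lam * \<alpha> + (\<alpha> / mu - lam * \<alpha>) * Q x (a * x)"
      by linarith
    then have "(\<rho> - 2 * real b * \<epsilon>) * \<alpha> \<le> (lam + (1 / mu - lam) * Q x (a * x)) * \<alpha>"
      by (simp add: algebra_simps)
    then show ?case using \<alpha>(1) by simp
  qed
qed

lemma Q_limit:
  assumes "0 < a"
  shows "((\<lambda>x. Q x (a * x)) \<longlongrightarrow> (clamp_slope (sqrt a) - lam) / (1 / mu - lam)) at_top"
proof -
  define c where "c = clamp_slope (sqrt a)"
  have "((\<lambda>x. lam + (1 / mu - lam) * Q x (a * x)) \<longlongrightarrow> c) at_top"
  proof (rule tendstoI)
    fix \<eta> :: real assume \<eta>: "0 < \<eta>"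
    have clamp: "(\<lambda>b. clamp_slope (sqrt (f b))) \<longlonglongrightarrow> c" if "f \<longlonglongrightarrow> a" for f :: "nat \<Rightarrow> real"
      unfolding c_def clamp_slope_def by (intro tendsto_max tendsto_min tendsto_const tendsto_real_sqrt that)
    have lims: "(\<lambda>b. a / (real b / real (Suc b))) \<longlonglongrightarrow> a" "(\<lambda>b. a / (real (Suc b) / real b)) \<longlonglongrightarrow> a"
      using assms by real_asymp+
    have "(\<lambda>b. clamp_slope (sqrt (a / (real b / real (Suc b))))) \<longlonglongrightarrow> c"
      "(\<lambda>b. clamp_slope (sqrt (a / (real (Suc b) / real b)))) \<longlonglongrightarrow> c"
      by (rule clamp[OF lims(1)] clamp[OF lims(2)])+
    then have "\<forall>\<^sub>F b in sequentially. clamp_slope (sqrt (a / (real b / real (Suc b)))) < c + \<eta> / 2"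
      "\<forall>\<^sub>F b in sequentially. c - \<eta> / 2 < clamp_slope (sqrt (a / (real (Suc b) / real b)))"
      using \<eta> by (intro order_tendstoD(2)[of _ c] order_tendstoD(1)[of _ c]; simp)+
    then have "\<forall>\<^sub>F b in sequentially. 0 < b \<and> clamp_slope (sqrt (a / (real b / real (Suc b)))) < c + \<eta> / 2
      \<and> c - \<eta> / 2 < clamp_slope (sqrt (a / (real (Suc b) / real b)))"
      using eventually_gt_at_top[of 0] by eventually_elim simp
    then obtain b where b: "0 < b" "clamp_slope (sqrt (a / (real b / real (Suc b)))) < c + \<eta> / 2"
      "c - \<eta> / 2 < clamp_slope (sqrt (a / (real (Suc b) / real b)))"
      using eventually_happens'[OF sequentially_bot] by blast
    \<comment> \<open>The number of blocks is fixed before \<epsilon>, because it multiplies the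
      errors in \<open>Q_upper\<close> and \<open>Q_lower\<close>.\<close>
    define \<epsilon> where "\<epsilon> = \<eta> / (4 * real (Suc b))"
    have \<epsilon>: "0 < \<epsilon>" "2 * real (Suc b) * \<epsilon> = \<eta> / 2" using \<eta> by (auto simp: \<epsilon>_def field_simps)
    have "2 * real b * \<epsilon> \<le> 2 * real (Suc b) * \<epsilon>" using \<epsilon>(1) by (intro mult_right_mono) auto
    then have \<epsilon>': "2 * real b * \<epsilon> \<le> \<eta> / 2" using \<epsilon>(2) by simp
    show "\<forall>\<^sub>F x in at_top. dist (lam + (1 / mu - lam) * Q x (a * x)) c < \<eta>"
      using Q_upper[OF assms b(1) \<epsilon>(1)] Q_lower[OF assms b(1) \<epsilon>(1)]
    proof eventually_elim
      case (elim x)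
      then show ?case using b(2,3) \<epsilon>(2) \<epsilon>' unfolding dist_real_def by linarith
    qed
  qed
  then have "((\<lambda>x. ((lam + (1 / mu - lam) * Q x (a * x)) - lam) / (1 / mu - lam)) \<longlongrightarrow> (c - lam) / (1 / mu - lam)) at_top"
    using lam_less by (intro tendsto_divide tendsto_diff tendsto_const) auto
  moreover have "((lam + (1 / mu - lam) * q) - lam) / (1 / mu - lam) = q" for q
    using lam_less by simp
  ultimately show ?thesis by (simp only: c_def)
qed

text \<open>At a fixed time the particle is not at infinity, which later shows that it has a
  position almost surely. The mean at \<open>x\<close> is at most
  \<open>\<rho> * x + t / \<rho>\<close> with \<rho> close to \<open>lam\<close>, whereas by
  monotonicity it is at least \<open>(lam + g * Q) * x\<close>.\<close>

lemma Q_escape: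
  assumes "0 < t" "0 < \<epsilon>"
  shows "\<forall>\<^sub>F x in at_top. Q x t \<le> \<epsilon>"
proof -
  define g where "g = 1 / mu - lam"
  \<comment> \<open>The excess over \<open>lam\<close> uses half of the allowed
    \<open>g * \<epsilon>\<close>, and the other half absorbs \<open>t / \<rho>\<close> for large
    \<open>x\<close>. The bound \<open>g / 2\<close> keeps \<rho> below
    \<open>1 / mu\<close>.\<close>
  define \<rho> where "\<rho> = lam + min (g / 2) (g * \<epsilon> / 2)"
  have g: "0 < g" using lam_less by (simp add: g_def)
  have "0 < min (g / 2) (g * \<epsilon> / 2)" using g assms by simp
  then have \<rho>: "lam < \<rho>" "\<rho> < 1 / mu" "\<rho> \<le> lam + g * \<epsilon> / 2" "0 < \<rho>"
  proof -
    have "\<rho> \<le> lam + g / 2" "\<rho> \<le> lam + g * \<epsilon> / 2" by (simp_all add: \<rho>_def)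
    moreover have "lam + g = 1 / mu" by (simp add: g_def)
    moreover have "lam < \<rho>" using \<open>0 < min (g / 2) (g * \<epsilon> / 2)\<close> unfolding \<rho>_def by linarith
    ultimately show "lam < \<rho>" "\<rho> < 1 / mu" "\<rho> \<le> lam + g * \<epsilon> / 2" "0 < \<rho>" using g pos by linarith+
  qed
  have "\<forall>\<^sub>F x in at_top. 2 * t / (\<rho> * g * \<epsilon>) < x" by (rule eventually_gt_at_top)
  then show ?thesis using eventually_gt_at_top[of 0]
  proof eventually_elim
    case (elim x)
    interpret mesh lam mu x t using elim assms by (intro mesh) auto
    have "lam * x + (x / mu - lam * x) * Q x t \<le> (\<rho> * x + t / \<rho>) - 0"
    proof (rule discr_limit_upper)
      show "(\<lambda>K. 1 - mesh_discr lam mu x t (Suc 0 * K) K) \<longlonglongrightarrow> Q x t"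
        using Q_lim[OF elim(2) assms(1), of 1] by simp
      show "\<forall>\<^sub>F K in sequentially. mesh_mean lam mu x t (Suc 0 * K) K \<le> \<rho> * x + t / \<rho>"
        using mean_upper_ray[OF \<rho>(1,2) elim(2) assms(1), of 1] by simp
      show "\<forall>\<^sub>F K in sequentially. 0 \<le> mesh_mean lam mu x t (0 * K) K"
        using par_bounds by (simp add: mesh_mean_def mean_lpp_0)
    qed
    moreover have "\<rho> * x \<le> (lam + g * \<epsilon> / 2) * x" using \<rho> elim by (intro mult_right_mono) auto
    moreover have "t / \<rho> \<le> g * \<epsilon> / 2 * x" using elim(1) \<rho> g assms(2) by (simp add: field_simps)
    moreover have "(x / mu - lam * x) * Q x t = Q x t * (g * x)" by (simp add: g_def algebra_simps)
    moreover have "(lam + g * \<epsilon> / 2) * x = lam * x + g * \<epsilon> / 2 * x" by (simp add: distrib_right)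
    moreover have "g * \<epsilon> / 2 * x + g * \<epsilon> / 2 * x = \<epsilon> * (g * x)" by (simp add: field_simps)
    moreover have "B \<le> E" if "L + A \<le> (R + T) - 0" "R \<le> M" "T \<le> G" "A = B" "M = L + G" "G + G = E"
      for A B E G L M R T :: real using that by linarith
    ultimately have "Q x t * (g * x) \<le> \<epsilon> * (g * x)" by blast
    then show ?case using g elim by simp
  qed
qed

end

section \<open>Dynamics of the particles\<close>

lemma leftmost_subset: "leftmost D \<subseteq> D"
  by (auto simp: leftmost_def)

lemma leftmost_cases: "leftmost D = {} \<or> (\<exists>m\<in>D. leftmost D = {m} \<and> (\<forall>z\<in>D. m \<le> z))"
proof (cases "leftmost D = {}")
  case False
  then obtain m where m: "m \<in> D" "\<forall>z\<in>D. m \<le> z" by (auto simp: leftmost_def)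
  then have "leftmost D = {m}" by (auto simp: leftmost_def intro: antisym)
  then show ?thesis using m by blast
qed simp

lemma leftmost_insert: "leftmost (insert x C) = (if \<forall>z\<in>C. x \<le> z then {x} else leftmost C)"
  by (auto simp: leftmost_def intro: antisym)

lemma leftmost_restrict: "leftmost (C \<inter> {..r}) = leftmost C \<inter> {..r}"
  by (auto simp: leftmost_def)

text \<open>Equality is allowed because the extra particle may lie beyond the restriction or have
  been removed from it, and because an \<alpha>-point may fall exactly on it.\<close>

definition extends_by_one :: "real set \<Rightarrow> real set \<Rightarrow> bool" where
  "extends_by_one C D \<longleftrightarrow> D = C \<or> (\<exists>x. x \<notin> C \<and> D = insert x C)"

lemma extends_by_oneI: "x \<notin> C \<and> D = insert x C \<Longrightarrow> extends_by_one C D"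
  by (auto simp: extends_by_one_def)

lemma extends_by_oneD: "extends_by_one C D \<Longrightarrow> x \<in> D \<Longrightarrow> x \<notin> C \<Longrightarrow> D = insert x C"
  by (auto simp: extends_by_one_def)

lemma extends_by_one_refl [simp]: "extends_by_one C C"
  by (simp add: extends_by_one_def)

text \<open>If the event removes the extra particle \<open>x\<close> from \<open>D\<close>, then the
  particle \<open>m\<close> that it removes from \<open>C\<close> instead becomes the extra one:
  this is the jump of the second class particle. If the event removes the same particle from both,
  \<open>x\<close> stays extra unless an \<alpha>-point falls on it.\<close>

lemma extends_by_one_event:
  assumes "extends_by_one C D"
  shows "extends_by_one (apply_event e C) (apply_event e D)"
proof (cases "D = C")
  case False
  then obtain x where x: "x \<notin> C" "D = insert x C" using assms by (auto simp: extends_by_one_def)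
  show ?thesis
  proof (cases e)
    case Sink
    show ?thesis
    proof (cases "\<forall>z\<in>C. x \<le> z")
      case True
      then have D': "apply_event e D = C" using x by (simp add: Sink leftmost_insert)
      from leftmost_cases[of C] show ?thesis
      proof
        assume "leftmost C = {}"
        then show ?thesis unfolding D' by (simp add: Sink extends_by_one_def)
      next
        assume "\<exists>m\<in>C. leftmost C = {m} \<and> (\<forall>z\<in>C. m \<le> z)"
        then obtain m where m: "m \<in> C" "leftmost C = {m}" by blast
        then have C': "apply_event e C = C - {m}" by (simp add: Sink)
        have "m \<notin> C - {m} \<and> C = insert m (C - {m})" using m(1) by blast
        then show ?thesis unfolding D' C' by (rule extends_by_oneI)
      qed
    next
      case False
      then have "leftmost D = leftmost C" unfolding x leftmost_insert by (rule if_not_P)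
      then have *: "apply_event e C = C - leftmost C" "apply_event e D = insert x C - leftmost C"
        by (simp_all add: Sink x)
      have "x \<notin> C - leftmost C \<and> insert x C - leftmost C = insert x (C - leftmost C)"
        using x leftmost_subset[of C] by blast
      then show ?thesis unfolding * by (rule extends_by_oneI)
    qed
  next
    case (Alpha_Point u)
    define Cu where "Cu = {y \<in> C. u < y}"
    have C': "apply_event e C = insert u (C - leftmost Cu)" by (simp add: Alpha_Point Cu_def)
    have sub: "leftmost Cu \<subseteq> C" "\<And>y. y \<in> leftmost Cu \<Longrightarrow> u < y" using leftmost_subset[of Cu] by (auto simp: Cu_def)
    have D': "apply_event e D = insert u (insert x C - leftmost {y \<in> insert x C. u < y})"
      by (simp add: Alpha_Point x)
    show ?thesis
    proof (cases "x \<le> u")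
      case True
      then have "{y \<in> insert x C. u < y} = Cu" by (auto simp: Cu_def)
      then have 1: "apply_event e D = insert x (apply_event e C)"
        unfolding D' C' using sub(1) x by blast
      have 2: "x \<notin> C - leftmost Cu" using x by blast
      show ?thesis
      proof (cases "x = u")
        case True
        then have "apply_event e D = apply_event e C" unfolding 1 by (simp add: C')
        then show ?thesis by (simp add: extends_by_one_def)
      next
        case False
        then have "x \<notin> apply_event e C" using 2 by (simp add: C')
        then show ?thesis using 1 by (intro extends_by_oneI[of x]) blast
      qed
    next
      case False
      then have Du: "{y \<in> insert x C. u < y} = insert x Cu" by (auto simp: Cu_def)
      show ?thesis
      proof (cases "\<forall>z\<in>Cu. x \<le> z")
        case True
        then have D'': "apply_event e D = insert u C"
          unfolding D' Du using x by (simp add: leftmost_insert)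
        from leftmost_cases[of Cu] show ?thesis
        proof
          assume "leftmost Cu = {}"
          then show ?thesis unfolding D'' C' by (simp add: extends_by_one_def)
        next
          assume "\<exists>m\<in>Cu. leftmost Cu = {m} \<and> (\<forall>z\<in>Cu. m \<le> z)"
          then obtain m where m: "m \<in> Cu" "leftmost Cu = {m}" by blast
          then have "m \<noteq> u" "m \<in> C" by (auto simp: Cu_def)
          then have "m \<notin> insert u (C - {m}) \<and> insert u C = insert m (insert u (C - {m}))" by blast
          then show ?thesis unfolding D'' C' m(2) by (rule extends_by_oneI)
        qed
      next
        case nl: False
        then have "leftmost (insert x Cu) = leftmost Cu" unfolding leftmost_insert by (rule if_not_P)
        then have D'': "apply_event e D = insert u (insert x C - leftmost Cu)" unfolding D' Du by simp
        have "x \<notin> insert u (C - leftmost Cu) \<and>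
            insert u (insert x C - leftmost Cu) = insert x (insert u (C - leftmost Cu))"
          using x sub(1) False by blast
        then show ?thesis unfolding D'' C' by (rule extends_by_oneI)
      qed
    qed
  qed
qed (simp add: extends_by_one_def)

lemma extends_by_one_fold:
  "extends_by_one C D \<Longrightarrow> extends_by_one (fold apply_event es C) (fold apply_event es D)"
  by (induction es arbitrary: C D) (auto intro: extends_by_one_event)

lemma extends_by_one_hammersley:
  "extends_by_one (hammersley_restricted src snk alp R t) (hammersley_restricted (insert x src) snk alp R t)"
  unfolding hammersley_restricted_def
proof (rule extends_by_one_fold)
  show "extends_by_one (src \<inter> {..R}) (insert x src \<inter> {..R})"
    by (cases "x \<le> R"; cases "x \<in> src") (auto simp: extends_by_one_def insert_absorb)
qed

definition relevant :: "real \<Rightarrow> event \<Rightarrow> bool" where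
  "relevant r e = (case e of Sink \<Rightarrow> True | Alpha_Point u \<Rightarrow> u \<le> r)"

text \<open>Taking the leftmost particle commutes with the restriction to positions up to
  \<open>r\<close>, and an \<alpha>-point beyond \<open>r\<close> changes nothing up to
  \<open>r\<close>.\<close>

lemma apply_event_restrict:
  "apply_event e C \<inter> {..r} = (if relevant r e then apply_event e (C \<inter> {..r}) else C \<inter> {..r})"
proof (cases e)
  case Sink
  then show ?thesis by (auto simp: relevant_def leftmost_restrict)
next
  case (Alpha_Point u)
  have eq: "{y \<in> C \<inter> {..r}. u < y} = {y \<in> C. u < y} \<inter> {..r}" by auto
  have "leftmost {y \<in> C. u < y} \<subseteq> {u<..}" using leftmost_subset by fastforce
  then show ?thesis
    unfolding Alpha_Point apply_event.simps eq leftmost_restrict by (auto simp: relevant_def)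
qed

lemma fold_apply_event_restrict:
  "fold apply_event es C \<inter> {..r} = fold apply_event (filter (relevant r) es) (C \<inter> {..r})"
  by (induction es arbitrary: C) (auto simp: apply_event_restrict)

lemma sorted_list_of_set_eqI: "sorted xs \<Longrightarrow> distinct xs \<Longrightarrow> set xs = A \<Longrightarrow> sorted_list_of_set A = xs"
  by (metis sorted_list_of_set.idem_if_sorted_distinct)

lemma sorted_list_of_set_Collect:
  "finite A \<Longrightarrow> sorted_list_of_set {x \<in> A. P x} = filter P (sorted_list_of_set A)"
  by (rule sorted_list_of_set_eqI) (auto intro: sorted_wrt_filter)

lemma concat_map_filter:
  "(\<And>x. x \<in> set xs \<Longrightarrow> \<not> P x \<Longrightarrow> f x = []) \<Longrightarrow> concat (map f (filter P xs)) = concat (map f xs)"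
  by (induction xs) auto

definition event_times :: "real set \<Rightarrow> (real \<times> real) set \<Rightarrow> real \<Rightarrow> real \<Rightarrow> real set" where
  "event_times snk alp R t = {s. s \<le> t \<and> (s \<in> snk \<or> (\<exists>u\<le>R. (u, s) \<in> alp))}"

definition events_at :: "real set \<Rightarrow> (real \<times> real) set \<Rightarrow> real \<Rightarrow> real \<Rightarrow> event list" where
  "events_at snk alp R s = (if s \<in> snk then [Sink] else []) @
     map Alpha_Point (sorted_list_of_set {u. u \<le> R \<and> (u, s) \<in> alp})"

lemma event_list_alt:
  "event_list snk alp R t = concat (map (events_at snk alp R) (sorted_list_of_set (event_times snk alp R t)))"
  by (simp add: event_list_def events_at_def[abs_def] event_times_def)

locale locally_finite_events =
  fixes snk :: "real set" and alp :: "(real \<times> real) set"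
  assumes fin_snk: "finite (snk \<inter> {..t})" and fin_alp: "finite (alp \<inter> {..R} \<times> {..t})"
begin

lemma finite_event_times: "finite (event_times snk alp R t)"
proof (rule finite_subset)
  show "event_times snk alp R t \<subseteq> (snk \<inter> {..t}) \<union> snd ` (alp \<inter> {..R} \<times> {..t})"
    by (force simp: event_times_def)
qed (use fin_snk fin_alp in auto)

lemma finite_positions: "finite {u. u \<le> R \<and> (u, s) \<in> alp}"
proof (rule finite_subset)
  show "{u. u \<le> R \<and> (u, s) \<in> alp} \<subseteq> fst ` (alp \<inter> {..R} \<times> {..s})" by force
qed (use fin_alp in auto)

lemma event_list_relevant:
  assumes "r \<le> R"
  shows "event_list snk alp r t = filter (relevant r) (event_list snk alp R t)"
proof -
  have at: "filter (relevant r) (events_at snk alp R s) = events_at snk alp r s" for s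
  proof -
    have "{u. u \<le> r \<and> (u, s) \<in> alp} = {u \<in> {u. u \<le> R \<and> (u, s) \<in> alp}. u \<le> r}" using assms by auto
    then have "sorted_list_of_set {u. u \<le> r \<and> (u, s) \<in> alp}
        = filter (\<lambda>u. u \<le> r) (sorted_list_of_set {u. u \<le> R \<and> (u, s) \<in> alp})"
      by (simp only: sorted_list_of_set_Collect[OF finite_positions])
    then show ?thesis by (simp add: events_at_def relevant_def filter_map comp_def)
  qed
  have times: "event_times snk alp r t = {s \<in> event_times snk alp R t. s \<in> event_times snk alp r t}"
    using assms by (force simp: event_times_def)
  have "filter (relevant r) (event_list snk alp R t)
      = concat (map (events_at snk alp r) (sorted_list_of_set (event_times snk alp R t)))"
    by (simp add: event_list_alt filter_concat at comp_def)
  also have "\<dots> = concat (map (events_at snk alp r)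
      (filter (\<lambda>s. s \<in> event_times snk alp r t) (sorted_list_of_set (event_times snk alp R t))))"
  proof (rule concat_map_filter[symmetric])
    fix s assume "s \<in> set (sorted_list_of_set (event_times snk alp R t))" "s \<notin> event_times snk alp r t"
    then have s: "s \<notin> snk" "{u. u \<le> r \<and> (u, s) \<in> alp} = {}"
      using finite_event_times by (auto simp: event_times_def)
    show "events_at snk alp r s = []" unfolding events_at_def s(2) using s(1) by simp
  qed
  also have "\<dots> = event_list snk alp r t"
    using times sorted_list_of_set_Collect[OF finite_event_times[of R t], of "\<lambda>s. s \<in> event_times snk alp r t"]
    by (simp add: event_list_alt)
  finally show ?thesis by simp
qed

lemma hammersley_restricted_consistent:
  assumes "r \<le> R"
  shows "hammersley_restricted src snk alp R t \<inter> {..r} = hammersley_restricted src snk alp r t"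
proof -
  have "src \<inter> {..R} \<inter> {..r} = src \<inter> {..r}" using assms by auto
  then show ?thesis
    unfolding hammersley_restricted_def fold_apply_event_restrict event_list_relevant[OF assms] by simp
qed

lemma hammersley_restrict: "hammersley src snk alp t \<inter> {..r} = hammersley_restricted src snk alp r t"
proof
  show "hammersley src snk alp t \<inter> {..r} \<subseteq> hammersley_restricted src snk alp r t"
  proof
    fix x assume "x \<in> hammersley src snk alp t \<inter> {..r}"
    then obtain R where x: "x \<in> hammersley_restricted src snk alp R t" "x \<le> r"
      by (auto simp: hammersley_def)
    have "x \<in> hammersley_restricted src snk alp (max R r) t"
      using x hammersley_restricted_consistent[of R "max R r" src t]  by auto
    then show "x \<in> hammersley_restricted src snk alp r t"
      using x hammersley_restricted_consistent[of r "max R r" src t] by auto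
  qed
  show "hammersley_restricted src snk alp r t \<subseteq> hammersley src snk alp t \<inter> {..r}"
    using hammersley_restricted_consistent[of r r src t] by (auto simp: hammersley_def)
qed

text \<open>If there is an extra particle, it lies beyond \<open>x\<close> exactly when the
  configurations agree up to \<open>x\<close>. The right-hand side involves only countably many
  restricted configurations, which gives access to measurability; its last part is the case without
  an extra particle.\<close>

lemma second_class_particle_gt:
  "second_class_particle src snk alp t > x \<longleftrightarrow>
     (hammersley_restricted (insert 0 src) snk alp x t = hammersley_restricted src snk alp x t \<and>
        (\<exists>n::nat. hammersley_restricted (insert 0 src) snk alp (real (Suc n)) t \<noteq> hammersley_restricted src snk alp (real (Suc n)) t))
     \<or> ((\<forall>n::nat. hammersley_restricted (insert 0 src) snk alp (real (Suc n)) t = hammersley_restricted src snk alp (real (Suc n)) t)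
        \<and> (THE x::real. False) > x)"
proof -
  define H H' where "H = hammersley src snk alp t" "H' = hammersley (insert 0 src) snk alp t"
  have R: "hammersley_restricted src snk alp r t = H \<inter> {..r}"
    "hammersley_restricted (insert 0 src) snk alp r t = H' \<inter> {..r}" for r
    by (simp_all add: H_H'_def hammersley_restrict)
  have ext: "extends_by_one (H \<inter> {..r}) (H' \<inter> {..r})" for r
    using extends_by_one_hammersley[of src snk alp r t 0] by (simp only: R)
  show ?thesis
  proof (cases "H' = H")
    case True
    then have "\<not> (x \<notin> H \<and> H' = insert x H)" for x by auto
    then have "second_class_particle src snk alp t = (THE x::real. False)"
      by (simp only: second_class_particle_def H_H'_def[symmetric])
    then show ?thesis using True by (simp add: R)
  next
    case False
    then obtain y where y: "y \<in> H \<and> y \<notin> H' \<or> y \<notin> H \<and> y \<in> H'" by auto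
    have "y \<notin> H \<and> y \<in> H'" using ext[of y] y by (auto simp: extends_by_one_def)
    moreover have "H' = insert y H"
    proof (rule set_eqI)
      fix z
      have "y \<in> H' \<inter> {..max y z}" "y \<notin> H \<inter> {..max y z}" using calculation by auto
      then have eq: "H' \<inter> {..max y z} = insert y (H \<inter> {..max y z})"
        by (rule extends_by_oneD[OF ext])
      have "z \<in> H' \<inter> {..max y z} \<longleftrightarrow> z \<in> insert y (H \<inter> {..max y z})" by (simp only: eq)
      then show "z \<in> H' \<longleftrightarrow> z \<in> insert y H" by simp
    qed
    ultimately have y: "y \<notin> H" "H' = insert y H" by auto
    have "second_class_particle src snk alp t = y"
      unfolding second_class_particle_def H_H'_def[symmetric] by (rule the_equality) (use y in auto)
    moreover obtain n :: nat where "y \<le> real n" using real_arch_simple by blast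
    then have "y \<in> H' \<inter> {..real (Suc n)}" "y \<notin> H \<inter> {..real (Suc n)}" using y by simp_all
    then have "H' \<inter> {..real (Suc n)} \<noteq> H \<inter> {..real (Suc n)}" by metis
    then have "\<exists>n::nat. H' \<inter> {..real (Suc n)} \<noteq> H \<inter> {..real (Suc n)}" by blast
    moreover have "H' \<inter> {..x} = H \<inter> {..x} \<longleftrightarrow> x < y"
    proof (cases "x < y")
      case True
      then show ?thesis unfolding y(2) by (simp add: Int_insert_left)
    next
      case False
      then have "y \<in> H' \<inter> {..x}" "y \<notin> H \<inter> {..x}" using y by simp_all
      then have "H' \<inter> {..x} \<noteq> H \<inter> {..x}" by metis
      then show ?thesis using False by simp
    qed
    ultimately show ?thesis by (auto simp: R)
  qed
qed

end

section \<open>Invariance under order-preserving relabelling\<close>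

definition map_event :: "(real \<Rightarrow> real) \<Rightarrow> event \<Rightarrow> event" where
  "map_event f e = (case e of Sink \<Rightarrow> Sink | Alpha_Point u \<Rightarrow> Alpha_Point (f u))"

lemma strict_mono_on_le_iff:
  fixes f :: "real \<Rightarrow> real"
  assumes "strict_mono_on A f" "x \<in> A" "y \<in> A"
  shows "f x \<le> f y \<longleftrightarrow> x \<le> y" "f x < f y \<longleftrightarrow> x < y" "f x = f y \<longleftrightarrow> x = y"
proof -
  have "x < y \<Longrightarrow> f x < f y" "y < x \<Longrightarrow> f y < f x"
    using strict_mono_onD[OF assms(1)] assms(2,3) by auto
  then show "f x \<le> f y \<longleftrightarrow> x \<le> y" "f x < f y \<longleftrightarrow> x < y" "f x = f y \<longleftrightarrow> x = y"
    by (cases x y rule: linorder_cases; simp)+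
qed

lemma leftmost_image:
  assumes "strict_mono_on A f" "D \<subseteq> A"
  shows "leftmost (f ` D) = f ` leftmost D"
proof -
  have "f y \<le> f z \<longleftrightarrow> y \<le> z" if "y \<in> D" "z \<in> D" for y z
    using strict_mono_on_le_iff(1)[OF assms(1)] assms(2) that by blast
  then show ?thesis unfolding leftmost_def by auto
qed

text \<open>The dynamics only compares positions, so it commutes with a strictly increasing
  relabelling. The set \<open>A\<close> must contain the \<alpha>-points, because particles jump to
  them.\<close>

lemma apply_event_image:
  assumes f: "strict_mono_on A f" and C: "C \<subseteq> A" and e: "\<And>u. e = Alpha_Point u \<Longrightarrow> u \<in> A"
  shows "apply_event (map_event f e) (f ` C) = f ` apply_event e C \<and> apply_event e C \<subseteq> A"
proof (cases e)
  case Sink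
  have "inj_on f A" using f by (rule strict_mono_on_imp_inj_on)
  then have "f ` C - f ` leftmost C = f ` (C - leftmost C)"
    using inj_on_image_set_diff[of f A C "leftmost C"] C leftmost_subset[of C] by blast
  then show ?thesis using C by (auto simp: Sink map_event_def leftmost_image[OF f C])
next
  case (Alpha_Point u)
  have u: "u \<in> A" using e Alpha_Point by simp
  have inj: "inj_on f A" using f by (rule strict_mono_on_imp_inj_on)
  define D where "D = {y \<in> C. u < y}"
  have D: "D \<subseteq> A" "D \<subseteq> C" using C by (auto simp: D_def)
  have "{y \<in> f ` C. f u < y} = f ` D"
    using strict_mono_on_le_iff(2)[OF f u] C by (auto simp: D_def)
  moreover have "f ` C - f ` leftmost D = f ` (C - leftmost D)"
    using inj_on_image_set_diff[OF inj, of C "leftmost D"] C D leftmost_subset[of D] by blast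
  ultimately show ?thesis
    using C u by (auto simp: Alpha_Point map_event_def leftmost_image[OF f D(1)] D_def[symmetric])
qed

lemma fold_apply_event_image:
  assumes "strict_mono_on A f" "C \<subseteq> A" "\<And>u. Alpha_Point u \<in> set es \<Longrightarrow> u \<in> A"
  shows "fold apply_event (map (map_event f) es) (f ` C) = f ` fold apply_event es C
    \<and> fold apply_event es C \<subseteq> A"
  using assms(2,3)
proof (induction es arbitrary: C)
  case (Cons e es)
  have "apply_event (map_event f e) (f ` C) = f ` apply_event e C \<and> apply_event e C \<subseteq> A"
    using Cons.prems by (intro apply_event_image[OF assms(1)]) auto
  then show ?case using Cons.IH[of "apply_event e C"] Cons.prems by simp
qed simp

lemma sorted_list_of_set_image:
  fixes g :: "real \<Rightarrow> real"
  assumes "finite A" "strict_mono_on A g"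
  shows "sorted_list_of_set (g ` A) = map g (sorted_list_of_set A)"
proof (rule sorted_list_of_set_eqI)
  have inj: "inj_on g A" using assms(2) by (rule strict_mono_on_imp_inj_on)
  show "distinct (map g (sorted_list_of_set A))" using inj assms(1) by (simp add: distinct_map)
  show "sorted (map g (sorted_list_of_set A))"
    unfolding sorted_map
    by (rule sorted_wrt_mono_rel[OF _ sorted_sorted_list_of_set[of A]])
      (use assms strict_mono_on_le_iff(1)[OF assms(2)] in auto)
qed (use assms(1) in simp)

text \<open>Strict monotonicity keeps distinct event times distinct and in order, and likewise the
  positions at one time, so the chronological list is relabelled entry by entry.\<close>

lemma event_list_image:
  assumes T: "finite (event_times snk alp R t)" "strict_mono_on (event_times snk alp R t) g"
    and U: "finite {u. u \<le> R \<and> (\<exists>s\<le>t. (u, s) \<in> alp)}" "strict_mono_on {u. u \<le> R \<and> (\<exists>s\<le>t. (u, s) \<in> alp)} f"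
    and snk: "snk' \<inter> {..t'} = g ` (snk \<inter> {..t})"
    and alp: "alp' \<inter> {..R'} \<times> {..t'} = map_prod f g ` (alp \<inter> {..R} \<times> {..t})"
  shows "event_list snk' alp' R' t' = map (map_event f) (event_list snk alp R t)"
proof -
  let ?T = "event_times snk alp R t" and ?U = "{u. u \<le> R \<and> (\<exists>s\<le>t. (u, s) \<in> alp)}"
  have snk_iff: "s' \<in> snk' \<and> s' \<le> t' \<longleftrightarrow> (\<exists>s. s' = g s \<and> s \<in> snk \<and> s \<le> t)" for s'
    using snk by (auto simp: set_eq_iff)
  have alp_iff: "(u', s') \<in> alp' \<and> u' \<le> R' \<and> s' \<le> t' \<longleftrightarrow>
      (\<exists>u s. u' = f u \<and> s' = g s \<and> (u, s) \<in> alp \<and> u \<le> R \<and> s \<le> t)" for u' s'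
  proof -
    have "(u', s') \<in> alp' \<and> u' \<le> R' \<and> s' \<le> t' \<longleftrightarrow> (u', s') \<in> alp' \<inter> {..R'} \<times> {..t'}" by simp
    also have "\<dots> \<longleftrightarrow> (u', s') \<in> map_prod f g ` (alp \<inter> {..R} \<times> {..t})" by (simp only: alp)
    also have "\<dots> \<longleftrightarrow> (\<exists>u s. u' = f u \<and> s' = g s \<and> (u, s) \<in> alp \<and> u \<le> R \<and> s \<le> t)" by force
    finally show ?thesis .
  qed
  have times: "event_times snk' alp' R' t' = g ` ?T"
  proof (rule set_eqI)
    fix s'
    have "s' \<in> event_times snk' alp' R' t' \<longleftrightarrow> (s' \<in> snk' \<and> s' \<le> t') \<or> (\<exists>u'. (u', s') \<in> alp' \<and> u' \<le> R' \<and> s' \<le> t')"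
      by (auto simp: event_times_def)
    also have "\<dots> \<longleftrightarrow> s' \<in> g ` ?T"
      unfolding snk_iff alp_iff by (auto simp: event_times_def)
    finally show "s' \<in> event_times snk' alp' R' t' \<longleftrightarrow> s' \<in> g ` ?T" .
  qed
  have at: "events_at snk' alp' R' (g s) = map (map_event f) (events_at snk alp R s)" if s: "s \<in> ?T" for s
  proof -
    have st: "s \<le> t" using s by (simp add: event_times_def)
    have gst: "g s \<le> t'"
    proof -
      have "g s \<in> event_times snk' alp' R' t'" using s by (simp only: times) simp
      then show ?thesis by (simp add: event_times_def)
    qed
    have inT: "r \<in> ?T" if "r \<in> snk" "r \<le> t" for r using that by (simp add: event_times_def)
    have inT': "r \<in> ?T" if "(u, r) \<in> alp" "u \<le> R" "r \<le> t" for u r using that by (auto simp: event_times_def)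
    have "g s \<in> snk' \<longleftrightarrow> s \<in> snk"
      using snk_iff[of "g s"] gst st inT strict_mono_on_le_iff(3)[OF T(2) s] by metis
    moreover have "{u'. u' \<le> R' \<and> (u', g s) \<in> alp'} = f ` {u. u \<le> R \<and> (u, s) \<in> alp}"
    proof (rule set_eqI)
      fix u'
      have "u' \<le> R' \<and> (u', g s) \<in> alp' \<longleftrightarrow> (\<exists>u r. u' = f u \<and> g s = g r \<and> (u, r) \<in> alp \<and> u \<le> R \<and> r \<le> t)"
        using alp_iff[of u' "g s"] gst by blast
      also have "\<dots> \<longleftrightarrow> (\<exists>u. u' = f u \<and> (u, s) \<in> alp \<and> u \<le> R)"
        using inT' strict_mono_on_le_iff(3)[OF T(2) s] st by metis
      finally show "u' \<in> {u'. u' \<le> R' \<and> (u', g s) \<in> alp'} \<longleftrightarrow> u' \<in> f ` {u. u \<le> R \<and> (u, s) \<in> alp}"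
        by auto
    qed
    moreover have "sorted_list_of_set (f ` {u. u \<le> R \<and> (u, s) \<in> alp}) = map f (sorted_list_of_set {u. u \<le> R \<and> (u, s) \<in> alp})"
    proof -
      have sub: "{u. u \<le> R \<and> (u, s) \<in> alp} \<subseteq> ?U" using st by auto
      show ?thesis
        by (intro sorted_list_of_set_image finite_subset[OF sub U(1)] monotone_on_subset[OF U(2) sub])
    qed
    ultimately show ?thesis by (simp add: events_at_def map_event_def)
  qed
  have "event_list snk' alp' R' t' = concat (map (\<lambda>s. events_at snk' alp' R' (g s)) (sorted_list_of_set ?T))"
    by (simp add: event_list_alt times sorted_list_of_set_image[OF T] comp_def)
  also have "\<dots> = concat (map (\<lambda>s. map (map_event f) (events_at snk alp R s)) (sorted_list_of_set ?T))"
    using at T(1) by (intro arg_cong[of _ _ concat] map_cong) auto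
  also have "\<dots> = map (map_event f) (event_list snk alp R t)"
    by (simp add: event_list_alt map_concat comp_def)
  finally show ?thesis .
qed

lemma Alpha_Point_in_event_list:
  assumes "finite (event_times snk alp R t)" "finite {u. u \<le> R \<and> (\<exists>s\<le>t. (u, s) \<in> alp)}"
    and "Alpha_Point u \<in> set (event_list snk alp R t)"
  shows "u \<in> {u. u \<le> R \<and> (\<exists>s\<le>t. (u, s) \<in> alp)}"
proof -
  obtain s where s: "s \<in> event_times snk alp R t" "Alpha_Point u \<in> set (events_at snk alp R s)"
    using assms(1,3) by (auto simp: event_list_alt)
  have st: "s \<le> t" using s by (simp add: event_times_def)
  have "finite {u. u \<le> R \<and> (u, s) \<in> alp}"
    by (rule finite_subset[OF _ assms(2)]) (use st in auto)
  then show ?thesis using s(2) st by (auto simp: events_at_def split: if_splits)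
qed

lemma hammersley_restricted_image:
  assumes T: "finite (event_times snk alp R t)" "strict_mono_on (event_times snk alp R t) g"
    and U: "finite {u. u \<le> R \<and> (\<exists>s\<le>t. (u, s) \<in> alp)}"
    and f: "strict_mono_on A f" "src \<inter> {..R} \<subseteq> A" "{u. u \<le> R \<and> (\<exists>s\<le>t. (u, s) \<in> alp)} \<subseteq> A"
    and src: "src' \<inter> {..R'} = f ` (src \<inter> {..R})"
    and snk: "snk' \<inter> {..t'} = g ` (snk \<inter> {..t})"
    and alp: "alp' \<inter> {..R'} \<times> {..t'} = map_prod f g ` (alp \<inter> {..R} \<times> {..t})"
  shows "hammersley_restricted src' snk' alp' R' t' = f ` hammersley_restricted src snk alp R t
    \<and> hammersley_restricted src snk alp R t \<subseteq> A"
proof -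
  have "event_list snk' alp' R' t' = map (map_event f) (event_list snk alp R t)"
    by (rule event_list_image[OF T U monotone_on_subset[OF f(1,3)] snk alp])
  then show ?thesis
    unfolding hammersley_restricted_def src
    using fold_apply_event_image[OF f(1,2), of "event_list snk alp R t"]
      Alpha_Point_in_event_list[OF T(1) U] f(3) by auto
qed

subsection \<open>Lattice configurations\<close>

definition lattice_src :: "(nat \<times> nat) set \<Rightarrow> real set" where
  "lattice_src S = {real i | i. 0 < i \<and> (i, 0) \<in> S}"

definition lattice_snk :: "(nat \<times> nat) set \<Rightarrow> real set" where
  "lattice_snk S = {real j | j. 0 < j \<and> (0, j) \<in> S}"

definition lattice_alp :: "(nat \<times> nat) set \<Rightarrow> (real \<times> real) set" where
  "lattice_alp S = {(real i, real j) | i j. 0 < i \<and> 0 < j \<and> (i, j) \<in> S}"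

definition lattice_hammersley :: "(nat \<times> nat) set \<Rightarrow> nat \<Rightarrow> nat \<Rightarrow> real set" where
  "lattice_hammersley S c n = hammersley_restricted (lattice_src S) (lattice_snk S) (lattice_alp S) (real c) (real n)"

text \<open>A source counts as a point of its column and a sink as a point of its row. This is the
  discrete counterpart of the almost sure absence of coinciding coordinates.\<close>

definition generic :: "(nat \<times> nat) set \<Rightarrow> bool" where
  "generic S \<longleftrightarrow> finite S \<and> (\<forall>i j j'. 0 < i \<and> (i, j) \<in> S \<and> (i, j') \<in> S \<longrightarrow> j = j')
     \<and> (\<forall>i i' j. 0 < j \<and> (i, j) \<in> S \<and> (i', j) \<in> S \<longrightarrow> i = i')"

lemma lattice_locally_finite: "finite S \<Longrightarrow> locally_finite_events (lattice_snk S) (lattice_alp S)"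
proof
  assume S: "finite S"
  have "lattice_snk S \<subseteq> (\<lambda>p. real (snd p)) ` S" by (force simp: lattice_snk_def)
  then have "finite (lattice_snk S)" by (rule finite_subset) (use S in simp)
  then show "finite (lattice_snk S \<inter> {..t})" for t by simp
  have "lattice_alp S \<subseteq> map_prod real real ` S" by (force simp: lattice_alp_def)
  then have "finite (lattice_alp S)" by (rule finite_subset) (use S in simp)
  then show "finite (lattice_alp S \<inter> {..R} \<times> {..t})" for R t by simp
qed

lemma lattice_positions: "{u. u \<le> real c \<and> (u, real (Suc j)) \<in> lattice_alp S} = real ` {i. 0 < i \<and> i \<le> c \<and> (i, Suc j) \<in> S}"
  by (auto simp: lattice_alp_def simp del: of_nat_Suc)

lemma lattice_event_list_Suc:
  assumes "finite S"
  shows "event_list (lattice_snk S) (lattice_alp S) (real c) (real (Suc j))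
    = event_list (lattice_snk S) (lattice_alp S) (real c) (real j)
      @ events_at (lattice_snk S) (lattice_alp S) (real c) (real (Suc j))"
proof -
  interpret locally_finite_events "lattice_snk S" "lattice_alp S" by (rule lattice_locally_finite[OF assms])
  let ?T = "event_times (lattice_snk S) (lattice_alp S) (real c)"
  let ?r = "real (Suc j)"
  have int: "s \<le> real j" if "s \<in> ?T ?r" "s \<noteq> ?r" for s
    using that by (auto simp: event_times_def lattice_snk_def lattice_alp_def)
  have sub: "s \<in> ?T ?r" if "s \<in> ?T (real j)" for s using that by (auto simp: event_times_def)
  have le: "s \<le> real j" if "s \<in> ?T (real j)" for s using that by (simp add: event_times_def)
  have prev: "s \<in> ?T (real j)" if "s \<in> ?T ?r" "s \<noteq> ?r" for s
    using int[OF that] that(1) by (auto simp: event_times_def)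
  show ?thesis
  proof (cases "?r \<in> ?T ?r")
    case True
    have "sorted_list_of_set (?T ?r) = sorted_list_of_set (?T (real j)) @ [?r]"
    proof (rule sorted_list_of_set_eqI)
      show "sorted (sorted_list_of_set (?T (real j)) @ [?r])"
        using le finite_event_times by (fastforce simp: sorted_append)
      show "distinct (sorted_list_of_set (?T (real j)) @ [?r])"
        using le finite_event_times by force
      show "set (sorted_list_of_set (?T (real j)) @ [?r]) = ?T ?r"
        using True sub prev finite_event_times by auto
    qed
    then show ?thesis by (simp add: event_list_alt)
  next
    case False
    then have "?T ?r = ?T (real j)" using sub prev by blast
    moreover have "events_at (lattice_snk S) (lattice_alp S) (real c) ?r = []"
    proof -
      have 1: "?r \<notin> lattice_snk S" "{u. u \<le> real c \<and> (u, ?r) \<in> lattice_alp S} = {}"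
        using False by (auto simp: event_times_def)
      show ?thesis unfolding events_at_def 1(2) using 1(1) by simp
    qed
    ultimately show ?thesis by (simp add: event_list_alt)
  qed
qed

text \<open>A row above the source axis of a generic set contains at most one point. This lemma and
  the next two update the passage times for no point, a sink and an \<alpha>-point, in a form
  comparable to the removal and insertion of particles.\<close>

lemma lpp_row_empty:
  assumes "\<And>k. k \<le> i \<Longrightarrow> (k, Suc j) \<notin> S"
  shows "lpp S i (Suc j) = lpp S i j"
  using assms
proof (induction i)
  case (Suc i)
  then have "lpp S i (Suc j) = lpp S i j" "(Suc i, Suc j) \<notin> S" by auto
  then show ?case using lpp_step[of S i j] by (simp add: max_def)
qed simp

lemma lpp_row_sink:
  assumes "(0, Suc j) \<in> S" "\<And>k. 0 < k \<Longrightarrow> k \<le> i \<Longrightarrow> (k, Suc j) \<notin> S"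
  shows "lpp S i (Suc j) = max (lpp S i j) (lpp S 0 j + 1)"
  using assms(2)
proof (induction i)
  case 0
  show ?case using assms(1) by simp
next
  case (Suc i)
  then have "lpp S i (Suc j) = max (lpp S i j) (lpp S 0 j + 1)" "(Suc i, Suc j) \<notin> S" by auto
  then show ?case using lpp_step[of S i j] by (simp add: max_def)
qed

lemma lpp_row_alpha:
  assumes "(Suc k, Suc j) \<in> S" "\<And>k'. k' \<le> Suc k + d \<Longrightarrow> k' \<noteq> Suc k \<Longrightarrow> (k', Suc j) \<notin> S"
  shows "lpp S (Suc k + d) (Suc j) = max (lpp S (Suc k + d) j) (lpp S k j + 1)"
  using assms(2)
proof (induction d)
  case 0
  have "lpp S k (Suc j) = lpp S k j" by (rule lpp_row_empty) (use 0 in auto)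
  then show ?case using assms(1) lpp_step[of S k j] by (simp add: max_def)
next
  case (Suc d)
  then have "lpp S (Suc k + d) (Suc j) = max (lpp S (Suc k + d) j) (lpp S k j + 1)"
    "(Suc (Suc k + d), Suc j) \<notin> S" by auto
  then show ?case using lpp_step[of S "Suc k + d" j] by (simp add: max_def)
qed

lemma card_remove_leftmost:
  assumes "finite F"
  shows "card (F - leftmost F) = card F - 1"
proof (cases "F = {}")
  case False
  then have "Min F \<in> leftmost F" using assms by (simp add: leftmost_def)
  then obtain m where "m \<in> F" "leftmost F = {m}" using leftmost_cases[of F] by blast
  then show ?thesis by (simp add: card_Diff_singleton)
qed simp

lemma card_split_at:
  fixes E :: "real set"
  assumes "finite E" "E \<subseteq> real ` I" "real (Suc k) \<notin> E" "Suc k \<le> i"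
  shows "card (E \<inter> {..real i}) = card (E \<inter> {..real k}) + card ({y \<in> E. real (Suc k) < y} \<inter> {..real i})"
proof -
  have dich: "y \<le> real k \<or> real (Suc k) < y" if "y \<in> E" for y
  proof -
    have "y \<in> real ` I" using assms(2) that by blast
    then obtain a where a: "y = real a" by blast
    have "a \<noteq> Suc k" using that assms(3) a by blast
    then show ?thesis unfolding a of_nat_le_iff of_nat_less_iff by linarith
  qed
  have "real k \<le> real i" using assms(4) by simp
  then have "E \<inter> {..real i} = (E \<inter> {..real k}) \<union> ({y \<in> E. real (Suc k) < y} \<inter> {..real i})"
    using dich by fastforce
  moreover have "card ((E \<inter> {..real k}) \<union> ({y \<in> E. real (Suc k) < y} \<inter> {..real i}))
      = card (E \<inter> {..real k}) + card ({y \<in> E. real (Suc k) < y} \<inter> {..real i})"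
    using assms(1) by (intro card_Un_disjoint) auto
  ultimately show ?thesis by simp
qed

lemma lattice_hammersley_0:
  "lattice_hammersley S c 0 = real ` {i. 0 < i \<and> i \<le> c \<and> (i, 0) \<in> S}"
proof -
  have "event_times (lattice_snk S) (lattice_alp S) (real c) (real 0) = {}"
    by (auto simp: event_times_def lattice_snk_def lattice_alp_def)
  then have "event_list (lattice_snk S) (lattice_alp S) (real c) (real 0) = []"
    by (simp add: event_list_alt)
  then show ?thesis
    by (auto simp: lattice_hammersley_def hammersley_restricted_def lattice_src_def)
qed

lemma lattice_hammersley_Suc:
  assumes "finite S"
  shows "lattice_hammersley S c (Suc j) = fold apply_event
    ((if (0, Suc j) \<in> S then [Sink] else []) @
      map Alpha_Point (sorted_list_of_set (real ` {i. 0 < i \<and> i \<le> c \<and> (i, Suc j) \<in> S})))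
    (lattice_hammersley S c j)"
proof -
  have "real (Suc j) \<in> lattice_snk S \<longleftrightarrow> (0, Suc j) \<in> S"
    by (auto simp: lattice_snk_def simp del: of_nat_Suc)
  then show ?thesis
    unfolding lattice_hammersley_def hammersley_restricted_def lattice_event_list_Suc[OF assms]
      events_at_def lattice_positions fold_append comp_def by simp
qed

text \<open>A sink removes the leftmost particle and raises \<open>lpp S 0 j\<close>; an
  \<alpha>-point adds a particle and removes the next one to its right. In both cases the counts
  follow the row updates of \<open>lpp\<close>. The inclusion ensures that in a generic set an
  \<alpha>-point never lands on a particle.\<close>

lemma lattice_hammersley_count:
  assumes "generic S"
  shows "lattice_hammersley S c j \<subseteq> real ` {i. 0 < i \<and> i \<le> c \<and> (\<exists>b\<le>j. (i, b) \<in> S)}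
    \<and> (\<forall>i\<le>c. card (lattice_hammersley S c j \<inter> {..real i}) + lpp S 0 j = lpp S i j)"
proof (induction j)
  case 0
  have "card (real ` {i. 0 < i \<and> i \<le> c \<and> (i, 0) \<in> S} \<inter> {..real i}) = lpp S i 0" if "i \<le> c" for i
  proof -
    have "real ` {i. 0 < i \<and> i \<le> c \<and> (i, 0) \<in> S} \<inter> {..real i} = real ` {k. 0 < k \<and> k \<le> i \<and> (k, 0) \<in> S}"
      using that by auto
    moreover have "card {k. 0 < k \<and> k \<le> i \<and> (k, 0) \<in> S} = lpp S i 0"
    proof (induction i)
      case (Suc i)
      have "{k. 0 < k \<and> k \<le> Suc i \<and> (k, 0) \<in> S} = (if (Suc i, 0) \<in> S
          then insert (Suc i) {k. 0 < k \<and> k \<le> i \<and> (k, 0) \<in> S} else {k. 0 < k \<and> k \<le> i \<and> (k, 0) \<in> S})"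
        by (auto simp: le_Suc_eq)
      moreover have "finite {k. 0 < k \<and> k \<le> i \<and> (k, 0) \<in> S}" by (rule finite_subset[of _ "{..i}"]) auto
      ultimately show ?case using Suc by auto
    qed auto
    ultimately show ?thesis by (simp add: card_image)
  qed
  then show ?case by (auto simp: lattice_hammersley_0)
next
  case (Suc j)
  define E where "E = lattice_hammersley S c j"
  define E' where "E' = lattice_hammersley S c (Suc j)"
  let ?P = "\<lambda>j. real ` {i. 0 < i \<and> i \<le> c \<and> (\<exists>b\<le>j. (i, b) \<in> S)}"
  have fS: "finite S" and col: "\<And>i j j'. 0 < i \<Longrightarrow> (i, j) \<in> S \<Longrightarrow> (i, j') \<in> S \<Longrightarrow> j = j'"
    and row: "\<And>i i'. (i, Suc j) \<in> S \<Longrightarrow> (i', Suc j) \<in> S \<Longrightarrow> i = i'"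
    using assms unfolding generic_def by (blast, blast, meson zero_less_Suc)
  have sub: "E \<subseteq> ?P j" and cnt: "\<And>i. i \<le> c \<Longrightarrow> card (E \<inter> {..real i}) + lpp S 0 j = lpp S i j"
    using Suc by (auto simp: E_def)
  have fP: "finite (?P j)" by (rule finite_imageI, rule finite_subset[of _ "{..c}"]) auto
  have fE: "finite E" by (rule finite_subset[OF sub fP])
  have PP: "?P j \<subseteq> ?P (Suc j)" by (auto intro: le_SucI)
  note E' = lattice_hammersley_Suc[OF fS, of c j, folded E_def E'_def]
  have "E' \<subseteq> ?P (Suc j) \<and> (\<forall>i\<le>c. card (E' \<inter> {..real i}) + lpp S 0 (Suc j) = lpp S i (Suc j))"
  proof (cases "\<exists>k\<le>c. (k, Suc j) \<in> S")
    case False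
    then have no: "{i. 0 < i \<and> i \<le> c \<and> (i, Suc j) \<in> S} = {}" "(0, Suc j) \<notin> S" by auto
    have "E' = E" unfolding E' no(1) using no(2) by simp
    moreover have "lpp S i (Suc j) = lpp S i j" if "i \<le> c" for i
      by (rule lpp_row_empty) (use False that in auto)
    ultimately show ?thesis using sub PP cnt no(2) by auto
  next
    case True
    then obtain k where k: "k \<le> c" "(k, Suc j) \<in> S" by blast
    show ?thesis
    proof (cases k)
      case 0
      then have snk: "(0, Suc j) \<in> S" using k by simp
      have no: "(i, Suc j) \<notin> S" if "0 < i" for i using row[OF snk, of i] that by auto
      have none: "{i. 0 < i \<and> i \<le> c \<and> (i, Suc j) \<in> S} = {}" using no by auto
      have eq: "E' = E - leftmost E" unfolding E' none using snk by simp
      have count: "card (E' \<inter> {..real i}) + lpp S 0 (Suc j) = lpp S i (Suc j)" if "i \<le> c" for i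
      proof -
        have "E' \<inter> {..real i} = (E \<inter> {..real i}) - leftmost (E \<inter> {..real i})"
          unfolding eq leftmost_restrict by blast
        then have "card (E' \<inter> {..real i}) = card (E \<inter> {..real i}) - 1"
          using fE by (simp add: card_remove_leftmost)
        moreover have "lpp S i (Suc j) = max (lpp S i j) (lpp S 0 j + 1)" "lpp S 0 (Suc j) = lpp S 0 j + 1"
          using lpp_row_sink[OF snk] no snk by auto
        ultimately show ?thesis using cnt[OF that] by simp
      qed
      have "E' \<subseteq> ?P (Suc j)"
        unfolding eq by (rule order_trans[OF Diff_subset order_trans[OF sub PP]])
      then show ?thesis by (intro conjI allI impI count)
    next
      case (Suc k')
      define v where "v = real (Suc k')"
      have al: "(Suc k', Suc j) \<in> S" "Suc k' \<le> c" using k Suc by simp_all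
      have no: "(i, Suc j) \<notin> S" if "i \<noteq> Suc k'" for i using row[OF al(1), of i] that by auto
      have one: "{i. 0 < i \<and> i \<le> c \<and> (i, Suc j) \<in> S} = {Suc k'}" "(0, Suc j) \<notin> S" using no al by auto
      have eq: "E' = insert v (E - leftmost {y \<in> E. v < y})" unfolding E' one(1) using one(2) by (simp add: v_def)
      have vE: "v \<notin> E"
      proof
        assume "v \<in> E"
        then obtain b where "b \<le> j" "(Suc k', b) \<in> S" using sub by (auto simp: v_def simp del: of_nat_Suc)
        then show False using col[of "Suc k'" b "Suc j"] al by simp
      qed
      have L0: "lpp S 0 (Suc j) = lpp S 0 j" by (rule lpp_row_empty) (use no in auto)
      have count: "card (E' \<inter> {..real i}) + lpp S 0 (Suc j) = lpp S i (Suc j)" if ic: "i \<le> c" for i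
      proof (cases "i < Suc k'")
        case True
        have iv: "real i < v" unfolding v_def using True by (simp del: of_nat_Suc)
        have "leftmost {y \<in> E. v < y} \<subseteq> {v<..}" using leftmost_subset[of "{y \<in> E. v < y}"] by auto
        then have "E' \<inter> {..real i} = E \<inter> {..real i}" unfolding eq using iv by auto
        moreover have "lpp S i (Suc j) = lpp S i j" by (rule lpp_row_empty) (use no True in auto)
        ultimately show ?thesis using cnt[OF ic] L0 by simp
      next
        case False
        then obtain d where d: "i = Suc k' + d" using le_Suc_ex not_less by blast
        define F where "F = {y \<in> E. v < y} \<inter> {..real i}"
        have fF: "finite F" using fE by (simp add: F_def)
        have "v \<le> real i" unfolding v_def of_nat_le_iff using d by simp
        then have "E' \<inter> {..real i} = insert v ((E \<inter> {..real i}) - leftmost F)"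
          unfolding eq F_def leftmost_restrict by auto
        moreover have "v \<notin> (E \<inter> {..real i}) - leftmost F" using vE by simp
        ultimately have c1: "card (E' \<inter> {..real i}) = Suc (card ((E \<inter> {..real i}) - leftmost F))"
          using fE by simp
        have sp: "card (E \<inter> {..real i}) = card (E \<inter> {..real k'}) + card F"
          unfolding F_def v_def by (rule card_split_at[OF fE sub]) (use vE d in \<open>auto simp: v_def\<close>)
        have "leftmost F \<subseteq> E \<inter> {..real i}" using leftmost_subset[of F] by (auto simp: F_def)
        then have c2: "card ((E \<inter> {..real i}) - leftmost F) = card (E \<inter> {..real i}) - card (leftmost F)"
          using fE by (intro card_Diff_subset) (auto intro: finite_subset)
        have fL: "finite (leftmost F)" by (rule finite_subset[OF leftmost_subset fF])
        have c3: "card F - card (leftmost F) = card F - 1" "card (leftmost F) \<le> card F"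
          using card_remove_leftmost[OF fF] card_Diff_subset[OF fL leftmost_subset]
            card_mono[OF fF leftmost_subset] by simp_all
        \<comment> \<open>One particle arrives at \<open>v\<close>, and one of \<open>F\<close>
          leaves unless \<open>F\<close> is empty.\<close>
        have "card (E' \<inter> {..real i}) = card (E \<inter> {..real k'}) + max (card F) 1"
          unfolding c1 c2 sp using c3 by auto
        moreover have "lpp S i (Suc j) = max (lpp S i j) (lpp S k' j + 1)"
          unfolding d by (rule lpp_row_alpha) (use al no in auto)
        moreover have "card (E \<inter> {..real k'}) + lpp S 0 j = lpp S k' j" using cnt al by simp
        ultimately show ?thesis using cnt[OF ic] sp L0 by simp
      qed
      have "E' \<subseteq> ?P (Suc j)"
      proof -
        have "v \<in> ?P (Suc j)" unfolding v_def using al by (intro imageI) auto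
        then show ?thesis
          unfolding eq insert_subset using order_trans[OF Diff_subset order_trans[OF sub PP]] by simp
      qed
      then show ?thesis by (intro conjI allI impI count)
    qed
  qed
  then show ?case unfolding E'_def .
qed

text \<open>The extra source sits at position \<open>1\<close> because lattice positions start
  there; the first column is kept free for it.\<close>

definition lattice_gap :: "nat \<Rightarrow> nat \<Rightarrow> (nat \<times> nat) set \<Rightarrow> bool" where
  "lattice_gap c n S \<longleftrightarrow>
     hammersley_restricted (insert 1 (lattice_src S)) (lattice_snk S) (lattice_alp S) (real c) (real n)
      \<noteq> hammersley_restricted (lattice_src S) (lattice_snk S) (lattice_alp S) (real c) (real n)"

lemma generic_subset:
  assumes "generic T" "S \<subseteq> T"
  shows "generic S"
proof -
  have "finite T" using assms(1) unfolding generic_def by simp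
  then have "finite S" by (rule finite_subset[OF assms(2)])
  moreover have "j = j'" if "0 < i" "(i, j) \<in> S" "(i, j') \<in> S" for i j j'
    using assms(1) subsetD[OF assms(2) that(2)] subsetD[OF assms(2) that(3)] that(1)
    unfolding generic_def by meson
  moreover have "i = i'" if "0 < j" "(i, j) \<in> S" "(i', j) \<in> S" for i i' j
    using assms(1) subsetD[OF assms(2) that(2)] subsetD[OF assms(2) that(3)] that(1)
    unfolding generic_def by meson
  ultimately show ?thesis unfolding generic_def by meson
qed

text \<open>Configurations that differ by at most one particle are equal if they have the same size,
  and both sizes are passage times minus the same number of sinks.\<close>

lemma lattice_gap_iff:
  assumes "generic (insert (1, 0) S)" "(1, 0) \<notin> S"
  shows "lattice_gap c n S \<longleftrightarrow> lpp (insert (1, 0) S) c n \<noteq> lpp S c n"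
proof -
  let ?S = "insert (1, 0) S"
  define E E' where "E = lattice_hammersley S c n" "E' = lattice_hammersley ?S c n"
  have g: "generic S" by (rule generic_subset[OF assms(1)]) auto
  have "lattice_src ?S = insert 1 (lattice_src S)" by (auto simp: lattice_src_def)
  moreover have "lattice_snk ?S = lattice_snk S" by (auto simp: lattice_snk_def)
  moreover have "lattice_alp ?S = lattice_alp S" by (auto simp: lattice_alp_def)
  ultimately have E': "E' = hammersley_restricted (insert 1 (lattice_src S)) (lattice_snk S) (lattice_alp S) (real c) (real n)"
    by (simp add: E_E'_def lattice_hammersley_def)
  have gap: "lattice_gap c n S \<longleftrightarrow> E' \<noteq> E"
    unfolding lattice_gap_def E' E_E'_def lattice_hammersley_def ..
  have ext: "extends_by_one E E'"
    unfolding E' E_E'_def(1) lattice_hammersley_def by (rule extends_by_one_hammersley)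
  have count: "finite (lattice_hammersley T c n) \<and> card (lattice_hammersley T c n) + lpp T 0 n = lpp T c n"
    if "generic T" for T
  proof -
    have sub: "lattice_hammersley T c n \<subseteq> real ` {..c}" using lattice_hammersley_count[OF that, of c n] by auto
    then have "lattice_hammersley T c n \<inter> {..real c} = lattice_hammersley T c n" by auto
    then show ?thesis using lattice_hammersley_count[OF that, of c n] finite_subset[OF sub] by auto
  qed
  have "lpp ?S 0 n = lpp S 0 n" by (rule lpp_cong) auto
  then have c: "finite E" "finite E'" "card E + lpp S 0 n = lpp S c n" "card E' + lpp S 0 n = lpp ?S c n"
    using count[OF g] count[OF assms(1)] by (auto simp: E_E'_def)
  have "E' = E \<longleftrightarrow> card E' = card E"
  proof
    assume eq: "card E' = card E"
    show "E' = E"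
    proof (rule ccontr)
      assume "E' \<noteq> E"
      then obtain x where "x \<notin> E" "E' = insert x E" using ext by (auto simp: extends_by_one_def)
      then show False using eq c(1) by simp
    qed
  qed simp
  then show ?thesis unfolding gap using c(3,4) by linarith
qed

section \<open>Locating the points in the cells of the mesh\<close>

definition mesh_cell :: "real \<Rightarrow> nat \<Rightarrow> nat \<Rightarrow> real set" where
  "mesh_cell x c i = {x * (real i - 1) / real c <.. x * real i / real c}"

definition mesh_index :: "real \<Rightarrow> nat \<Rightarrow> real \<Rightarrow> nat" where
  "mesh_index x c u = nat \<lceil>u * real c / x\<rceil>"

lemma mesh_index:
  assumes "0 < x" "0 < c" "0 < u"
  shows "u \<in> mesh_cell x c i \<longleftrightarrow> i = mesh_index x c u" "0 < mesh_index x c u"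
    "mesh_index x c u \<le> c \<longleftrightarrow> u \<le> x"
proof -
  define v where "v = u * real c / x"
  have v: "0 < v" using assms by (simp add: v_def)
  have idx: "mesh_index x c u = nat \<lceil>v\<rceil>" by (simp add: mesh_index_def v_def)
  have "u \<in> mesh_cell x c i \<longleftrightarrow> real i - 1 < v \<and> v \<le> real i"
    using assms by (simp add: mesh_cell_def v_def field_simps)
  also have "\<dots> \<longleftrightarrow> \<lceil>v\<rceil> = int i" by (auto simp: ceiling_eq_iff)
  also have "\<dots> \<longleftrightarrow> i = nat \<lceil>v\<rceil>" using v by auto
  finally show "u \<in> mesh_cell x c i \<longleftrightarrow> i = mesh_index x c u" by (simp only: idx)
  show "0 < mesh_index x c u" using v by (simp add: idx)
  have "mesh_index x c u \<le> c \<longleftrightarrow> v \<le> real c" unfolding idx by (simp add: ceiling_le_iff nat_le_iff)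
  also have "\<dots> \<longleftrightarrow> u \<le> x" using assms by (simp add: v_def field_simps)
  finally show "mesh_index x c u \<le> c \<longleftrightarrow> u \<le> x" .
qed

text \<open>For \<open>u = 0\<close> the second conclusion keeps every separated position out of the
  first column, which is reserved for the extra source.\<close>

lemma mesh_index_less:
  assumes "0 < x" "0 < c" "0 \<le> u" "x / real c < v - u"
  shows "mesh_index x c u < mesh_index x c v" "1 < mesh_index x c v"
proof -
  have "1 < (v - u) * real c / x" using assms by (simp add: field_simps)
  then have 1: "u * real c / x + 1 < v * real c / x" by (simp add: left_diff_distrib diff_divide_distrib)
  have 0: "0 \<le> u * real c / x" using assms by simp
  have "\<lceil>u * real c / x\<rceil> + 1 \<le> \<lceil>v * real c / x\<rceil>" using 1 by linarith
  moreover have "0 \<le> \<lceil>u * real c / x\<rceil>" using 0 by linarith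
  ultimately show "mesh_index x c u < mesh_index x c v" unfolding mesh_index_def by linarith
  have "2 \<le> \<lceil>v * real c / x\<rceil>" using 0 1 by linarith
  then show "1 < mesh_index x c v" unfolding mesh_index_def by linarith
qed

definition occupied ::
  "real set \<Rightarrow> real set \<Rightarrow> (real \<times> real) set \<Rightarrow> real \<Rightarrow> real \<Rightarrow> nat \<Rightarrow> nat \<Rightarrow> (nat \<times> nat) set" where
  "occupied src snk alp x t c n = {(i, j) \<in> grid c n.
     if j = 0 then src \<inter> mesh_cell x c i \<noteq> {}
     else if i = 0 then snk \<inter> mesh_cell t n j \<noteq> {}
     else alp \<inter> mesh_cell x c i \<times> mesh_cell t n j \<noteq> {}}"

definition separated :: "real set \<Rightarrow> real \<Rightarrow> bool" where
  "separated A h \<longleftrightarrow> (\<forall>u\<in>A. \<forall>v\<in>A. u < v \<longrightarrow> h < v - u)"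

lemma separated_exists:
  assumes "finite A"
  obtains e where "0 < e" "\<And>h. h < e \<Longrightarrow> separated A h"
proof -
  define D where "D = insert 1 ((\<lambda>(u, v). v - u) ` {p \<in> A \<times> A. fst p < snd p})"
  have fin: "finite D" using assms by (auto simp: D_def)
  have pos: "\<forall>d\<in>D. 0 < d" by (auto simp: D_def)
  have "Min D \<in> D" using fin by (intro Min_in) (auto simp: D_def)
  then have "0 < Min D" using pos by blast
  moreover have "separated A h" if "h < Min D" for h
    unfolding separated_def
  proof (intro ballI impI)
    fix u v assume "u \<in> A" "v \<in> A" "u < v"
    then have "v - u \<in> D" by (force simp: D_def)
    then have "Min D \<le> v - u" using fin by (intro Min_le)
    then show "h < v - u" using that by linarith
  qed
  ultimately show ?thesis using that by blast
qed

locale quadrant_events = locally_finite_events snk alp for snk alp +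
  fixes src :: "real set"
  assumes fin_src: "finite (src \<inter> {..R})"
    and positive: "src \<subseteq> {0<..}" "snk \<subseteq> {0<..}" "alp \<subseteq> {0<..} \<times> {0<..}"
begin

text \<open>The origin is included so that separation also measures the distance of the other
  positions from it.\<close>

definition positions :: "real \<Rightarrow> real \<Rightarrow> real set" where
  "positions x t = insert 0 ((src \<inter> {..x}) \<union> {u. u \<le> x \<and> (\<exists>s\<le>t. (u, s) \<in> alp)})"

lemma finite_alpha_positions: "finite {u. u \<le> x \<and> (\<exists>s\<le>t. (u, s) \<in> alp)}"
proof (rule finite_subset)
  show "{u. u \<le> x \<and> (\<exists>s\<le>t. (u, s) \<in> alp)} \<subseteq> fst ` (alp \<inter> {..x} \<times> {..t})" by force
qed (use fin_alp in auto)

lemma finite_all_positions: "finite (positions x t)"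
  unfolding positions_def using fin_src finite_alpha_positions by simp

text \<open>The position \<open>0\<close> of the extra source is moved to the first column, which is empty.\<close>

lemma lattice_gap_occupied:
  assumes "0 < x" "0 < t" "0 < c" "0 < n"
    and sepx: "separated (positions x t) (x / real c)"
    and sept: "separated (event_times snk alp x t) (t / real n)"
  shows "lattice_gap c n (occupied src snk alp x t c n) \<longleftrightarrow>
    hammersley_restricted (insert 0 src) snk alp x t \<noteq> hammersley_restricted src snk alp x t"
proof -
  define f where "f u = (if u = 0 then 1 else real (mesh_index x c u))" for u
  define g where "g s = real (mesh_index t n s)" for s
  let ?S = "occupied src snk alp x t c n"
  let ?A = "positions x t" and ?T = "event_times snk alp x t"
  have A0: "0 \<le> u" if "u \<in> ?A" for u using that positive by (force simp: positions_def)
  have f_mono: "strict_mono_on ?A f"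
  proof (rule strict_mono_onI)
    fix u v assume uv: "u \<in> ?A" "v \<in> ?A" "u < v"
    then have gap: "x / real c < v - u" using sepx by (simp add: separated_def)
    have "0 \<le> u" using A0 uv by simp
    then show "f u < f v"
      using mesh_index_less[OF assms(1,3) _ gap] uv(3) by (auto simp: f_def)
  qed
  have g_mono: "strict_mono_on ?T g"
  proof (rule strict_mono_onI)
    fix r s assume rs: "r \<in> ?T" "s \<in> ?T" "r < s"
    then have gap: "t / real n < s - r" using sept by (simp add: separated_def)
    have "0 \<le> r" using rs(1) positive by (force simp: event_times_def)
    then show "g r < g s" using mesh_index_less[OF assms(2,4) _ gap] by (simp add: g_def)
  qed
  note ix = mesh_index[OF assms(1,3)] and it = mesh_index[OF assms(2,4)]
  have src': "lattice_src ?S \<inter> {..real c} = f ` (src \<inter> {..x})"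
  proof (rule set_eqI, rule iffI)
    fix v assume "v \<in> lattice_src ?S \<inter> {..real c}"
    then obtain i u where i: "v = real i" "0 < i" "i \<le> c" "u \<in> src" "u \<in> mesh_cell x c i"
      by (auto simp: lattice_src_def occupied_def)
    then have u: "0 < u" using positive by auto
    then have "v = f u" "u \<le> x" using i ix[OF u] by (auto simp: f_def)
    then show "v \<in> f ` (src \<inter> {..x})" using i by auto
  next
    fix v assume "v \<in> f ` (src \<inter> {..x})"
    then obtain u where u: "v = f u" "u \<in> src" "u \<le> x" by auto
    then have u0: "0 < u" using positive by auto
    have "u \<in> src \<inter> mesh_cell x c (mesh_index x c u)" using u ix[OF u0] by simp
    then have "(mesh_index x c u, 0) \<in> ?S"
      using ix(2,3)[OF u0] u(3) by (auto simp: occupied_def grid_def)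
    then show "v \<in> lattice_src ?S \<inter> {..real c}"
      using u u0 ix(2,3)[OF u0] by (auto simp: lattice_src_def f_def)
  qed
  have src0': "insert 1 (lattice_src ?S) \<inter> {..real c} = f ` (insert 0 src \<inter> {..x})"
  proof -
    have "insert 1 (lattice_src ?S) \<inter> {..real c} = insert 1 (lattice_src ?S \<inter> {..real c})"
      using assms(3) by (simp add: Int_insert_left)
    also have "\<dots> = insert (f 0) (f ` (src \<inter> {..x}))" by (simp add: src' f_def)
    also have "\<dots> = f ` (insert 0 src \<inter> {..x})" using assms(1) by (simp add: Int_insert_left)
    finally show ?thesis .
  qed
  have snk': "lattice_snk ?S \<inter> {..real n} = g ` (snk \<inter> {..t})"
  proof (rule set_eqI, rule iffI)
    fix v assume "v \<in> lattice_snk ?S \<inter> {..real n}"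
    then obtain j where j: "v = real j" "0 < j" "j \<le> n" "(0, j) \<in> ?S" by (auto simp: lattice_snk_def)
    then have "snk \<inter> mesh_cell t n j \<noteq> {}" by (simp add: occupied_def)
    then obtain s where js: "s \<in> snk" "s \<in> mesh_cell t n j" by blast
    note j = j(1,2,3) js
    then have s: "0 < s" using positive by auto
    then have "v = g s" "s \<le> t" using j it[OF s] by (auto simp: g_def)
    then show "v \<in> g ` (snk \<inter> {..t})" using j by auto
  next
    fix v assume "v \<in> g ` (snk \<inter> {..t})"
    then obtain s where s: "v = g s" "s \<in> snk" "s \<le> t" by auto
    then have s0: "0 < s" using positive by auto
    have "s \<in> snk \<inter> mesh_cell t n (mesh_index t n s)" using s it[OF s0] by simp
    then have "(0, mesh_index t n s) \<in> ?S"
      using it(2,3)[OF s0] s(3) by (auto simp: occupied_def grid_def)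
    then show "v \<in> lattice_snk ?S \<inter> {..real n}"
      using s s0 it(2,3)[OF s0] by (auto simp: lattice_snk_def g_def)
  qed
  have alp': "lattice_alp ?S \<inter> {..real c} \<times> {..real n} = map_prod f g ` (alp \<inter> {..x} \<times> {..t})"
  proof (rule set_eqI, rule iffI)
    fix v assume "v \<in> lattice_alp ?S \<inter> {..real c} \<times> {..real n}"
    then obtain i j where ij: "v = (real i, real j)" "0 < i" "i \<le> c" "0 < j" "j \<le> n" "(i, j) \<in> ?S"
      by (auto simp: lattice_alp_def)
    then have "alp \<inter> mesh_cell x c i \<times> mesh_cell t n j \<noteq> {}" by (simp add: occupied_def)
    then obtain u s where us: "(u, s) \<in> alp" "u \<in> mesh_cell x c i" "s \<in> mesh_cell t n j" by blast
    note ij = ij(1-5) us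
    then have us: "0 < u" "0 < s" using positive by auto
    then have "v = map_prod f g (u, s)" "u \<le> x" "s \<le> t"
      using ij ix[OF us(1)] it[OF us(2)] by (auto simp: f_def g_def)
    then show "v \<in> map_prod f g ` (alp \<inter> {..x} \<times> {..t})" using ij(6) by (intro image_eqI) auto
  next
    fix v assume "v \<in> map_prod f g ` (alp \<inter> {..x} \<times> {..t})"
    then obtain u s where us: "v = (f u, g s)" "(u, s) \<in> alp" "u \<le> x" "s \<le> t" by auto
    then have us0: "0 < u" "0 < s" using positive by auto
    have "(u, s) \<in> alp \<inter> mesh_cell x c (mesh_index x c u) \<times> mesh_cell t n (mesh_index t n s)"
      using us ix[OF us0(1)] it[OF us0(2)] by simp
    then have "alp \<inter> mesh_cell x c (mesh_index x c u) \<times> mesh_cell t n (mesh_index t n s) \<noteq> {}" by blast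
    then have "(mesh_index x c u, mesh_index t n s) \<in> ?S"
      using ix(2,3)[OF us0(1)] it(2,3)[OF us0(2)] us by (simp add: occupied_def grid_def)
    then show "v \<in> lattice_alp ?S \<inter> {..real c} \<times> {..real n}"
      using us us0 ix(2,3)[OF us0(1)] it(2,3)[OF us0(2)] by (auto simp: lattice_alp_def f_def g_def)
  qed
  have U: "{u. u \<le> x \<and> (\<exists>s\<le>t. (u, s) \<in> alp)} \<subseteq> ?A" "src \<inter> {..x} \<subseteq> ?A" "insert 0 src \<inter> {..x} \<subseteq> ?A"
    by (auto simp: positions_def)
  note im = hammersley_restricted_image[OF finite_event_times g_mono finite_alpha_positions f_mono _ U(1) _ snk' alp']
  have 1: "hammersley_restricted (lattice_src ?S) (lattice_snk ?S) (lattice_alp ?S) (real c) (real n)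
      = f ` hammersley_restricted src snk alp x t \<and> hammersley_restricted src snk alp x t \<subseteq> ?A"
    by (rule im[OF U(2) src'])
  have 2: "hammersley_restricted (insert 1 (lattice_src ?S)) (lattice_snk ?S) (lattice_alp ?S) (real c) (real n)
      = f ` hammersley_restricted (insert 0 src) snk alp x t \<and> hammersley_restricted (insert 0 src) snk alp x t \<subseteq> ?A"
    by (rule im[OF U(3) src0'])
  have "inj_on f ?A" using f_mono by (rule strict_mono_on_imp_inj_on)
  then have "f ` hammersley_restricted (insert 0 src) snk alp x t = f ` hammersley_restricted src snk alp x t
      \<longleftrightarrow> hammersley_restricted (insert 0 src) snk alp x t = hammersley_restricted src snk alp x t"
    using 1 2 by (intro inj_on_image_eq_iff) auto
  then show ?thesis unfolding lattice_gap_def using 1 2 by simp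
qed

lemma eventually_lattice_gap_occupied:
  assumes "0 < x" "0 < t" "0 < b"
  shows "\<forall>\<^sub>F K in sequentially. lattice_gap (b * K) K (occupied src snk alp x t (b * K) K) \<longleftrightarrow>
    hammersley_restricted (insert 0 src) snk alp x t \<noteq> hammersley_restricted src snk alp x t"
proof -
  obtain e1 where e1: "0 < e1" "\<And>h. h < e1 \<Longrightarrow> separated (positions x t) h"
    using separated_exists[OF finite_all_positions] by metis
  obtain e2 where e2: "0 < e2" "\<And>h. h < e2 \<Longrightarrow> separated (event_times snk alp x t) h"
    using separated_exists[OF finite_event_times] by metis
  have "(\<lambda>K. x / real (b * K)) \<longlonglongrightarrow> 0" "(\<lambda>K::nat. t / real K) \<longlonglongrightarrow> 0"
    using assms by real_asymp+
  then have "\<forall>\<^sub>F K in sequentially. x / real (b * K) < e1" "\<forall>\<^sub>F K in sequentially. t / real K < e2"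
    using e1(1) e2(1) order_tendstoD(2) by blast+
  then show ?thesis using eventually_gt_at_top[of 0]
  proof eventually_elim
    case (elim K)
    show ?case using assms elim by (intro lattice_gap_occupied e1(2) e2(2)) auto
  qed
qed

end

subsection \<open>The probability of a coincidence on the grid\<close>

lemma bexp_pairs:
  assumes "finite I" "is_prob_on I p" "A \<subseteq> I"
  shows "bexp I p (\<lambda>S. \<Sum>a\<in>A. \<Sum>b\<in>A - {a}. of_bool (a \<in> S \<and> b \<in> S)) \<le> (\<Sum>a\<in>A. p a)\<^sup>2"
proof -
  have fA: "finite A" by (rule finite_subset[OF assms(3,1)])
  have "bexp I p (\<lambda>S. \<Sum>a\<in>A. \<Sum>b\<in>A - {a}. of_bool (a \<in> S \<and> b \<in> S))
      = (\<Sum>a\<in>A. \<Sum>b\<in>A - {a}. bexp I p (\<lambda>S. of_bool (a \<in> S \<and> b \<in> S)))"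
    by (simp only: bexp_sum)
  also have "\<dots> = (\<Sum>a\<in>A. \<Sum>b\<in>A - {a}. p a * p b)"
    using assms by (intro sum.cong refl bexp_mem2) auto
  also have "\<dots> \<le> (\<Sum>a\<in>A. \<Sum>b\<in>A. p a * p b)"
    using assms fA by (intro sum_mono sum_mono2) (auto simp: is_prob_on_def subset_iff)
  also have "\<dots> = (\<Sum>a\<in>A. p a)\<^sup>2" by (simp add: power2_eq_square sum_product)
  finally show ?thesis .
qed

definition good_config :: "(nat \<times> nat) set \<Rightarrow> bool" where
  "good_config S \<longleftrightarrow> generic (insert (1, 0) S) \<and> (1, 0) \<notin> S"

text \<open>A union bound: a bad configuration has a point in the first column, two points in some
  column or two points in some row.\<close>

lemma not_good_config_bound:
  assumes S: "S \<subseteq> grid c n" and c: "0 < c"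
  shows "of_bool (\<not> good_config S) \<le> (\<Sum>a\<in>{1} \<times> {..n}. of_bool (a \<in> S))
    + (\<Sum>i\<in>{1..c}. \<Sum>a\<in>{i} \<times> {..n}. \<Sum>b\<in>{i} \<times> {..n} - {a}. of_bool (a \<in> S \<and> b \<in> S))
    + (\<Sum>j\<in>{1..n}. \<Sum>a\<in>{..c} \<times> {j}. \<Sum>b\<in>{..c} \<times> {j} - {a}. of_bool (a \<in> S \<and> b \<in> S) :: real)"
    (is "_ \<le> ?X + ?Y + ?Z")
proof (rule ccontr)
  assume neg: "\<not> ?thesis"
  have nn: "0 \<le> ?X" "0 \<le> ?Y" "0 \<le> ?Z" by (auto intro!: sum_nonneg)
  have bad: "\<not> good_config S" using neg nn by (auto simp: of_bool_def split: if_splits)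
  have small: "?X + ?Y + ?Z < 1" using neg bad by simp
  have X: "a \<notin> S" if "a \<in> {1} \<times> {..n}" for a
  proof
    assume "a \<in> S"
    then have "1 \<le> ?X" using that by (intro order_trans[OF _ member_le_sum[of a]]) auto
    then show False using small nn by linarith
  qed
  have Y: "\<not> (a \<in> S \<and> b \<in> S)" if "i \<in> {1..c}" "a \<in> {i} \<times> {..n}" "b \<in> {i} \<times> {..n} - {a}" for i a b
  proof
    assume ab: "a \<in> S \<and> b \<in> S"
    have "1 \<le> (\<Sum>b\<in>{i} \<times> {..n} - {a}. of_bool (a \<in> S \<and> b \<in> S) :: real)"
      using that ab by (intro order_trans[OF _ member_le_sum[of b]]) auto
    also have "\<dots> \<le> (\<Sum>a\<in>{i} \<times> {..n}. \<Sum>b\<in>{i} \<times> {..n} - {a}. of_bool (a \<in> S \<and> b \<in> S))"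
      using that by (intro member_le_sum[of a]) (auto intro!: sum_nonneg)
    also have "\<dots> \<le> ?Y"
      using that by (intro member_le_sum[of i]) (auto intro!: sum_nonneg)
    finally show False using small nn by linarith
  qed
  have Z: "\<not> (a \<in> S \<and> b \<in> S)" if "j \<in> {1..n}" "a \<in> {..c} \<times> {j}" "b \<in> {..c} \<times> {j} - {a}" for j a b
  proof
    assume ab: "a \<in> S \<and> b \<in> S"
    have "1 \<le> (\<Sum>b\<in>{..c} \<times> {j} - {a}. of_bool (a \<in> S \<and> b \<in> S) :: real)"
      using that ab by (intro order_trans[OF _ member_le_sum[of b]]) auto
    also have "\<dots> \<le> (\<Sum>a\<in>{..c} \<times> {j}. \<Sum>b\<in>{..c} \<times> {j} - {a}. of_bool (a \<in> S \<and> b \<in> S))"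
      using that by (intro member_le_sum[of a]) (auto intro!: sum_nonneg)
    also have "\<dots> \<le> ?Z"
      using that by (intro member_le_sum[of j]) (auto intro!: sum_nonneg)
    finally show False using small nn by linarith
  qed
  have gr: "i \<le> c \<and> j \<le> n" if "(i, j) \<in> S" for i j using that S by (auto simp: grid_def)
  have no1: "(1, j) \<notin> S" for j using X[of "(1, j)"] gr[of 1 j] by auto
  have "finite S" by (rule finite_subset[OF S finite_grid])
  moreover have "j = j'" if "0 < i" "(i, j) \<in> insert (1, 0) S" "(i, j') \<in> insert (1, 0) S" for i j j'
  proof (cases "i = 1")
    case True
    then show ?thesis using that no1 by auto
  next
    case False
    then have "(i, j) \<in> S" "(i, j') \<in> S" using that by auto
    then show ?thesis using Y[of i "(i, j)" "(i, j')"] that(1) gr by fastforce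
  qed
  moreover have "i = i'" if "0 < j" "(i, j) \<in> insert (1, 0) S" "(i', j) \<in> insert (1, 0) S" for i i' j
  proof -
    have "(i, j) \<in> S" "(i', j) \<in> S" using that by auto
    then show ?thesis using Z[of j "(i, j)" "(i', j)"] that(1) gr by fastforce
  qed
  ultimately have "generic (insert (1, 0) S)" unfolding generic_def by (metis finite_insert)
  then show False using bad no1 by (simp add: good_config_def)
qed

lemma bexp_not_good_config:
  assumes "0 \<le> l" "l \<le> 1" "0 \<le> m" "m \<le> 1" "0 \<le> p" "p \<le> 1" "0 < c"
  shows "bexp (grid c n) (prm l m p) (\<lambda>S. of_bool (\<not> good_config S))
    \<le> (l + real n * p) + real c * (l + real n * p)\<^sup>2 + real n * (m + real c * p)\<^sup>2"
proof -
  let ?q = "prm l m p" and ?I = "grid c n"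
  have pr: "is_prob_on ?I ?q" using assms by (intro is_prob_prm)
  have col: "(\<Sum>a\<in>{i} \<times> {..n}. ?q a) = l + real n * p" if "1 \<le> i" for i
  proof -
    have "(\<Sum>a\<in>{i} \<times> {..n}. ?q a) = (\<Sum>j\<in>{..n}. ?q (i, j))"
      by (rule sum.reindex_bij_witness[of _ "\<lambda>j. (i, j)" snd]) auto
    also have "\<dots> = (\<Sum>j\<in>insert 0 {1..n}. ?q (i, j))" by (rule sum.cong) auto
    also have "\<dots> = l + (\<Sum>j\<in>{1..n}. p)" using that by (simp add: prm_def)
    finally show ?thesis by simp
  qed
  have row: "(\<Sum>a\<in>{..c} \<times> {j}. ?q a) = m + real c * p" if "1 \<le> j" for j
  proof -
    have "(\<Sum>a\<in>{..c} \<times> {j}. ?q a) = (\<Sum>i\<in>{..c}. ?q (i, j))"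
      by (rule sum.reindex_bij_witness[of _ "\<lambda>i. (i, j)" fst]) auto
    also have "\<dots> = (\<Sum>i\<in>insert 0 {1..c}. ?q (i, j))" by (rule sum.cong) auto
    also have "\<dots> = m + (\<Sum>i\<in>{1..c}. p)" using that by (simp add: prm_def)
    finally show ?thesis by simp
  qed
  have "bexp ?I ?q (\<lambda>S. of_bool (\<not> good_config S)) \<le>
      bexp ?I ?q (\<lambda>S. (\<Sum>a\<in>{1} \<times> {..n}. of_bool (a \<in> S))
        + (\<Sum>i\<in>{1..c}. \<Sum>a\<in>{i} \<times> {..n}. \<Sum>b\<in>{i} \<times> {..n} - {a}. of_bool (a \<in> S \<and> b \<in> S))
        + (\<Sum>j\<in>{1..n}. \<Sum>a\<in>{..c} \<times> {j}. \<Sum>b\<in>{..c} \<times> {j} - {a}. of_bool (a \<in> S \<and> b \<in> S)))"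
    by (rule bexp_mono[OF pr not_good_config_bound]) (use assms in auto)
  also have "\<dots> = (\<Sum>a\<in>{1} \<times> {..n}. bexp ?I ?q (\<lambda>S. of_bool (a \<in> S)))
      + (\<Sum>i\<in>{1..c}. bexp ?I ?q (\<lambda>S. \<Sum>a\<in>{i} \<times> {..n}. \<Sum>b\<in>{i} \<times> {..n} - {a}. of_bool (a \<in> S \<and> b \<in> S)))
      + (\<Sum>j\<in>{1..n}. bexp ?I ?q (\<lambda>S. \<Sum>a\<in>{..c} \<times> {j}. \<Sum>b\<in>{..c} \<times> {j} - {a}. of_bool (a \<in> S \<and> b \<in> S)))"
    by (simp only: bexp_add bexp_sum[where J = "{1..c}"] bexp_sum[where J = "{1..n}"] bexp_sum[where J = "{1} \<times> {..n}"])
  also have "\<dots> \<le> (l + real n * p) + (\<Sum>i\<in>{1..c}. (l + real n * p)\<^sup>2) + (\<Sum>j\<in>{1..n}. (m + real c * p)\<^sup>2)"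
  proof (intro add_mono sum_mono)
    have "(\<Sum>a\<in>{1} \<times> {..n}. bexp ?I ?q (\<lambda>S. of_bool (a \<in> S))) = (\<Sum>a\<in>{1} \<times> {..n}. ?q a)"
      using assms by (intro sum.cong refl bexp_mem1) (auto simp: grid_def)
    then show "(\<Sum>a\<in>{1} \<times> {..n}. bexp ?I ?q (\<lambda>S. of_bool (a \<in> S))) \<le> l + real n * p"
      using col[of 1] by simp
  next
    fix i assume i: "i \<in> {1..c}"
    have "{i} \<times> {..n} \<subseteq> ?I" using i by (auto simp: grid_def)
    from bexp_pairs[OF finite_grid pr this]
    show "bexp ?I ?q (\<lambda>S. \<Sum>a\<in>{i} \<times> {..n}. \<Sum>b\<in>{i} \<times> {..n} - {a}. of_bool (a \<in> S \<and> b \<in> S)) \<le> (l + real n * p)\<^sup>2"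
      using col[of i] i by simp
  next
    fix j assume j: "j \<in> {1..n}"
    have "{..c} \<times> {j} \<subseteq> ?I" using j by (auto simp: grid_def)
    from bexp_pairs[OF finite_grid pr this]
    show "bexp ?I ?q (\<lambda>S. \<Sum>a\<in>{..c} \<times> {j}. \<Sum>b\<in>{..c} \<times> {j} - {a}. of_bool (a \<in> S \<and> b \<in> S)) \<le> (m + real c * p)\<^sup>2"
      using row[of j] j by simp
  qed
  finally show ?thesis by simp
qed

text \<open>On a good configuration the indicator of the gap equals the difference of passage times;
  on a bad one both still lie between \<open>0\<close> and \<open>1\<close>.\<close>

lemma bexp_lattice_gap:
  assumes "0 \<le> l" "l \<le> 1" "0 \<le> m" "m \<le> 1" "0 \<le> p" "p \<le> 1"
  shows "\<bar>bexp (grid c n) (prm l m p) (\<lambda>S. of_bool (lattice_gap c n S)) - discr l m p c n\<bar>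
    \<le> bexp (grid c n) (prm l m p) (\<lambda>S. of_bool (\<not> good_config S))"
proof -
  let ?q = "prm l m p" and ?I = "grid c n"
  define d where "d S = real (lpp (insert (1, 0) S) c n) - real (lpp (S - {(1, 0)}) c n)" for S
  have pr: "is_prob_on ?I ?q" using assms by (intro is_prob_prm)
  have le: "\<bar>of_bool (lattice_gap c n S) - d S\<bar> \<le> of_bool (\<not> good_config S)" for S
  proof -
    have d01: "0 \<le> d S" "d S \<le> 1" using lpp_discrepancy[of S c n] by (auto simp: d_def)
    show ?thesis
    proof (cases "good_config S")
      case True
      then have S: "(1, 0) \<notin> S" and gap: "lattice_gap c n S \<longleftrightarrow> lpp (insert (1, 0) S) c n \<noteq> lpp S c n"
        using lattice_gap_iff by (auto simp: good_config_def)
      have "S - {(1, 0)} = S" using S by simp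
      then show ?thesis using d01 True gap by (auto simp: d_def)
    next
      case False
      then show ?thesis using d01 by auto
    qed
  qed
  have "bexp ?I ?q (\<lambda>S. of_bool (lattice_gap c n S)) - discr l m p c n = bexp ?I ?q (\<lambda>S. of_bool (lattice_gap c n S) - d S)"
    by (simp add: discr_def bexp_diff d_def)
  moreover have "bexp ?I ?q (\<lambda>S. of_bool (lattice_gap c n S) - d S) \<le> bexp ?I ?q (\<lambda>S. of_bool (\<not> good_config S))"
    by (rule bexp_mono[OF pr]) (use le in \<open>simp only: abs_le_iff\<close>)
  moreover have "bexp ?I ?q (\<lambda>S. - 1 * of_bool (\<not> good_config S)) \<le> bexp ?I ?q (\<lambda>S. of_bool (lattice_gap c n S) - d S)"
  proof (rule bexp_mono[OF pr])
    fix S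
    show "- 1 * of_bool (\<not> good_config S) \<le> of_bool (lattice_gap c n S) - d S" using le[of S] by linarith
  qed
  ultimately show ?thesis unfolding bexp_cmult by linarith
qed

section \<open>Probabilities for the Poisson processes\<close>

text \<open>The parameters \<open>l\<close> and \<open>m\<close> are of order \<open>1 / K\<close>,
  and \<open>p\<close> is of order \<open>1 / K\<^sup>2\<close>. A given line of the grid thus holds
  a point with probability of order \<open>1 / K\<close> and two points with order
  \<open>1 / K\<^sup>2\<close>, and the number of lines is of order \<open>K\<close>.\<close>

lemma (in mesh) bad_limit:
  assumes "0 < b"
  shows "(\<lambda>K. bexp (grid (b * K) K) (prm (l K) (m K) (p K)) (\<lambda>S. of_bool (\<not> good_config S))) \<longlonglongrightarrow> 0"
proof -
  define B where "B K = (l K + real K * p K) + real (b * K) * (l K + real K * p K)\<^sup>2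
      + real K * (m K + real (b * K) * p K)\<^sup>2" for K
  \<comment> \<open>The bound \<open>B\<close> rewritten in rescaled parameters that converge, with
    the remaining factor \<open>1 / K\<close> in front.\<close>
  define R where "R K = inverse (real K) * ((real K * l K + (real K)\<^sup>2 * p K)
      + real b * (real K * l K + (real K)\<^sup>2 * p K)\<^sup>2 + (real K * m K + real b * ((real K)\<^sup>2 * p K))\<^sup>2)" for K
  have "R \<longlonglongrightarrow> 0 * ((lam * \<alpha> + \<alpha> * t) + real b * (lam * \<alpha> + \<alpha> * t)\<^sup>2 + (mu * t + real b * (\<alpha> * t))\<^sup>2)"
    unfolding R_def
    by (intro tendsto_mult tendsto_add tendsto_power tendsto_const lim_inverse_n src_par_lim alp_par_lim pos)
  moreover have "\<forall>\<^sub>F K in sequentially. R K = B K"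
    using eventually_gt_at_top[of 0]
  proof eventually_elim
    case (elim K)
    define k where "k = real K"
    have k: "k \<noteq> 0" using elim by (simp add: k_def)
    show ?case unfolding R_def B_def of_nat_mult k_def[symmetric] using k
      by (simp add: power2_eq_square field_simps)
  qed
  ultimately have B: "B \<longlonglongrightarrow> 0" using Lim_transform_eventually by fastforce
  show ?thesis
  proof (rule tendsto_sandwich[OF _ _ tendsto_const B])
    show "\<forall>\<^sub>F K in sequentially. 0 \<le> bexp (grid (b * K) K) (prm (l K) (m K) (p K)) (\<lambda>S. of_bool (\<not> good_config S))"
      using par_bounds by (intro always_eventually allI bexp_nonneg is_prob_prm) auto
    show "\<forall>\<^sub>F K in sequentially. bexp (grid (b * K) K) (prm (l K) (m K) (p K)) (\<lambda>S. of_bool (\<not> good_config S)) \<le> B K"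
      using eventually_gt_at_top[of 0]
    proof eventually_elim
      case (elim K)
      show ?case unfolding B_def using par_bounds assms elim by (intro bexp_not_good_config) auto
    qed
  qed
qed

subsection \<open>Occupation numbers of Poisson processes\<close>

definition hits :: "'w measure \<Rightarrow> ('w \<Rightarrow> 'a set) \<Rightarrow> ('i \<Rightarrow> 'a set) \<Rightarrow> 'i set \<Rightarrow> 'i set \<Rightarrow> 'w set" where
  "hits M A cell J T = {w \<in> space M. \<forall>i\<in>J. A w \<inter> cell i \<noteq> {} \<longleftrightarrow> i \<in> T}"

lemma poisson_process_hits:
  fixes A :: "'w \<Rightarrow> 'a::euclidean_space set"
  assumes M: "prob_space M" and PP: "poisson_process M E c A"
    and J: "finite J" "J \<noteq> {}"
    and cell: "\<And>i. i \<in> J \<Longrightarrow> cell i \<in> sets borel \<and> bounded (cell i) \<and> cell i \<subseteq> E \<and> cell i \<noteq> {}"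
    and disj: "\<And>i j. i \<in> J \<Longrightarrow> j \<in> J \<Longrightarrow> i \<noteq> j \<Longrightarrow> cell i \<inter> cell j = {}"
  shows "hits M A cell J T \<in> point_process_events M A" "hits M A cell J T \<in> sets M"
    "measure M (hits M A cell J T) = (\<Prod>i\<in>J. if i \<in> T then 1 - exp (- (c * measure lborel (cell i)))
        else exp (- (c * measure lborel (cell i))))"
proof -
  interpret prob_space M by (rule M)
  define Z where "Z i = {w \<in> space M. card (A w \<inter> cell i) = 0}" for i
  define G where "G i = (if i \<in> T then space M - Z i else Z i)" for i
  \<comment> \<open>Independence in \<open>poisson_process\<close> is indexed by the regions
    themselves, so distinct indices must have distinct cells; for disjoint cells this follows from
    their being nonempty.\<close>
  have inj: "inj_on cell J" using disj cell by (fastforce simp: inj_on_def)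
  have fin: "finite (A w \<inter> cell i)" if "w \<in> space M" "i \<in> J" for w i
    using PP cell that by (auto simp: poisson_process_def)
  have hits: "hits M A cell J T = (\<Inter>i\<in>J. G i)"
  proof (rule set_eqI)
    fix w
    have "w \<in> G i \<longleftrightarrow> w \<in> space M \<and> (A w \<inter> cell i \<noteq> {} \<longleftrightarrow> i \<in> T)" if "i \<in> J" for i
    proof (cases "w \<in> space M")
      case True
      have "card (A w \<inter> cell i) = 0 \<longleftrightarrow> A w \<inter> cell i = {}" using fin[OF True that] by simp
      then show ?thesis using True unfolding G_def Z_def by (cases "i \<in> T") simp_all
    qed (auto simp: G_def Z_def)
    then show "w \<in> hits M A cell J T \<longleftrightarrow> w \<in> (\<Inter>i\<in>J. G i)"
      using J(2) by (auto simp: hits_def)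
  qed
  have meas: "(\<lambda>w. card (A w \<inter> cell i)) \<in> M \<rightarrow>\<^sub>M count_space UNIV"
    and pr: "measure M {w \<in> space M. card (A w \<inter> cell i) = k} =
          (c * measure lborel (cell i)) ^ k / fact k * exp (- (c * measure lborel (cell i)))" if "i \<in> J" for i k
    using PP cell[OF that] by (auto simp: poisson_process_def)
  have Zsets: "Z i \<in> sets M" if "i \<in> J" for i
  proof -
    have "(\<lambda>w. card (A w \<inter> cell i)) -` {0} \<inter> space M \<in> sets M"
      using meas[OF that] by (rule measurable_sets) simp
    moreover have "(\<lambda>w. card (A w \<inter> cell i)) -` {0} \<inter> space M = Z i" by (auto simp: Z_def)
    ultimately show ?thesis by simp
  qed
  have Zprob: "prob (Z i) = exp (- (c * measure lborel (cell i)))" if "i \<in> J" for i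
    using pr[OF that, of 0] by (simp add: Z_def)
  have Gprob: "prob (G i) = (if i \<in> T then 1 - exp (- (c * measure lborel (cell i)))
        else exp (- (c * measure lborel (cell i))))" if "i \<in> J" for i
    using Zsets[OF that] Zprob[OF that] by (simp add: G_def prob_compl)
  have Gsets: "G i \<in> sets M" if "i \<in> J" for i using Zsets[OF that] by (auto simp: G_def)
  show "hits M A cell J T \<in> sets M" unfolding hits using J Gsets by (intro sets.finite_INT) auto
  show "hits M A cell J T \<in> point_process_events M A"
  proof -
    interpret S: sigma_algebra "space M" "point_process_events M A"
      unfolding point_process_events_def by (rule sigma_algebra_sigma_sets) auto
    have "Z i \<in> point_process_events M A" if "i \<in> J" for i
      unfolding point_process_events_def Z_def using cell[OF that] by (intro sigma_sets.Basic) blast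
    then have "G i \<in> point_process_events M A" if "i \<in> J" for i
      using that by (auto simp: G_def)
    then show ?thesis unfolding hits using J by (intro S.finite_INT) auto
  qed
  define D where "D = cell ` J"
  have "indep_vars (\<lambda>_. count_space UNIV) (\<lambda>B w. card (A w \<inter> B)) D"
  proof -
    have "finite D \<and> disjoint D \<and> (\<forall>B\<in>D. B \<in> sets borel \<and> bounded B \<and> B \<subseteq> E)"
      using J(1) cell disj by (fastforce simp: D_def disjoint_def)
    then show ?thesis using PP unfolding poisson_process_def by blast
  qed
  note indep = this
  define W where "W B = (\<lambda>w. card (A w \<inter> B)) -` (if B \<in> cell ` (J \<inter> T) then - {0} else {0}) \<inter> space M" for B
  have "prob (\<Inter>B\<in>D. W B) = (\<Prod>B\<in>D. prob (W B))"
    unfolding W_def using J by (intro indep_varsD[OF indep]) (auto simp: D_def)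
  moreover have WG: "W (cell i) = G i" if "i \<in> J" for i
  proof -
    have "cell i \<in> cell ` (J \<inter> T) \<longleftrightarrow> i \<in> T" using inj that by (auto simp: inj_on_def)
    then show ?thesis by (auto simp: W_def G_def Z_def)
  qed
  moreover have "(\<Inter>B\<in>D. W B) = (\<Inter>i\<in>J. G i)" using WG by (auto simp: D_def)
  moreover have "(\<Prod>B\<in>D. prob (W B)) = (\<Prod>i\<in>J. prob (G i))"
    unfolding D_def prod.reindex[OF inj] comp_def by (rule prod.cong) (simp_all add: WG)
  ultimately have "prob (\<Inter>i\<in>J. G i) = (\<Prod>i\<in>J. prob (G i))" by simp
  then show "measure M (hits M A cell J T) = (\<Prod>i\<in>J. if i \<in> T then 1 - exp (- (c * measure lborel (cell i)))
        else exp (- (c * measure lborel (cell i))))"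
    unfolding hits using Gprob by simp
qed

lemma mesh_cell_facts:
  assumes "0 < x" "0 < c" "0 < i"
  shows "mesh_cell x c i \<in> sets borel" "bounded (mesh_cell x c i)" "mesh_cell x c i \<subseteq> {0<..}"
    "mesh_cell x c i \<noteq> {}" "emeasure lborel (mesh_cell x c i) = ennreal (x / real c)"
    "measure lborel (mesh_cell x c i) = x / real c"
proof -
  have len: "x * real i / real c - x * (real i - 1) / real c = x / real c"
    by (simp add: diff_divide_distrib[symmetric] algebra_simps)
  have pos: "0 < x / real c" using assms by simp
  have lt: "x * (real i - 1) / real c < x * real i / real c" using len pos by linarith
  show "mesh_cell x c i \<in> sets borel" by (simp add: mesh_cell_def)
  show "bounded (mesh_cell x c i)"
    unfolding mesh_cell_def
    by (rule bounded_subset[OF bounded_closed_interval[of "x * (real i - 1) / real c" "x * real i / real c"]]) auto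
  have "0 \<le> x * (real i - 1) / real c" using assms by simp
  then show "mesh_cell x c i \<subseteq> {0<..}" unfolding mesh_cell_def by auto
  show "mesh_cell x c i \<noteq> {}" unfolding mesh_cell_def using lt by auto
  show "emeasure lborel (mesh_cell x c i) = ennreal (x / real c)"
    unfolding mesh_cell_def using lt len by simp
  then show "measure lborel (mesh_cell x c i) = x / real c"
    using pos by (simp add: measure_def)
qed

lemma mesh_cell_disjoint:
  assumes "0 < x" "0 < c" "0 < i" "0 < j" "i \<noteq> j"
  shows "mesh_cell x c i \<inter> mesh_cell x c j = {}"
proof (rule ccontr)
  assume "\<not> ?thesis"
  then obtain u where u: "u \<in> mesh_cell x c i" "u \<in> mesh_cell x c j" by blast
  have "0 < u" using u(1) mesh_cell_facts(3)[OF assms(1,2,3)] by auto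
  then show False using u mesh_index(1)[OF assms(1,2)] assms(5) by simp
qed

lemma measure_mesh_rectangle:
  assumes "0 < x" "0 < c" "0 < i" "0 < t" "0 < n" "0 < j"
  shows "measure lborel (mesh_cell x c i \<times> mesh_cell t n j) = x / real c * (t / real n)"
proof -
  note X = mesh_cell_facts[OF assms(1,2,3)] and T = mesh_cell_facts[OF assms(4,5,6)]
  have "emeasure lborel (mesh_cell x c i \<times> mesh_cell t n j)
      = emeasure (lborel \<Otimes>\<^sub>M lborel) (mesh_cell x c i \<times> mesh_cell t n j)"
    by (simp add: lborel_prod)
  also have "\<dots> = ennreal (x / real c) * ennreal (t / real n)"
    using X(1,5) T(1,5) by (subst lborel.emeasure_pair_measure_Times) auto
  finally show ?thesis using assms by (simp add: measure_def enn2real_mult)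
qed

section \<open>The Hammersley process on its probability space\<close>

locale hammersley_process = prob_space M for M :: "'w measure" +
  fixes sources sinks :: "'w \<Rightarrow> real set" and alphas :: "'w \<Rightarrow> (real \<times> real) set"
    and lam mu :: real
  assumes pos: "0 < lam" "0 < mu" and lm: "lam * mu < 1"
    and pp_src: "poisson_process M {0<..} lam sources"
    and pp_snk: "poisson_process M {0<..} mu sinks"
    and pp_alp: "poisson_process M ({0<..} \<times> {0<..}) 1 alphas"
    and indep: "independent_point_processes M sources sinks alphas"
begin

lemma quadrant_events_at:
  assumes "w \<in> space M"
  shows "quadrant_events (sinks w) (alphas w) (sources w)"
proof
  have src: "sources w \<subseteq> {0<..}" "\<And>B. bounded B \<Longrightarrow> finite (sources w \<inter> B)"
    and snk: "sinks w \<subseteq> {0<..}" "\<And>B. bounded B \<Longrightarrow> finite (sinks w \<inter> B)"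
    and alp: "alphas w \<subseteq> {0<..} \<times> {0<..}" "\<And>B. bounded B \<Longrightarrow> finite (alphas w \<inter> B)"
    using pp_src pp_snk pp_alp assms by (auto simp: poisson_process_def)
  show "sources w \<subseteq> {0<..}" "sinks w \<subseteq> {0<..}" "alphas w \<subseteq> {0<..} \<times> {0<..}"
    using src snk alp by blast+
  fix R t :: real
  have "sources w \<inter> {..R} = sources w \<inter> {0..R}" using src(1) by force
  then show "finite (sources w \<inter> {..R})" using src(2)[of "{0..R}"] by simp
  have "sinks w \<inter> {..t} = sinks w \<inter> {0..t}" using snk(1) by force
  then show "finite (sinks w \<inter> {..t})" using snk(2)[of "{0..t}"] by simp
  have "alphas w \<inter> {..R} \<times> {..t} = alphas w \<inter> {0..R} \<times> {0..t}" using alp(1) by force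
  then show "finite (alphas w \<inter> {..R} \<times> {..t})" using alp(2)[of "{0..R} \<times> {0..t}"] by (simp add: bounded_Times)
qed

definition occ :: "real \<Rightarrow> real \<Rightarrow> nat \<Rightarrow> nat \<Rightarrow> 'w \<Rightarrow> (nat \<times> nat) set" where
  "occ x t c n w = occupied (sources w) (sinks w) (alphas w) x t c n"

lemma occ_subset: "occ x t c n w \<subseteq> grid c n"
  by (auto simp: occ_def occupied_def)

text \<open>Source, sink and interior cells are read from three independent processes, each
  independent over disjoint cells, so the probability is the product of Bernoulli weights that
  defines \<open>bexp\<close>.\<close>

lemma occ_distribution:
  assumes "0 < x" "0 < t" "0 < c" "0 < n" and T: "T \<subseteq> grid c n"
  defines "q \<equiv> prm (1 - exp (- (lam * (x / real c)))) (1 - exp (- (mu * (t / real n)))) (1 - exp (- (x / real c * (t / real n))))"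
  shows "{w \<in> space M. occ x t c n w = T} \<in> events"
    and "prob {w \<in> space M. occ x t c n w = T} = (\<Prod>i\<in>T. q i) * (\<Prod>i\<in>grid c n - T. 1 - q i)"
proof -
  define J1 J2 J3 where "J1 = {1..c}" "J2 = {1..n}" "J3 = {1..c} \<times> {1..n}"
  define T1 T2 where "T1 = {i. (i, 0) \<in> T}" "T2 = {j. (0, j) \<in> T}"
  define E1 where "E1 = hits M sources (mesh_cell x c) J1 T1"
  define E2 where "E2 = hits M sinks (mesh_cell t n) J2 T2"
  define E3 where "E3 = hits M alphas (\<lambda>(i, j). mesh_cell x c i \<times> mesh_cell t n j) J3 T"
  have J: "finite J1" "J1 \<noteq> {}" "finite J2" "J2 \<noteq> {}" "finite J3" "J3 \<noteq> {}"
    using assms(3,4) by (auto simp: J1_J2_J3_def)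
  have cell1: "mesh_cell x c i \<in> sets borel \<and> bounded (mesh_cell x c i) \<and> mesh_cell x c i \<subseteq> {0<..} \<and> mesh_cell x c i \<noteq> {}"
    if "i \<in> J1" for i using mesh_cell_facts[OF assms(1,3)] that by (auto simp: J1_J2_J3_def)
  have cell2: "mesh_cell t n j \<in> sets borel \<and> bounded (mesh_cell t n j) \<and> mesh_cell t n j \<subseteq> {0<..} \<and> mesh_cell t n j \<noteq> {}"
    if "j \<in> J2" for j using mesh_cell_facts[OF assms(2,4)] that by (auto simp: J1_J2_J3_def)
  have disj1: "mesh_cell x c i \<inter> mesh_cell x c j = {}" if "i \<in> J1" "j \<in> J1" "i \<noteq> j" for i j
    using mesh_cell_disjoint[OF assms(1,3)] that by (auto simp: J1_J2_J3_def)
  have disj2: "mesh_cell t n i \<inter> mesh_cell t n j = {}" if "i \<in> J2" "j \<in> J2" "i \<noteq> j" for i j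
    using mesh_cell_disjoint[OF assms(2,4)] that by (auto simp: J1_J2_J3_def)
  have J3: "ij \<in> J3 \<longleftrightarrow> fst ij \<in> J1 \<and> snd ij \<in> J2" for ij by (cases ij) (auto simp: J1_J2_J3_def)
  have cell3: "(case ij of (i, j) \<Rightarrow> mesh_cell x c i \<times> mesh_cell t n j) \<in> sets borel
      \<and> bounded (case ij of (i, j) \<Rightarrow> mesh_cell x c i \<times> mesh_cell t n j)
      \<and> (case ij of (i, j) \<Rightarrow> mesh_cell x c i \<times> mesh_cell t n j) \<subseteq> {0<..} \<times> {0<..}
      \<and> (case ij of (i, j) \<Rightarrow> mesh_cell x c i \<times> mesh_cell t n j) \<noteq> {}" if "ij \<in> J3" for ij
  proof -
    obtain i j where ij: "ij = (i, j)" by (cases ij)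
    have c: "i \<in> J1" "j \<in> J2" using that J3[of ij] ij by auto
    have "mesh_cell x c i \<times> mesh_cell t n j \<in> sets borel"
      using cell1[OF c(1)] cell2[OF c(2)] by (intro borel_Times) auto
    then show ?thesis using cell1[OF c(1)] cell2[OF c(2)] unfolding ij by (auto intro!: bounded_Times)
  qed
  have disj3: "(case ij of (i, j) \<Rightarrow> mesh_cell x c i \<times> mesh_cell t n j) \<inter> (case kl of (i, j) \<Rightarrow> mesh_cell x c i \<times> mesh_cell t n j) = {}"
    if "ij \<in> J3" "kl \<in> J3" "ij \<noteq> kl" for ij kl
  proof -
    obtain i j k l where ij: "ij = (i, j)" "kl = (k, l)" by (cases ij, cases kl) blast
    have "i \<in> J1" "j \<in> J2" "k \<in> J1" "l \<in> J2" using that J3[of ij] J3[of kl] ij by auto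
    then have "i \<noteq> k \<Longrightarrow> mesh_cell x c i \<inter> mesh_cell x c k = {}" "j \<noteq> l \<Longrightarrow> mesh_cell t n j \<inter> mesh_cell t n l = {}"
      using disj1 disj2 by auto
    then show ?thesis using that(3) ij by (auto simp: Times_Int_Times)
  qed
  note h1 = poisson_process_hits[where cell = "mesh_cell x c" and T = T1, OF prob_space_axioms pp_src J(1,2) cell1 disj1, folded E1_def]
  note h2 = poisson_process_hits[where cell = "mesh_cell t n" and T = T2, OF prob_space_axioms pp_snk J(3,4) cell2 disj2, folded E2_def]
  note h3 = poisson_process_hits[where cell = "\<lambda>(i, j). mesh_cell x c i \<times> mesh_cell t n j" and T = T,
      OF prob_space_axioms pp_alp J(5,6) cell3 disj3, folded E3_def]
  have eq: "{w \<in> space M. occ x t c n w = T} = E1 \<inter> E2 \<inter> E3"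
  proof (rule set_eqI)
    fix w
    have "occ x t c n w = T \<longleftrightarrow> (\<forall>i j. (i, j) \<in> grid c n \<longrightarrow> ((i, j) \<in> occ x t c n w \<longleftrightarrow> (i, j) \<in> T))"
      using occ_subset[of x t c n w] T by auto
    also have "\<dots> \<longleftrightarrow> (\<forall>i\<in>J1. (i, 0) \<in> occ x t c n w \<longleftrightarrow> i \<in> T1) \<and> (\<forall>j\<in>J2. (0, j) \<in> occ x t c n w \<longleftrightarrow> j \<in> T2)
        \<and> (\<forall>ij\<in>J3. ij \<in> occ x t c n w \<longleftrightarrow> ij \<in> T)"
    proof
      assume *: "\<forall>i j. (i, j) \<in> grid c n \<longrightarrow> ((i, j) \<in> occ x t c n w \<longleftrightarrow> (i, j) \<in> T)"
      show "(\<forall>i\<in>J1. (i, 0) \<in> occ x t c n w \<longleftrightarrow> i \<in> T1) \<and> (\<forall>j\<in>J2. (0, j) \<in> occ x t c n w \<longleftrightarrow> j \<in> T2)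
        \<and> (\<forall>ij\<in>J3. ij \<in> occ x t c n w \<longleftrightarrow> ij \<in> T)"
        using * by (auto simp: J1_J2_J3_def T1_T2_def grid_def)
    next
      assume *: "(\<forall>i\<in>J1. (i, 0) \<in> occ x t c n w \<longleftrightarrow> i \<in> T1) \<and> (\<forall>j\<in>J2. (0, j) \<in> occ x t c n w \<longleftrightarrow> j \<in> T2)
        \<and> (\<forall>ij\<in>J3. ij \<in> occ x t c n w \<longleftrightarrow> ij \<in> T)"
      show "\<forall>i j. (i, j) \<in> grid c n \<longrightarrow> ((i, j) \<in> occ x t c n w \<longleftrightarrow> (i, j) \<in> T)"
      proof (intro allI impI)
        fix i j assume ij: "(i, j) \<in> grid c n"
        consider "j = 0" "i \<in> J1" | "i = 0" "j \<in> J2" | "(i, j) \<in> J3"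
          using ij by (cases "i = 0"; cases "j = 0") (auto simp: grid_def J1_J2_J3_def)
        then show "(i, j) \<in> occ x t c n w \<longleftrightarrow> (i, j) \<in> T"
          using * by cases (auto simp: T1_T2_def)
      qed
    qed
    also have "\<dots> \<longleftrightarrow> (\<forall>i\<in>J1. sources w \<inter> mesh_cell x c i \<noteq> {} \<longleftrightarrow> i \<in> T1) \<and> (\<forall>j\<in>J2. sinks w \<inter> mesh_cell t n j \<noteq> {} \<longleftrightarrow> j \<in> T2)
        \<and> (\<forall>ij\<in>J3. alphas w \<inter> (case ij of (i, j) \<Rightarrow> mesh_cell x c i \<times> mesh_cell t n j) \<noteq> {} \<longleftrightarrow> ij \<in> T)"
    proof -
      have "(i, 0) \<in> occ x t c n w \<longleftrightarrow> sources w \<inter> mesh_cell x c i \<noteq> {}" if "i \<in> J1" for i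
        using that by (simp add: occ_def occupied_def grid_def J1_J2_J3_def)
      moreover have "(0, j) \<in> occ x t c n w \<longleftrightarrow> sinks w \<inter> mesh_cell t n j \<noteq> {}" if "j \<in> J2" for j
        using that by (simp add: occ_def occupied_def grid_def J1_J2_J3_def)
      moreover have "ij \<in> occ x t c n w \<longleftrightarrow> alphas w \<inter> (case ij of (i, j) \<Rightarrow> mesh_cell x c i \<times> mesh_cell t n j) \<noteq> {}"
        if "ij \<in> J3" for ij
        using that by (cases ij) (simp add: occ_def occupied_def grid_def J1_J2_J3_def)
      ultimately show ?thesis by simp
    qed
    finally show "w \<in> {w \<in> space M. occ x t c n w = T} \<longleftrightarrow> w \<in> E1 \<inter> E2 \<inter> E3"
      by (auto simp only: E1_def E2_def E3_def hits_def mem_Collect_eq Int_iff)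
  qed
  show "{w \<in> space M. occ x t c n w = T} \<in> events"
    unfolding eq using h1(2) h2(2) h3(2) by auto
  have "prob (\<Inter>j\<in>{0, 1, 2::nat}. [E1, E2, E3] ! j) = (\<Prod>j\<in>{0, 1, 2::nat}. prob ([E1, E2, E3] ! j))"
    using indep unfolding independent_point_processes_def
    by (rule indep_setsD) (use h1(1) h2(1) h3(1) in auto)
  then have "prob (E1 \<inter> E2 \<inter> E3) = prob E1 * prob E2 * prob E3"
    by (simp add: Int_assoc mult.assoc)
  moreover have "prob E1 = (\<Prod>i\<in>J1. if (i, 0) \<in> T then q (i, 0) else 1 - q (i, 0))"
    by (rule trans[OF h1(3) prod.cong]) (use mesh_cell_facts(6)[OF assms(1,3)] in \<open>auto simp: J1_J2_J3_def T1_T2_def q_def prm_def\<close>)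
  moreover have "prob E2 = (\<Prod>j\<in>J2. if (0, j) \<in> T then q (0, j) else 1 - q (0, j))"
    by (rule trans[OF h2(3) prod.cong]) (use mesh_cell_facts(6)[OF assms(2,4)] in \<open>auto simp: J1_J2_J3_def T1_T2_def q_def prm_def\<close>)
  moreover have "prob E3 = (\<Prod>ij\<in>J3. if ij \<in> T then q ij else 1 - q ij)"
    by (rule trans[OF h3(3) prod.cong]) (use measure_mesh_rectangle[OF assms(1,3) _ assms(2,4)] in \<open>auto simp: J1_J2_J3_def q_def prm_def\<close>)
  moreover have "(\<Prod>i\<in>T. q i) * (\<Prod>i\<in>grid c n - T. 1 - q i) = (\<Prod>i\<in>grid c n. if i \<in> T then q i else 1 - q i)"
  proof -
    have "grid c n \<inter> {i. i \<in> T} = T" "grid c n \<inter> - {i. i \<in> T} = grid c n - T" using T by auto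
    then show ?thesis by (simp add: prod.If_cases)
  qed
  moreover have "(\<Prod>i\<in>grid c n. g i) = (\<Prod>i\<in>J1. g (i, 0)) * (\<Prod>j\<in>J2. g (0, j)) * (\<Prod>ij\<in>J3. g ij)" for g :: "nat \<times> nat \<Rightarrow> real"
  proof -
    have "grid c n = ((\<lambda>i. (i, 0)) ` J1 \<union> Pair 0 ` J2) \<union> J3"
    proof (rule set_eqI)
      fix ij :: "nat \<times> nat"
      obtain i j where "ij = (i, j)" by (cases ij)
      then show "ij \<in> grid c n \<longleftrightarrow> ij \<in> ((\<lambda>i. (i, 0)) ` J1 \<union> Pair 0 ` J2) \<union> J3"
        by (cases "i = 0"; cases "j = 0") (auto simp: grid_def J1_J2_J3_def)
    qed
    moreover have "prod g (((\<lambda>i. (i, 0)) ` J1 \<union> Pair 0 ` J2) \<union> J3)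
        = prod g ((\<lambda>i. (i, 0)) ` J1) * prod g (Pair 0 ` J2) * prod g J3"
      using J by (subst prod.union_disjoint; (subst prod.union_disjoint)?) (auto simp: J1_J2_J3_def)
    ultimately show ?thesis by (simp add: prod.reindex inj_on_def)
  qed
  ultimately show "prob {w \<in> space M. occ x t c n w = T} = (\<Prod>i\<in>T. q i) * (\<Prod>i\<in>grid c n - T. 1 - q i)"
    unfolding eq by simp
qed

text \<open>\<open>occ\<close> takes finitely many values, so every property \<open>P\<close> of it
  describes a finite union of the events in \<open>occ_distribution\<close>.\<close>

lemma prob_occ:
  assumes "0 < x" "0 < t" "0 < b" "0 < K"
  shows "{w \<in> space M. P (occ x t (b * K) K w)} \<in> events"
    and "prob {w \<in> space M. P (occ x t (b * K) K w)}
      = bexp (grid (b * K) K) (prm (src_par lam (x / real b) K) (src_par mu t K) (alp_par (x / real b) t K)) (\<lambda>S. of_bool (P S))"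
proof -
  let ?c = "b * K"
  let ?q = "prm (src_par lam (x / real b) K) (src_par mu t K) (alp_par (x / real b) t K)"
  define \<T> where "\<T> = {T \<in> Pow (grid ?c K). P T}"
  define V where "V T = {w \<in> space M. occ x t ?c K w = T}" for T
  have c: "0 < ?c" using assms by simp
  have q: "?q = prm (1 - exp (- (lam * (x / real ?c)))) (1 - exp (- (mu * (t / real K)))) (1 - exp (- (x / real ?c * (t / real K))))"
    by (simp add: src_par_def alp_par_def power2_eq_square mult.assoc)
  have fin: "finite \<T>" by (simp add: \<T>_def)
  have V: "V T \<in> events" "prob (V T) = (\<Prod>i\<in>T. ?q i) * (\<Prod>i\<in>grid ?c K - T. 1 - ?q i)" if "T \<in> \<T>" for T
    using occ_distribution[OF assms(1,2) c assms(4), of T] that unfolding q V_def \<T>_def by auto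
  have eq: "{w \<in> space M. P (occ x t ?c K w)} = (\<Union>T\<in>\<T>. V T)"
    using occ_subset by (auto simp: \<T>_def V_def)
  show "{w \<in> space M. P (occ x t ?c K w)} \<in> events"
    unfolding eq using fin V(1) by (intro sets.finite_UN) auto
  have "prob (\<Union>T\<in>\<T>. V T) = (\<Sum>T\<in>\<T>. prob (V T))"
    using fin V(1) by (intro finite_measure_finite_Union) (auto simp: disjoint_family_on_def V_def)
  also have "\<dots> = (\<Sum>T\<in>\<T>. (\<Prod>i\<in>T. ?q i) * (\<Prod>i\<in>grid ?c K - T. 1 - ?q i))"
    using V(2) by (intro sum.cong) auto
  also have "\<dots> = bexp (grid ?c K) ?q (\<lambda>S. of_bool (P S))"
    unfolding bexp_def \<T>_def by (intro sum.mono_neutral_cong_left) auto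
  finally show "prob {w \<in> space M. P (occ x t ?c K w)} = bexp (grid ?c K) ?q (\<lambda>S. of_bool (P S))"
    unfolding eq .
qed

text \<open>On this event the second class particle is at a position at most \<open>x\<close> at time \<open>t\<close>.\<close>

definition present :: "real \<Rightarrow> real \<Rightarrow> 'w set" where
  "present x t = {w \<in> space M. hammersley_restricted (insert 0 (sources w)) (sinks w) (alphas w) x t
     \<noteq> hammersley_restricted (sources w) (sinks w) (alphas w) x t}"

text \<open>For each outcome membership in \<open>present x t\<close> is decided by the grid for
  large \<open>K\<close>. This yields measurability, as a limit inferior of events, and convergence
  of the probabilities by dominated convergence; bad configurations account for the difference to
  \<open>mesh_discr\<close>.\<close>

lemma present_limit:
  assumes "0 < x" "0 < t" "0 < b"
  shows "present x t \<in> events"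
    and "(\<lambda>K. mesh_discr lam mu (x / real b) t (b * K) K) \<longlonglongrightarrow> prob (present x t)"
proof -
  define H where "H K = {w \<in> space M. lattice_gap (b * K) K (occ x t (b * K) K w)}" for K
  have ev: "\<forall>\<^sub>F K in sequentially. w \<in> H K \<longleftrightarrow> w \<in> present x t" if "w \<in> space M" for w
    using quadrant_events.eventually_lattice_gap_occupied[OF quadrant_events_at[OF that] assms]
    by eventually_elim (use that in \<open>simp add: H_def present_def occ_def\<close>)
  \<comment> \<open>The shift by one avoids the empty mesh \<open>K = 0\<close>.\<close>
  have Hsets: "H (Suc k) \<in> events" for k
    unfolding H_def by (rule prob_occ[OF assms zero_less_Suc])
  have "present x t = {w \<in> space M. \<exists>N. \<forall>k\<ge>N. w \<in> H (Suc k)}"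
  proof (rule set_eqI)
    fix w
    show "w \<in> present x t \<longleftrightarrow> w \<in> {w \<in> space M. \<exists>N. \<forall>k\<ge>N. w \<in> H (Suc k)}"
    proof (cases "w \<in> space M")
      case True
      obtain N where N: "\<And>K. K \<ge> N \<Longrightarrow> w \<in> H K \<longleftrightarrow> w \<in> present x t"
        using ev[OF True] unfolding eventually_sequentially by blast
      show ?thesis
      proof
        assume "w \<in> present x t"
        then have "\<forall>k\<ge>N. w \<in> H (Suc k)" using N by simp
        then show "w \<in> {w \<in> space M. \<exists>N. \<forall>k\<ge>N. w \<in> H (Suc k)}" using True by blast
      next
        assume "w \<in> {w \<in> space M. \<exists>N. \<forall>k\<ge>N. w \<in> H (Suc k)}"
        then obtain N' where "\<forall>k\<ge>N'. w \<in> H (Suc k)" by blast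
        then have "w \<in> H (Suc (max N N'))" by simp
        then show "w \<in> present x t" using N[of "Suc (max N N')"] by simp
      qed
    qed (simp add: present_def)
  qed
  moreover have "{w \<in> space M. \<exists>N. \<forall>k\<ge>N. w \<in> H (Suc k)} \<in> events"
    using Hsets by measurable
  ultimately show sets: "present x t \<in> events" by (simp only:)
  have "(\<lambda>k. \<integral>w. indicat_real (H (Suc k)) w \<partial>M) \<longlonglongrightarrow> (\<integral>w. indicat_real (present x t) w \<partial>M)"
  proof (rule integral_dominated_convergence[where w = "\<lambda>_. 1"])
    show "AE w in M. (\<lambda>k. indicat_real (H (Suc k)) w) \<longlonglongrightarrow> indicat_real (present x t) w"
    proof (rule AE_I2)
      fix w assume "w \<in> space M"
      then have "\<forall>\<^sub>F k in sequentially. w \<in> H (Suc k) \<longleftrightarrow> w \<in> present x t"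
        using ev eventually_sequentially_Suc[of "\<lambda>K. w \<in> H K \<longleftrightarrow> w \<in> present x t"] by simp
      then have "\<forall>\<^sub>F k in sequentially. indicat_real (H (Suc k)) w = indicat_real (present x t) w"
        by eventually_elim (simp add: indicator_def)
      then show "(\<lambda>k. indicat_real (H (Suc k)) w) \<longlonglongrightarrow> indicat_real (present x t) w"
        by (rule tendsto_eventually)
    qed
  qed (use sets Hsets in \<open>auto simp: indicator_def\<close>)
  then have lim: "(\<lambda>k. prob (H (Suc k))) \<longlonglongrightarrow> prob (present x t)"
    using sets Hsets sets.Int_space_eq2[OF Hsets] by (simp add: sets.Int_space_eq1 sets.Int_space_eq2)
  interpret mesh lam mu "x / real b" t
    using assms pos lm by (simp add: mesh_def)
  define D where "D k = prob (H (Suc k)) - mesh_discr lam mu (x / real b) t (b * Suc k) (Suc k)" for k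
  define Bd where "Bd K = bexp (grid (b * K) K) (prm (l K) (m K) (p K)) (\<lambda>S. of_bool (\<not> good_config S))" for K
  have "\<bar>D k\<bar> \<le> Bd (Suc k)" for k
    using bexp_lattice_gap[OF par_bounds, of "b * Suc k" "Suc k" "Suc k" "Suc k" "Suc k"]
    unfolding D_def Bd_def H_def prob_occ(2)[OF assms zero_less_Suc] mesh_discr_def by simp
  moreover have "(\<lambda>k. Bd (Suc k)) \<longlonglongrightarrow> 0"
    unfolding Bd_def using LIMSEQ_Suc[OF bad_limit[OF assms(3)]] .
  ultimately have "D \<longlonglongrightarrow> 0"
    by (intro Lim_null_comparison[of D "\<lambda>k. Bd (Suc k)"]) auto
  then have "(\<lambda>k. prob (H (Suc k)) - D k) \<longlonglongrightarrow> prob (present x t) - 0"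
    by (intro tendsto_diff lim)
  then have "(\<lambda>k. mesh_discr lam mu (x / real b) t (b * Suc k) (Suc k)) \<longlonglongrightarrow> prob (present x t)"
    by (simp add: D_def)
  then show "(\<lambda>K. mesh_discr lam mu (x / real b) t (b * K) K) \<longlonglongrightarrow> prob (present x t)"
    by (rule LIMSEQ_imp_Suc)
qed

text \<open>The complement of \<open>present x t\<close> also contains the outcomes without any
  extra particle. That these form a null set is deduced afterwards from \<open>Q_escape\<close> for
  this very \<open>Q\<close>.\<close>

sublocale mesh_limit lam mu "\<lambda>x t. 1 - prob (present x t)"
proof
  fix x t :: real and b :: nat
  assume "0 < x" "0 < t" "0 < b"
  then show "(\<lambda>K. 1 - mesh_discr lam mu (x / real b) t (b * K) K) \<longlonglongrightarrow> 1 - prob (present x t)"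
    by (intro tendsto_diff tendsto_const present_limit)
qed (use pos lm in auto)

lemma prob_second_class_particle_gt:
  assumes "0 < x" "0 < t"
  shows "prob {w \<in> space M. second_class_particle (sources w) (sinks w) (alphas w) t > x} = 1 - prob (present x t)"
proof -
  \<comment> \<open>The outcomes in which the two configurations agree everywhere, so that the
    particle has no position.\<close>
  define N where "N = (\<Inter>n::nat. space M - present (real (Suc n)) t)"
  have sets: "present x t \<in> events" "\<And>n. present (real (Suc n)) t \<in> events"
    using present_limit(1)[OF _ assms(2), of _ 1] assms(1) by auto
  have Nsets: "N \<in> events" unfolding N_def using sets(2) by (intro sets.countable_INT) auto
  have "prob N = 0"
  proof (rule ccontr)
    assume "prob N \<noteq> 0"
    then have "0 < prob N / 2" using measure_nonneg[of M N] by linarith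
    from Q_escape[OF assms(2) this] obtain R where R: "\<And>y. R \<le> y \<Longrightarrow> 1 - prob (present y t) \<le> prob N / 2"
      unfolding eventually_at_top_linorder by blast
    obtain n :: nat where n: "R \<le> real n" using real_arch_simple by blast
    have "prob N \<le> prob (space M - present (real (Suc n)) t)"
      using sets(2) by (intro finite_measure_mono) (auto simp: N_def)
    also have "\<dots> = 1 - prob (present (real (Suc n)) t)" using sets(2) by (rule prob_compl)
    also have "\<dots> \<le> prob N / 2" using n by (intro R) simp
    finally show False using \<open>0 < prob N / 2\<close> by linarith
  qed
  then have "N \<in> null_sets M" using Nsets by (simp add: null_sets_def emeasure_eq_measure)
  then have AEN: "AE w in M. w \<notin> N" by (rule AE_not_in)
  define X where "X = {w \<in> space M. second_class_particle (sources w) (sinks w) (alphas w) t > x}"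
  have mem: "w \<in> X \<longleftrightarrow> (w \<notin> present x t \<and> w \<notin> N) \<or> (w \<in> N \<and> (THE x::real. False) > x)"
    if "w \<in> space M" for w
  proof -
    interpret quadrant_events "sinks w" "alphas w" "sources w" by (rule quadrant_events_at[OF that])
    show ?thesis
      using that by (auto simp: X_def N_def present_def second_class_particle_gt simp del: of_nat_Suc)
  qed
  \<comment> \<open>On \<open>N\<close> the description has one fixed value, so \<open>X\<close>
    contains all of \<open>N\<close> or none of it.\<close>
  have "X = (space M - present x t - N) \<union> (if (THE x::real. False) > x then N else {})"
    using mem sets.sets_into_space[OF Nsets] by (auto simp: X_def)
  then have Xsets: "X \<in> events" using sets(1) Nsets by auto
  have "prob X = prob (space M - present x t)"
  proof (rule finite_measure_eq_AE)
    show "AE w in M. w \<in> X \<longleftrightarrow> w \<in> space M - present x t"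
      using AEN AE_space by eventually_elim (use mem in auto)
  qed (use Xsets sets in auto)
  then show ?thesis using sets(1) by (simp add: X_def prob_compl)
qed

text \<open>The mesh requires a positive time. At time \<open>0\<close> no event has occurred, and
  the extra particle is still at the origin.\<close>

lemma second_class_particle_time_0:
  assumes "w \<in> space M" "0 < x"
  shows "\<not> second_class_particle (sources w) (sinks w) (alphas w) 0 > x"
proof -
  interpret quadrant_events "sinks w" "alphas w" "sources w" by (rule quadrant_events_at[OF assms(1)])
  have "event_times (sinks w) (alphas w) R 0 = {}" for R
    using positive by (force simp: event_times_def)
  then have "hammersley_restricted src (sinks w) (alphas w) R 0 = src \<inter> {..R}" for src R
    by (simp add: hammersley_restricted_def event_list_alt)
  moreover have "insert 0 (sources w) \<inter> {..R} \<noteq> sources w \<inter> {..R}" if "0 \<le> R" for R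
  proof -
    have "0 \<in> insert 0 (sources w) \<inter> {..R}" "0 \<notin> sources w \<inter> {..R}" using that positive(1) by auto
    then show ?thesis by metis
  qed
  ultimately show ?thesis using assms(2) by (auto simp: second_class_particle_gt simp del: of_nat_Suc)
qed

lemma clamp_slope_value:
  "(clamp_slope (sqrt a) - lam) / (1 / mu - lam) = (if a \<ge> 1 / mu\<^sup>2 then 1
    else if a \<ge> lam\<^sup>2 then (sqrt a - lam) / (1 / mu - lam) else 0)"
proof -
  have ge: "v\<^sup>2 \<le> a \<longleftrightarrow> v \<le> sqrt a" if "0 \<le> v" for v
    using that real_sqrt_le_iff[of "v\<^sup>2" a] by simp
  have "a \<ge> 1 / mu\<^sup>2 \<longleftrightarrow> sqrt a \<ge> 1 / mu"
    using ge[of "1 / mu"] pos by (simp only: power_divide power_one) simp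
  moreover have "a \<ge> lam\<^sup>2 \<longleftrightarrow> sqrt a \<ge> lam" using ge[of lam] pos by simp
  ultimately show ?thesis using lam_less by (auto simp: clamp_slope_def)
qed

end

theorem theorem2p5:
  fixes M :: "'w measure"
    and sources sinks :: "'w \<Rightarrow> real set"
    and alphas :: "'w \<Rightarrow> (real \<times> real) set"
    and lam mu a :: real
  assumes "prob_space M"
    and "lam > 0" and "mu > 0" and "lam * mu < 1"
    and "poisson_process M {0<..} lam sources"
    and "poisson_process M {0<..} mu sinks"
    and "poisson_process M ({0<..} \<times> {0<..}) 1 alphas"
    and "independent_point_processes M sources sinks alphas"
    and "a \<ge> 0"
  shows "((\<lambda>x::real. measure M {w \<in> space M.
            second_class_particle (sources w) (sinks w) (alphas w) (a * x) > x})
          \<longlongrightarrow> (if a \<ge> 1 / mu\<^sup>2 then 1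
              else if a \<ge> lam\<^sup>2 then (sqrt a - lam) / (1 / mu - lam)
              else 0)) at_top"
proof -
  interpret hammersley_process M sources sinks alphas lam mu
    using assms by (simp add: hammersley_process_def hammersley_process_axioms_def)
  show ?thesis
  \<comment> \<open>For \<open>a = 0\<close> the time is \<open>0\<close> for every
    \<open>x\<close>, so the limit along positive times does not apply.\<close>
  proof (cases "a = 0")
    case True
    have "\<forall>\<^sub>F x in at_top. 0 = measure M {w \<in> space M. second_class_particle (sources w) (sinks w) (alphas w) (a * x) > x}"
      using eventually_gt_at_top[of 0]
    proof eventually_elim
      case (elim x)
      have none: "{w \<in> space M. second_class_particle (sources w) (sinks w) (alphas w) (a * x) > x} = {}"
        using second_class_particle_time_0[OF _ elim] True by auto
      show ?case unfolding none by simp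
    qed
    then have "((\<lambda>x. measure M {w \<in> space M. second_class_particle (sources w) (sinks w) (alphas w) (a * x) > x})
        \<longlongrightarrow> 0) at_top"
      by (rule Lim_transform_eventually[OF tendsto_const])
    moreover have "\<not> 1 / mu\<^sup>2 \<le> a" "\<not> lam\<^sup>2 \<le> a" using True assms by auto
    ultimately show ?thesis by simp
  next
    case False
    then have a: "0 < a" using assms by simp
    have "\<forall>\<^sub>F x in at_top. 1 - prob (present x (a * x))
        = measure M {w \<in> space M. second_class_particle (sources w) (sinks w) (alphas w) (a * x) > x}"
      using eventually_gt_at_top[of 0]
    proof eventually_elim
      case (elim x)
      show ?case using prob_second_class_particle_gt[OF elim] a elim by simp
    qed
    from Lim_transform_eventually[OF Q_limit[OF a] this]
    show ?thesis unfolding clamp_slope_value .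
  qed
qed

end
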